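(* Let $q$ be a prime and let $K$ be a field. Suppose that either - $\mathrm{char}(K)=q$ and $G:=K^{(q)}$, or - $\mathrm{char}(K)\neq q$, $\zeta_q\in K$, $G:=(K^\times)^q$, and if $q=2$ then $K$ is not euclidean. Assume that for $\mathcal{N}=\{U\in\mathcal{T}_G\mid 0\in U\}$ the following hold: (V1) $\bigcap_{U\in\mathcal{N}}U=\{0\}$ and $\{0\}\notin\mathcal{N}$; (V2) $\forall U,V\in\mathcal{N}\ \exists W\in\mathcal{N}:\ W\subseteq U\cap V$; (V3) $\forall U\in\mathcal{N}\ \exists V\in\mathcal{N}:\ V-V\subseteq U$; (V4) $\forall U\in\mathcal{N}\ \forall x,y\in K\ \exists V\in\mathcal{N}:\ (x+V)\cdot(y+V)\subseteq x\cdot y+U$; (V5) $\forall U\in\mathcal{N}\ \forall x\in K^\times\ \exists V\in\mathcal{N}:\ (x+V)^{-1}\subseteq x^{-1}+U$; (V6) $\forall U\in\mathcal{N}\ \exists V\in\mathcal{N}\ \forall x,y\in K:\ x\cdot y\in V\Rightarrow x\in U\ \vee\ y\in U$. Then $K$ admits a non-trivial $\emptyset$-definable valuation.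
   Context: For $\mathrm{char}(K)=q>0$, $K^{(q)}=\{x^q-x\mid x\in K\}$ is the Artin--Schreier group, an additive subgroup of $K$. $(K^\times)^q=\{x^q\mid x\in K^\times\}$ is a multiplicative subgroup of $K^\times$. $\zeta_q$ denotes a primitive $q$-th root of unity. $K$ is euclidean if $K^2=\{x^2\mid x\in K\}$ is the positive cone of an ordering on $K$. For an additive subgroup $G$ of $K$, $\mathcal{T}_G$ denotes the coarsest topology on $K$ for which $G$ is open and all Möbius transformations are continuous; explicitly, it is the topology with subbase consisting of all sets $\left\{\frac{ax+b}{cx+d}\mid x\in G,\ cx\neq -d\right\}$ with $a,b,c,d\in K$, $ad-bc\neq0$. For a multiplicative subgroup $G$ of $K^\times$, $\mathcal{T}_G$ denotes the coarsest topology on $K$ for which $G$ is open and all linear transformations $x\mapsto ax+b$ ($a\in K^\times$, $b\in K$) are continuous; explicitly, it is the topology with subbase consisting of all sets $a\cdot G+b$ with $a\in K^\times$, $b\in K$. A valuation is $\emptyset$-definable if its valuation ring is definable in $K$ by a first-order formula in the language of rings without parameters. *)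

theory Defs
  imports "HOL-Analysis.Abstract_Topology" "HOL-Computational_Algebra.Primes" "HOL-Algebra.Group"
begin

section \<open>The subgroups\<close>

definition artin_schreier_group :: "nat \<Rightarrow> 'a::field set" where
  "artin_schreier_group q = {x ^ q - x | x. True}"

definition unit_powers :: "nat \<Rightarrow> 'a::field set" where
  "unit_powers q = {x ^ q | x. x \<noteq> 0}"

definition primitive_root_of_unity :: "nat \<Rightarrow> 'a::field \<Rightarrow> bool" where
  "primitive_root_of_unity q \<zeta> \<longleftrightarrow> \<zeta> ^ q = 1 \<and> (\<forall>k. 0 < k \<and> k < q \<longrightarrow> \<zeta> ^ k \<noteq> 1)"


section \<open>Euclidean fields\<close>

text \<open>A pair \<open>(x, y)\<close> in the relation \<open>r\<close> means \<open>x \<le> y\<close>.\<close>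

definition field_ordering :: "'a::field rel \<Rightarrow> bool" where
  "field_ordering r \<longleftrightarrow> linear_order_on UNIV r \<and>
     (\<forall>x y z. (x, y) \<in> r \<longrightarrow> (x + z, y + z) \<in> r) \<and>
     (\<forall>x y. (0, x) \<in> r \<and> (0, y) \<in> r \<longrightarrow> (0, x * y) \<in> r)"

definition positive_cone :: "'a::field rel \<Rightarrow> 'a set" where
  "positive_cone r = {x. (0, x) \<in> r}"

definition euclidean_field :: "'a::field itself \<Rightarrow> bool" where
  "euclidean_field _ \<longleftrightarrow> (\<exists>r :: 'a rel. field_ordering r \<and> positive_cone r = {x ^ 2 | x. True})"


section \<open>The topologies induced by a subgroup\<close>

definition additive_group_topology :: "'a::field set \<Rightarrow> 'a topology" where
  "additive_group_topology G = topology_generated_by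
     {{(a * x + b) / (c * x + d) | x. x \<in> G \<and> c * x \<noteq> - d} | a b c d. a * d - b * c \<noteq> 0}"

definition multiplicative_group_topology :: "'a::field set \<Rightarrow> 'a topology" where
  "multiplicative_group_topology G = topology_generated_by
     {{a * x + b | x. x \<in> G} | a b. a \<noteq> 0}"

text \<open>The carrier of a topology generated by a subbase is the union of the subbase; here
  it is the whole field.\<close>

lemma topspace_additive_group_topology:
  fixes G :: "'a::field set"
  assumes "0 \<in> G"
  shows "topspace (additive_group_topology G) = UNIV"
proof -
  have "y \<in> topspace (additive_group_topology G)" for y :: 'a
  proof -
    let ?S = "{(1 * x + y) / (0 * x + 1) | x. x \<in> G \<and> 0 * x \<noteq> - 1}"
    have "1 * 1 - y * 0 \<noteq> (0 :: 'a)"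
      by simp
    then have "openin (additive_group_topology G) ?S"
      unfolding additive_group_topology_def by (intro topology_generated_by_Basis) blast
    moreover have "y \<in> ?S"
      using assms by simp
    ultimately show ?thesis
      using openin_subset by blast
  qed
  then show ?thesis
    by blast
qed

lemma topspace_multiplicative_group_topology:
  fixes G :: "'a::field set"
  assumes "1 \<in> G"
  shows "topspace (multiplicative_group_topology G) = UNIV"
proof -
  have "y \<in> topspace (multiplicative_group_topology G)" for y :: 'a
  proof -
    let ?S = "{1 * x + (y - 1) | x. x \<in> G}"
    have "openin (multiplicative_group_topology G) ?S"
      unfolding multiplicative_group_topology_def
      by (intro topology_generated_by_Basis) (use one_neq_zero in blast)
    moreover have "y \<in> ?S"
      using assms by force
    ultimately show ?thesis
      using openin_subset by blast
  qed
  then show ?thesis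
    by blast
qed


section \<open>Valuations\<close>

text \<open>The value group is an ordered abelian group; following the group library it is written
  multiplicatively, so its neutral element \<open>\<one>\<close> is the \<open>0\<close> of the usual additive notation.
  A pair \<open>(\<alpha>, \<beta>)\<close> in \<open>r\<close> means \<open>\<alpha> \<le> \<beta>\<close>.\<close>

locale ordered_abelian_group = comm_group \<Gamma> for \<Gamma> (structure) +
  fixes r :: "'g rel"
  assumes linear_order: "linear_order_on (carrier \<Gamma>) r"
    and mult_mono: "\<lbrakk>(\<alpha>, \<beta>) \<in> r; \<gamma> \<in> carrier \<Gamma>\<rbrakk> \<Longrightarrow> (\<alpha> \<otimes> \<gamma>, \<beta> \<otimes> \<gamma>) \<in> r"

text \<open>The order on the value group extended by \<open>None\<close>, which plays the role of \<open>\<infinity>\<close>.\<close>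

fun value_le :: "'g rel \<Rightarrow> 'g option \<Rightarrow> 'g option \<Rightarrow> bool" where
  "value_le r _ None \<longleftrightarrow> True"
| "value_le r None (Some _) \<longleftrightarrow> False"
| "value_le r (Some \<alpha>) (Some \<beta>) \<longleftrightarrow> (\<alpha>, \<beta>) \<in> r"

locale valuation = ordered_abelian_group \<Gamma> r for \<Gamma> (structure) and r +
  fixes v :: "'a::field \<Rightarrow> 'g option"
  assumes infinity_iff: "v x = None \<longleftrightarrow> x = 0"
    and value_closed: "v x = Some \<alpha> \<Longrightarrow> \<alpha> \<in> carrier \<Gamma>"
    and value_mult: "\<lbrakk>v x = Some \<alpha>; v y = Some \<beta>\<rbrakk> \<Longrightarrow> v (x * y) = Some (\<alpha> \<otimes> \<beta>)"
    and value_add: "value_le r (v x) (v (x + y)) \<or> value_le r (v y) (v (x + y))"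
      \<comment> \<open>\<open>v (x + y) \<ge> min (v x) (v y)\<close>\<close>

definition valuation_ring :: "('g, 'm) monoid_scheme \<Rightarrow> 'g rel \<Rightarrow> ('a::field \<Rightarrow> 'g option) \<Rightarrow> 'a set"
  where "valuation_ring \<Gamma> r v = {x. value_le r (Some \<one>\<^bsub>\<Gamma>\<^esub>) (v x)}"

definition nontrivial_valuation :: "('g, 'm) monoid_scheme \<Rightarrow> ('a::field \<Rightarrow> 'g option) \<Rightarrow> bool"
  where "nontrivial_valuation \<Gamma> v \<longleftrightarrow> (\<exists>x. x \<noteq> 0 \<and> v x \<noteq> Some \<one>\<^bsub>\<Gamma>\<^esub>)"


section \<open>First-order definability in the language of rings\<close>

datatype ring_term =
    Var nat | Zero | One
  | Plus ring_term ring_term | Minus ring_term | Times ring_term ring_term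

datatype ring_formula =
    Equal ring_term ring_term | Neg ring_formula
  | Conj ring_formula ring_formula | Exists nat ring_formula

primrec term_value :: "(nat \<Rightarrow> 'a::comm_ring_1) \<Rightarrow> ring_term \<Rightarrow> 'a" where
  "term_value e (Var n) = e n"
| "term_value e Zero = 0"
| "term_value e One = 1"
| "term_value e (Plus s t) = term_value e s + term_value e t"
| "term_value e (Minus t) = - term_value e t"
| "term_value e (Times s t) = term_value e s * term_value e t"

primrec satisfies :: "(nat \<Rightarrow> 'a::comm_ring_1) \<Rightarrow> ring_formula \<Rightarrow> bool" where
  "satisfies e (Equal s t) \<longleftrightarrow> term_value e s = term_value e t"
| "satisfies e (Neg \<phi>) \<longleftrightarrow> \<not> satisfies e \<phi>"
| "satisfies e (Conj \<phi> \<psi>) \<longleftrightarrow> satisfies e \<phi> \<and> satisfies e \<psi>"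
| "satisfies e (Exists n \<phi>) \<longleftrightarrow> (\<exists>x. satisfies (e(n := x)) \<phi>)"

primrec term_vars :: "ring_term \<Rightarrow> nat set" where
  "term_vars (Var n) = {n}"
| "term_vars Zero = {}"
| "term_vars One = {}"
| "term_vars (Plus s t) = term_vars s \<union> term_vars t"
| "term_vars (Minus t) = term_vars t"
| "term_vars (Times s t) = term_vars s \<union> term_vars t"

primrec free_vars :: "ring_formula \<Rightarrow> nat set" where
  "free_vars (Equal s t) = term_vars s \<union> term_vars t"
| "free_vars (Neg \<phi>) = free_vars \<phi>"
| "free_vars (Conj \<phi> \<psi>) = free_vars \<phi> \<union> free_vars \<psi>"
| "free_vars (Exists n \<phi>) = free_vars \<phi> - {n}"

text \<open>Definability without parameters by a formula whose only free variable is number \<open>0\<close>.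
  The value assigned to every other variable is therefore irrelevant.\<close>

definition empty_definable :: "'a::comm_ring_1 set \<Rightarrow> bool" where
  "empty_definable S \<longleftrightarrow> (\<exists>\<phi>. free_vars \<phi> \<subseteq> {0} \<and> S = {x. satisfies (\<lambda>_. x) \<phi>})"

text \<open>Existence of a non-trivial valuation whose valuation ring is definable without parameters.
  The value group is sought on the type \<open>'a set\<close>. This loses no generality: given a valuation
  \<open>v\<close> with any value group, each value \<open>\<gamma>\<close> may be replaced by the coset
  \<open>{x. v x = Some \<gamma>}\<close> of the units of the valuation ring, with the same valuation ring.\<close>

definition admits_nontrivial_empty_definable_valuation :: "'a::field itself \<Rightarrow> bool" where
  "admits_nontrivial_empty_definable_valuation _ \<longleftrightarrow>
     (\<exists>(\<Gamma> :: 'a set monoid) r (v :: 'a \<Rightarrow> 'a set option).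
        valuation \<Gamma> r v \<and> nontrivial_valuation \<Gamma> v \<and> empty_definable (valuation_ring \<Gamma> r v))"

end

theory Submission
  imports Defs "HOL-Real_Asymp.Real_Asymp" "HOL-Analysis.Elementary_Normed_Spaces"
    "HOL-Computational_Algebra.Polynomial"
begin

text \<open>
  Let \<open>H\<close> be the Artin--Schreier group or, with \<open>c = (\<zeta> - 1)\<^sup>q\<close>, the set of all \<open>y\<close> such that
  \<open>1 + c y\<close> is a nonzero \<open>q\<close>-th power; it is a neighbourhood of \<open>0\<close>. By (V6) the set \<open>T\<close> of inverses
  of elements outside \<open>H\<close> is bounded, so by (V3) each stage \<open>B\<^sub>n\<close> of the ring \<open>D\<close> generated by \<open>T\<close> is
  bounded and hence proper. The stages are definable without parameters. A valuation ring contains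
  \<open>T\<close> iff its maximal ideal lies in \<open>H\<close>.

  If \<open>D\<close> is not the whole field, Chevalley's theorem gives a valuation ring \<open>V\<close> above \<open>D\<close> dominating
  a localization of \<open>D\<close>. Unless \<open>H\<close> contains all \<open>y \<in> V\<close> for which \<open>1 + c y\<close> is a unit, one has
  \<open>D = V\<close>. If then \<open>D = B\<^sub>n\<close> for some \<open>n\<close>, we are done; otherwise the stages exhaust \<open>D\<close> like the
  balls of an absolute value on its residue field. If it is nonarchimedean, Newton's method gives a
  valuation ring containing \<open>T\<close> but not \<open>D\<close>. If it is archimedean, all units of \<open>D\<close> are \<open>q\<close>-th
  powers up to sign; if moreover this holds for all nonzero elements of the field but not without the
  sign, then \<open>q = 2\<close> and the field is euclidean.

  If the units of some \<open>V\<close> lie in a proper definable subgroup \<open>G\<close> of the multiplicative group, the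
  largest coarsening with this property has the maximal ideal \<open>S \<union> S S \<union> {0}\<close>, where \<open>S\<close> is the
  set of all \<open>x \<notin> G\<close> with \<open>1 + x \<in> G\<close>. If \<open>H\<close> contains \<open>V\<close>, let \<open>A\<close> be the largest fractional ideal
  in \<open>H\<close>. Then \<open>T \<union> (T - T) \<union> {0}\<close> is the fractional ideal of all \<open>t\<close> with \<open>1 / t \<notin> A\<close>, and its
  multiplier ring is a definable valuation ring.
\<close>

section \<open>Valuation rings\<close>

text \<open>The valuation rings at hand come from choice and have no definition; only
  \<open>T\<close> has one. Each branch must therefore recover a ring from \<open>T\<close>, or from
  a subgroup, by boundedly many ring operations. The scaling by \<open>c\<close> makes this uniform:
  \<open>1 + c P x = (1 + \<pi> x) ^ q\<close> for a polynomial \<open>P\<close> whose coefficients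
  lie in every valuation ring and whose linear coefficient is a unit in all of them. So small
  elements can be approximated by values of \<open>P\<close> even if the residue characteristic is
  \<open>q\<close>. A root of unity would be a parameter; pooling the inverses over all of them
  removes it, at the price of factors that lie in every valuation ring. Absolute values enter
  because the stages may grow forever: this growth is then a matter of the residue field, where
  Ostrowski's dichotomy is available.\<close>

lemma binomial_prime:
  fixes x :: "'a::comm_ring_1"
  assumes "prime q"
  shows "(1 + x) ^ q = 1 + of_nat q * x * (\<Sum>k<q - 1. of_nat ((q choose Suc k) div q) * x ^ k) + x ^ q"
proof -
  obtain r where r: "q = Suc r"
    using assms prime_gt_0_nat gr0_implies_Suc by blast
  have "(1 + x) ^ q = (\<Sum>k\<le>q. of_nat (q choose k) * x ^ k)"
    by (simp add: binomial_ring add.commute[of 1])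
  also have "\<dots> = 1 + (\<Sum>k<q - 1. of_nat (q choose Suc k) * x ^ Suc k) + x ^ q"
  proof -
    have "(\<Sum>k\<le>Suc r. f k) = f 0 + (\<Sum>k<r. f (Suc k)) + f (Suc r)" for f :: "nat \<Rightarrow> 'a"
      by (simp add: sum.atMost_shift)
    from this[of "\<lambda>k. of_nat (q choose k) * x ^ k"] show ?thesis
      by (simp add: r)
  qed
  also have "(\<Sum>k<q - 1. of_nat (q choose Suc k) * x ^ Suc k) =
      of_nat q * x * (\<Sum>k<q - 1. of_nat ((q choose Suc k) div q) * x ^ k)"
    unfolding sum_distrib_left
  proof (rule sum.cong)
    fix k
    assume "k \<in> {..<q - 1}"
    \<comment> \<open>The quotient by \<open>q\<close> is taken in the natural numbers, which keeps
      the identity meaningful in characteristic \<open>q\<close>.\<close>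
    then have "q dvd (q choose Suc k)"
      by (intro dvd_choose_prime assms(1)) auto
    then have "(of_nat (q choose Suc k) :: 'a) = of_nat q * of_nat ((q choose Suc k) div q)"
      by (simp flip: of_nat_mult)
    then show "of_nat (q choose Suc k) * x ^ Suc k = of_nat q * x * (of_nat ((q choose Suc k) div q) * x ^ k)"
      by (simp add: mult_ac)
  qed simp
  finally show ?thesis .
qed

text \<open>Zero and negatives come from the last axiom, because \<open>0\<close> and
  \<open>- 1\<close> are their own inverses. The whole field counts as a valuation ring, with
  \<open>0\<close> as its only nonunit.\<close>

locale valring =
  fixes V :: "'a::field set"
  assumes one_mem: "1 \<in> V"
    and add_mem: "\<lbrakk>x \<in> V; y \<in> V\<rbrakk> \<Longrightarrow> x + y \<in> V"
    and mult_mem: "\<lbrakk>x \<in> V; y \<in> V\<rbrakk> \<Longrightarrow> x * y \<in> V"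
    and mem_or_inverse: "x \<in> V \<or> inverse x \<in> V"

definition nonunits :: "'a::field set \<Rightarrow> 'a set" where
  "nonunits V = {x. x = 0 \<or> inverse x \<notin> V}"

definition val_units :: "'a::field set \<Rightarrow> 'a set" where
  "val_units V = {x \<in> V. x \<noteq> 0 \<and> inverse x \<in> V}"

lemma zero_nonunit [simp]: "0 \<in> nonunits V"
  by (simp add: nonunits_def)

context valring
begin

lemma zero_mem: "0 \<in> V"
  using mem_or_inverse[of 0] by simp

lemma neg_mem: "x \<in> V \<Longrightarrow> - x \<in> V"
proof -
  have "- 1 \<in> V"
    using mem_or_inverse[of "- 1"] by simp
  then show "x \<in> V \<Longrightarrow> - x \<in> V"
    using mult_mem[of "- 1" x] by simp
qed

lemma diff_mem: "\<lbrakk>x \<in> V; y \<in> V\<rbrakk> \<Longrightarrow> x - y \<in> V"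
  using add_mem[of x "- y"] neg_mem by simp

lemma power_mem: "x \<in> V \<Longrightarrow> x ^ n \<in> V"
  by (induction n) (auto intro: one_mem mult_mem)

lemma of_nat_mem: "of_nat n \<in> V"
  by (induction n) (auto intro: one_mem zero_mem add_mem)

lemma sum_mem: "(\<And>i. i \<in> I \<Longrightarrow> f i \<in> V) \<Longrightarrow> sum f I \<in> V"
  by (induction I rule: infinite_finite_induct) (auto intro: zero_mem add_mem)

lemma nonunits_subset: "nonunits V \<subseteq> V"
  using mem_or_inverse zero_mem by (auto simp: nonunits_def)

lemma nonunit_mem: "x \<in> nonunits V \<Longrightarrow> x \<in> V"
  using nonunits_subset by blast

lemma unit_mem: "x \<in> val_units V \<Longrightarrow> x \<in> V"
  by (simp add: val_units_def)

lemma unit_nonzero: "x \<in> val_units V \<Longrightarrow> x \<noteq> 0"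
  by (simp add: val_units_def)

lemma inverse_unit: "x \<in> val_units V \<Longrightarrow> inverse x \<in> val_units V"
  by (simp add: val_units_def)

lemma unit_iff: "x \<in> val_units V \<longleftrightarrow> x \<in> V \<and> x \<notin> nonunits V"
  by (auto simp: val_units_def nonunits_def)

lemma one_unit: "1 \<in> val_units V"
  by (simp add: val_units_def one_mem)

lemma mult_unit: "\<lbrakk>x \<in> val_units V; y \<in> val_units V\<rbrakk> \<Longrightarrow> x * y \<in> val_units V"
  by (simp add: val_units_def mult_mem)

lemma divide_unit: "\<lbrakk>x \<in> val_units V; y \<in> val_units V\<rbrakk> \<Longrightarrow> x / y \<in> val_units V"
  by (simp add: divide_inverse inverse_unit mult_unit)

lemma neg_unit: "x \<in> val_units V \<Longrightarrow> - x \<in> val_units V"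
  by (simp add: val_units_def neg_mem)

lemma power_unit: "x \<in> val_units V \<Longrightarrow> x ^ n \<in> val_units V"
  by (induction n) (auto intro: one_unit mult_unit)

lemma divide_mem: "\<lbrakk>x \<in> V; y \<in> val_units V\<rbrakk> \<Longrightarrow> x / y \<in> V"
  by (simp add: divide_inverse inverse_unit mult_mem unit_mem)

lemma one_not_nonunit: "1 \<notin> nonunits V"
  by (simp add: nonunits_def one_mem)

lemma nonunit_mult: "\<lbrakk>x \<in> nonunits V; y \<in> V\<rbrakk> \<Longrightarrow> x * y \<in> nonunits V"
proof (rule ccontr)
  assume x: "x \<in> nonunits V" and y: "y \<in> V" and xy: "x * y \<notin> nonunits V"
  then have "x \<noteq> 0" "y \<noteq> 0" "inverse (x * y) \<in> V"
    by (auto simp: nonunits_def)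
  then have "inverse x \<in> V"
    using mult_mem[OF y \<open>inverse (x * y) \<in> V\<close>] by (simp add: field_simps)
  then show False
    using x \<open>x \<noteq> 0\<close> by (simp add: nonunits_def)
qed

lemma nonunit_mult': "\<lbrakk>x \<in> V; y \<in> nonunits V\<rbrakk> \<Longrightarrow> x * y \<in> nonunits V"
  using nonunit_mult[of y x] by (simp add: mult.commute)

lemma not_mem_iff: "x \<notin> V \<longleftrightarrow> x \<noteq> 0 \<and> inverse x \<in> nonunits V"
  using zero_mem by (auto simp: nonunits_def)

lemma quotient_cases: "x / y \<in> V \<or> y / x \<in> V"
  using mem_or_inverse[of "x / y"] by (simp add: inverse_eq_divide)

text \<open>Of two elements one divides the other in \<open>V\<close>, so \<open>x + y\<close> is a
  multiple of \<open>x\<close> or of \<open>y\<close>. Fractional ideals can thus be given by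
  closure under scaling alone.\<close>

lemma submodule_add:
  assumes J: "\<And>x a. \<lbrakk>x \<in> J; a \<in> V\<rbrakk> \<Longrightarrow> x * a \<in> J" and x: "x \<in> J" and y: "y \<in> J"
  shows "x + y \<in> J"
proof (cases "x = 0 \<or> y = 0")
  case True
  then show ?thesis
    using x y by auto
next
  case False
  have "x * (1 + y / x) \<in> J \<or> y * (1 + x / y) \<in> J"
    using quotient_cases[of x y] J[OF x] J[OF y] add_mem[OF one_mem] by blast
  moreover have "x * (1 + y / x) = x + y" "y * (1 + x / y) = x + y"
    using False by (simp_all add: distrib_left)
  ultimately show ?thesis
    by (simp only: disj_absorb)
qed

text \<open>Inverting the complement reverses the order of values twice, so it turns a fractional
  ideal into another one, the dual cut.\<close>

lemma inverse_complement_mult: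
  assumes A: "\<And>x a. \<lbrakk>x \<in> A; a \<in> V\<rbrakk> \<Longrightarrow> x * a \<in> A" and "a \<in> V"
    and t: "t \<in> {t. t = 0 \<or> inverse t \<notin> A}"
  shows "t * a \<in> {t. t = 0 \<or> inverse t \<notin> A}"
proof (cases "t * a = 0")
  case False
  then have eq: "inverse (t * a) * a = inverse t"
    by (simp add: field_simps)
  have "inverse (t * a) \<notin> A"
  proof
    assume "inverse (t * a) \<in> A"
    then have "inverse t \<in> A"
      unfolding eq[symmetric] by (rule A) fact
    then show False
      using t False by auto
  qed
  then show ?thesis
    by blast
qed simp

lemma nonunit_add: "\<lbrakk>x \<in> nonunits V; y \<in> nonunits V\<rbrakk> \<Longrightarrow> x + y \<in> nonunits V"
  by (rule submodule_add) (rule nonunit_mult)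

lemma neg_nonunit: "x \<in> nonunits V \<Longrightarrow> - x \<in> nonunits V"
  using nonunit_mult[OF _ neg_mem[OF one_mem]] by simp

lemma nonunit_diff: "\<lbrakk>x \<in> nonunits V; y \<in> nonunits V\<rbrakk> \<Longrightarrow> x - y \<in> nonunits V"
  using nonunit_add[of x "- y"] neg_nonunit by simp

lemma unit_add_nonunit:
  assumes "x \<in> val_units V" "y \<in> nonunits V"
  shows "x + y \<in> val_units V"
  using assms nonunit_diff[of "x + y" y] by (auto simp: unit_iff intro: add_mem nonunit_mem)

lemma unit_diff_nonunit:
  assumes "x \<in> val_units V" "y \<in> nonunits V"
  shows "x - y \<in> val_units V"
  using unit_add_nonunit[OF assms(1) neg_nonunit[OF assms(2)]] by simp

lemma one_plus_unit: "y \<in> nonunits V \<Longrightarrow> 1 + y \<in> val_units V"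
  using unit_add_nonunit[OF one_unit] .

lemma nonunit_divide: "\<lbrakk>x \<in> nonunits V; y \<in> val_units V\<rbrakk> \<Longrightarrow> x / y \<in> nonunits V"
  by (simp add: divide_inverse inverse_unit nonunit_mult unit_mem)

lemma power_nonunit: "\<lbrakk>x \<in> nonunits V; n > 0\<rbrakk> \<Longrightarrow> x ^ n \<in> nonunits V"
  by (cases n) (auto intro: nonunit_mult power_mem nonunit_mem)

lemma power_mem_iff: "n > 0 \<Longrightarrow> x ^ n \<in> V \<longleftrightarrow> x \<in> V"
proof
  assume n: "n > 0" and xn: "x ^ n \<in> V"
  show "x \<in> V"
  proof (rule ccontr)
    assume "x \<notin> V"
    then have "x \<noteq> 0" "inverse x ^ n \<in> nonunits V"
      using n by (auto simp: not_mem_iff intro: power_nonunit)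
    then have "x ^ n * inverse x ^ n \<in> nonunits V"
      using xn by (intro nonunit_mult')
    then show False
      using \<open>x \<noteq> 0\<close> one_not_nonunit by (simp flip: power_mult_distrib)
  qed
qed (rule power_mem)

lemma power_nonunit_iff: "n > 0 \<Longrightarrow> x ^ n \<in> nonunits V \<longleftrightarrow> x \<in> nonunits V"
  using power_mem_iff[of n "inverse x"] by (auto simp: nonunits_def power_inverse)

lemma power_unit_iff: "n > 0 \<Longrightarrow> x ^ n \<in> val_units V \<longleftrightarrow> x \<in> val_units V"
  by (simp add: unit_iff power_mem_iff power_nonunit_iff)

lemma root_of_unity_mem: "\<lbrakk>x ^ n = 1; n > 0\<rbrakk> \<Longrightarrow> x \<in> V"
  using power_mem_iff[of n x] one_mem by simp

lemma unit_of_mult: "\<lbrakk>x * y \<in> val_units V; x \<in> V; y \<in> V\<rbrakk> \<Longrightarrow> x \<in> val_units V"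
  using nonunit_mult[of x y] by (auto simp: unit_iff)

lemma one_unit_is_unit: "x - 1 \<in> nonunits V \<Longrightarrow> x \<in> val_units V"
  using one_plus_unit[of "x - 1"] by simp

lemma one_units_mult:
  assumes "x - 1 \<in> nonunits V" "y - 1 \<in> nonunits V"
  shows "x * y - 1 \<in> nonunits V"
proof -
  have "x * (y - 1) + (x - 1) \<in> nonunits V"
    by (intro nonunit_add nonunit_mult' assms unit_mem one_unit_is_unit)
  then show ?thesis
    by (simp add: algebra_simps)
qed

lemma one_units_inverse:
  assumes "x - 1 \<in> nonunits V"
  shows "inverse x - 1 \<in> nonunits V"
proof -
  have "- (x - 1) * inverse x \<in> nonunits V"
    by (intro nonunit_mult neg_nonunit assms unit_mem inverse_unit one_unit_is_unit)
  then show ?thesis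
    using unit_nonzero[OF one_unit_is_unit[OF assms]] by (simp add: algebra_simps)
qed

lemma one_units_divide: "\<lbrakk>x - 1 \<in> nonunits V; y - 1 \<in> nonunits V\<rbrakk> \<Longrightarrow> x / y - 1 \<in> nonunits V"
  by (simp only: divide_inverse one_units_mult one_units_inverse)

lemma freshmans_dream_mod_nonunits:
  assumes "prime q" "of_nat q \<in> nonunits V" "x \<in> V"
  shows "(1 + x) ^ q - (1 + x ^ q) \<in> nonunits V"
proof -
  have "(1 + x) ^ q - (1 + x ^ q) = of_nat q * (x * (\<Sum>k<q - 1. of_nat ((q choose Suc k) div q) * x ^ k))"
    by (simp add: binomial_prime[OF assms(1)] mult.assoc)
  also have "\<dots> \<in> nonunits V"
    using assms(3) by (intro nonunit_mult[OF assms(2)] mult_mem sum_mem of_nat_mem power_mem)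
  finally show ?thesis .
qed

end

section \<open>Chevalley's extension theorem\<close>

lemma subset_Zorn_above:
  assumes "P A"
    and "\<And>C. \<lbrakk>C \<noteq> {}; \<And>X. X \<in> C \<Longrightarrow> P X \<and> A \<subseteq> X; \<And>X Y. \<lbrakk>X \<in> C; Y \<in> C\<rbrakk> \<Longrightarrow> X \<subseteq> Y \<or> Y \<subseteq> X\<rbrakk>
      \<Longrightarrow> P (\<Union>C)"
  obtains M where "P M" "A \<subseteq> M" "\<And>X. \<lbrakk>P X; M \<subseteq> X\<rbrakk> \<Longrightarrow> X = M"
proof -
  let ?S = "{X. P X \<and> A \<subseteq> X}"
  have "\<exists>M\<in>?S. \<forall>X\<in>?S. M \<subseteq> X \<longrightarrow> X = M"
  proof (rule subset_Zorn_nonempty)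
    show "?S \<noteq> {}"
      using assms(1) by blast
  next
    fix C
    assume C: "C \<noteq> {}" "subset.chain ?S C"
    then have "P (\<Union>C)"
      by (intro assms(2)) (auto simp: subset_chain_def)
    moreover obtain X where "X \<in> C" "A \<subseteq> X"
      using C by (auto simp: subset_chain_def)
    ultimately show "\<Union>C \<in> ?S"
      by blast
  qed
  then obtain M where M: "M \<in> ?S" "\<forall>X\<in>?S. M \<subseteq> X \<longrightarrow> X = M"
    by (elim bexE)
  then have "P M" "A \<subseteq> M"
    by simp_all
  then show ?thesis
  proof (rule that)
    show "X = M" if "P X" "M \<subseteq> X" for X
      using M(2) that order_trans[OF \<open>A \<subseteq> M\<close> that(2)] by simp
  qed
qed

text \<open>Not an ideal of \<open>D\<close> but a multiplicatively closed
  \<open>D\<close>-submodule of the field that avoids \<open>1\<close>. A maximal one is the maximal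
  ideal of a valuation ring, so Zorn's lemma is applied to single sets instead of pairs of a ring
  and an ideal.\<close>

definition proper_submodule :: "'a::field set \<Rightarrow> 'a set \<Rightarrow> bool" where
  "proper_submodule D I \<longleftrightarrow> 0 \<in> I \<and> 1 \<notin> I \<and> (\<forall>x\<in>I. \<forall>y\<in>I. x + y \<in> I \<and> x * y \<in> I) \<and>
     (\<forall>d\<in>D. \<forall>x\<in>I. d * x \<in> I)"

lemma proper_submodule_Union:
  assumes "C \<noteq> {}" and C: "\<And>X. X \<in> C \<Longrightarrow> proper_submodule D X"
    and chain: "\<And>X Y. \<lbrakk>X \<in> C; Y \<in> C\<rbrakk> \<Longrightarrow> X \<subseteq> Y \<or> Y \<subseteq> X"
  shows "proper_submodule D (\<Union>C)"
proof -
  have "x + y \<in> \<Union>C \<and> x * y \<in> \<Union>C" if "X \<in> C" "Y \<in> C" "x \<in> X" "y \<in> Y" for x y X Y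
    using chain[OF that(1,2)] that C[OF that(1)] C[OF that(2)]
    unfolding proper_submodule_def by blast
  moreover have "0 \<in> \<Union>C"
    using assms(1) C unfolding proper_submodule_def by blast
  moreover have "1 \<notin> \<Union>C" "\<forall>d\<in>D. \<forall>x\<in>\<Union>C. d * x \<in> \<Union>C"
    using C unfolding proper_submodule_def by blast+
  ultimately show ?thesis
    unfolding proper_submodule_def by blast
qed

lemma proper_submoduleD:
  assumes "proper_submodule D I"
  shows "0 \<in> I" "1 \<notin> I" "\<And>x y. \<lbrakk>x \<in> I; y \<in> I\<rbrakk> \<Longrightarrow> x + y \<in> I"
    "\<And>x y. \<lbrakk>x \<in> I; y \<in> I\<rbrakk> \<Longrightarrow> x * y \<in> I" "\<And>d x. \<lbrakk>d \<in> D; x \<in> I\<rbrakk> \<Longrightarrow> d * x \<in> I"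
  using assms unfolding proper_submodule_def by auto

text \<open>If neither \<open>x\<close> nor \<open>1 / x\<close> belongs to the valuation ring under construction, then \<open>1\<close> is a
  polynomial in \<open>x\<close> and a polynomial in \<open>1 / x\<close>, both with coefficients in \<open>I\<close>; the one of lower
  degree shortens the other.\<close>

lemma no_two_sided_equation:
  fixes x :: "'a::field"
  assumes I: "proper_submodule D I" and R: "\<And>i j. \<lbrakk>i \<in> I; j \<in> I\<rbrakk> \<Longrightarrow> i / (1 - j) \<in> I"
    and "x \<noteq> 0" "m > 0"
    and "\<forall>i. a i \<in> I" "(\<Sum>i\<le>m. a i * x ^ i) = 1" "\<forall>i. b i \<in> I" "(\<Sum>i\<le>n. b i * inverse x ^ i) = 1"
    and "n \<le> m"
  obtains a' m' where "m' < m" "\<forall>i. a' i \<in> I" "(\<Sum>i\<le>m'. a' i * x ^ i) = 1"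
proof -
  note [simp] = proper_submoduleD(1)[OF I]
  obtain k where k: "m = Suc k"
    using \<open>m > 0\<close> by (cases m) auto
  have b0: "1 - b 0 \<noteq> 0"
    using assms(7) proper_submoduleD(2)[OF I] by (metis eq_iff_diff_eq_0)
  have n: "n > 0"
    using assms(7,8) proper_submoduleD(2)[OF I] by (cases n) (auto, metis)
  \<comment> \<open>Division by \<open>1 - b 0\<close> removes the constant term of the equation in
    \<open>1 / x\<close>; multiplied by \<open>x ^ m\<close>, it then expresses \<open>x ^ m\<close>
    by lower powers.\<close>
  define c where "c i = (if 1 \<le> i \<and> i \<le> n then b i / (1 - b 0) else 0)" for i
  have c: "c i \<in> I" for i
    using R assms(7) by (auto simp: c_def)
  have split: "(\<Sum>i\<le>n. b i * inverse x ^ i) = b 0 + (\<Sum>i=1..n. b i * inverse x ^ i)"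
    using n by (simp add: atMost_atLeast0 sum.atLeast_Suc_atMost)
  have "(\<Sum>i=1..n. c i * inverse x ^ i) = (\<Sum>i=1..n. b i * inverse x ^ i) / (1 - b 0)"
    by (simp add: c_def sum_divide_distrib)
  also have "\<dots> = 1"
    using assms(8) b0 unfolding split by (simp add: divide_eq_1_iff eq_diff_eq add.commute)
  finally have c1: "(\<Sum>i=1..n. c i * inverse x ^ i) = 1" .
  define a' where "a' i = a i + a m * c (m - i)" for i
  have "x ^ m = (\<Sum>i=1..n. c i * (x ^ m * inverse x ^ i))"
    unfolding mult.left_commute[of _ "x ^ m"] sum_distrib_left[symmetric] c1 by simp
  also have "\<dots> = (\<Sum>i=1..n. c i * x ^ (m - i))"
    using \<open>x \<noteq> 0\<close> \<open>n \<le> m\<close> by (intro sum.cong) (auto simp: power_diff power_inverse divide_inverse)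
  also have "\<dots> = (\<Sum>i=1..m. c i * x ^ (m - i))"
    using \<open>n \<le> m\<close> by (intro sum.mono_neutral_left) (auto simp: c_def)
  also have "\<dots> = (\<Sum>i\<le>k. c (m - i) * x ^ i)"
    by (rule sum.reindex_bij_witness[of _ "\<lambda>i. m - i" "\<lambda>i. m - i"]) (auto simp: k)
  finally have xm: "x ^ m = (\<Sum>i\<le>k. c (m - i) * x ^ i)" .
  have "(\<Sum>i\<le>k. a' i * x ^ i) = (\<Sum>i\<le>k. a i * x ^ i) + a m * (\<Sum>i\<le>k. c (m - i) * x ^ i)"
    by (simp add: a'_def distrib_right sum.distrib sum_distrib_left mult.assoc)
  also have "\<dots> = (\<Sum>i\<le>m. a i * x ^ i)"
    unfolding xm[symmetric] by (simp add: k)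
  finally have "(\<Sum>i\<le>k. a' i * x ^ i) = 1"
    using assms(6) by simp
  moreover have "\<forall>i. a' i \<in> I"
    using assms(5) c by (auto simp: a'_def intro: proper_submoduleD(3,4)[OF I])
  ultimately show ?thesis
    using that[of k a'] by (simp add: k)
qed

text \<open>The two equations are interchanged by \<open>x \<mapsto> 1 / x\<close>; the longer one
  is shortened, so the sum of the degrees decreases.\<close>

lemma no_equations:
  fixes x :: "'a::field"
  assumes I: "proper_submodule D I" and R: "\<And>i j. \<lbrakk>i \<in> I; j \<in> I\<rbrakk> \<Longrightarrow> i / (1 - j) \<in> I"
    and "x \<noteq> 0" "\<forall>i. a i \<in> I" "(\<Sum>i\<le>m. a i * x ^ i) = 1" "\<forall>i. b i \<in> I" "(\<Sum>i\<le>n. b i * inverse x ^ i) = 1"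
  shows False
  using assms(3-)
proof (induction "m + n" arbitrary: m n a b x rule: less_induct)
  case less
  have pos: "k > 0" if "\<forall>i. e i \<in> I" "(\<Sum>i\<le>k. e i * y ^ i) = 1" for k e and y :: 'a
    using that proper_submoduleD(2)[OF I] by (cases k) (auto, metis)
  show ?case
  proof (cases "n \<le> m")
    case True
    then obtain a' m' where "m' < m" "\<forall>i. a' i \<in> I" "(\<Sum>i\<le>m'. a' i * x ^ i) = 1"
      using no_two_sided_equation[OF I R less(2) pos[OF less(3,4)] less(3-6)] by blast
    then show False
      using less(1)[of m' n x a' b] less(2-) by simp
  next
    case False
    obtain b' n' where "n' < n" "\<forall>i. b' i \<in> I" "(\<Sum>i\<le>n'. b' i * inverse x ^ i) = 1"
      by (rule no_two_sided_equation[OF I R, of "inverse x" n b a m])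
        (use less(2-) pos[OF less(5,6)] False in auto)
    then show False
      using less(1)[of m n' x a b'] less(2-) by simp
  qed
qed

lemma adjoin_proper_submodule:
  fixes x :: "'a::field"
  assumes I: "proper_submodule D I" and no: "\<not> (\<exists>a m. (\<forall>i. a i \<in> I) \<and> (\<Sum>i\<le>m. a i * x ^ i) = 1)"
  defines "J \<equiv> {y. \<exists>a m. (\<forall>i. a i \<in> I) \<and> y = (\<Sum>i\<le>m::nat. a i * x ^ i)}"
  shows "proper_submodule D J"
proof -
  note I0 [simp] = proper_submoduleD(1)[OF I]
  have sumI: "sum f A \<in> I" if "\<And>i. i \<in> A \<Longrightarrow> f i \<in> I" for f :: "nat \<Rightarrow> 'a" and A
    using that by (induction A rule: infinite_finite_induct) (auto intro: proper_submoduleD(3)[OF I])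
  have "\<exists>e k. (\<forall>i. e i \<in> I) \<and> (\<Sum>i\<le>m. a i * x ^ i) + (\<Sum>i\<le>n. b i * x ^ i) = (\<Sum>i\<le>k::nat. e i * x ^ i)"
    if a: "\<forall>i. a i \<in> I" and b: "\<forall>i. b i \<in> I" for a b :: "nat \<Rightarrow> 'a" and m n
  proof (intro exI conjI)
    let ?e = "\<lambda>i. (if i \<le> m then a i else 0) + (if i \<le> n then b i else 0)"
    show "\<forall>i. ?e i \<in> I"
      using a b by (auto intro: proper_submoduleD(3)[OF I])
    have *: "(\<Sum>i\<le>k. f i * x ^ i) = (\<Sum>i\<le>max m n. (if i \<le> k then f i else 0) * x ^ i)"
      if "k \<le> max m n" for k and f :: "nat \<Rightarrow> 'a"
      using that by (intro sum.mono_neutral_cong_left) auto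
    show "(\<Sum>i\<le>m. a i * x ^ i) + (\<Sum>i\<le>n. b i * x ^ i) = (\<Sum>i\<le>max m n. ?e i * x ^ i)"
      unfolding distrib_right sum.distrib by (subst (1 2) *) auto
  qed
  moreover have "\<exists>e k. (\<forall>i. e i \<in> I) \<and> (\<Sum>i\<le>m. a i * x ^ i) * (\<Sum>i\<le>n. b i * x ^ i) = (\<Sum>i\<le>k::nat. e i * x ^ i)"
    if a: "\<forall>i. a i \<in> I" and b: "\<forall>i. b i \<in> I" for a b :: "nat \<Rightarrow> 'a" and m n
  proof (intro exI conjI)
    let ?a = "\<lambda>i. if i \<le> m then a i else 0" and ?b = "\<lambda>i. if i \<le> n then b i else 0"
    let ?e = "\<lambda>k. \<Sum>i\<le>k. ?a i * ?b (k - i)"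
    show "\<forall>i. ?e i \<in> I"
      using a b by (auto intro!: sumI intro: proper_submoduleD(4)[OF I])
    have "(\<Sum>i\<le>m. a i * x ^ i) * (\<Sum>i\<le>n. b i * x ^ i) = (\<Sum>i\<le>m. ?a i * x ^ i) * (\<Sum>i\<le>n. ?b i * x ^ i)"
      by simp
    also have "\<dots> = (\<Sum>i\<le>m + n. ?e i * x ^ i)"
      by (rule polynomial_product) auto
    finally show "(\<Sum>i\<le>m. a i * x ^ i) * (\<Sum>i\<le>n. b i * x ^ i) = (\<Sum>i\<le>m + n. ?e i * x ^ i)" .
  qed
  moreover have "\<exists>e k. (\<forall>i. e i \<in> I) \<and> d * (\<Sum>i\<le>m. a i * x ^ i) = (\<Sum>i\<le>k::nat. e i * x ^ i)"
    if "d \<in> D" and a: "\<forall>i. a i \<in> I" for a :: "nat \<Rightarrow> 'a" and m d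
    using that by (intro exI[of _ "\<lambda>i. d * a i"] exI[of _ m])
      (auto simp: sum_distrib_left mult.assoc intro: proper_submoduleD(5)[OF I])
  moreover have "0 \<in> J"
    by (auto simp: J_def intro!: exI[of _ "\<lambda>_. 0"])
  moreover have "1 \<notin> J"
    using no by (auto simp: J_def)
  ultimately show ?thesis
    unfolding proper_submodule_def J_def by blast
qed

text \<open>The submodule \<open>d D\<close> starts the construction and keeps \<open>V\<close>
  nontrivial. The last clause says that the image of \<open>D\<close> in the residue field of
  \<open>V\<close> is a field, that is, the centre of \<open>V\<close> on \<open>D\<close> is a
  maximal ideal; maximality of the submodule provides it.\<close>

theorem chevalley:
  fixes D :: "'a::field set"
  assumes D: "1 \<in> D" "- 1 \<in> D" "\<And>x y. \<lbrakk>x \<in> D; y \<in> D\<rbrakk> \<Longrightarrow> x + y \<in> D"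
      "\<And>x y. \<lbrakk>x \<in> D; y \<in> D\<rbrakk> \<Longrightarrow> x * y \<in> D"
    and d: "d \<in> D" "d \<noteq> 0" "inverse d \<notin> D"
  obtains V where "valring V" "D \<subseteq> V" "V \<noteq> UNIV"
    "\<And>e. \<lbrakk>e \<in> D; e \<notin> nonunits V\<rbrakk> \<Longrightarrow> \<exists>e'\<in>D. 1 - e * e' \<in> nonunits V"
proof -
  have D0: "0 \<in> D"
    using D(3)[OF D(1,2)] by simp
  have "proper_submodule D ((*) d ` D)"
    unfolding proper_submodule_def
  proof (intro conjI ballI)
    show "0 \<in> (*) d ` D"
      using D0 by force
    show "1 \<notin> (*) d ` D"
      using d by (auto dest: inverse_unique)
  next
    fix y z
    assume "y \<in> (*) d ` D" "z \<in> (*) d ` D"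
    then obtain y' z' where *: "y = d * y'" "z = d * z'" "y' \<in> D" "z' \<in> D"
      by blast
    show "y + z \<in> (*) d ` D"
      using * D(3) by (intro image_eqI[of _ _ "y' + z'"]) (auto simp: distrib_left)
    show "y * z \<in> (*) d ` D"
      using * D(4) d(1) by (intro image_eqI[of _ _ "d * (y' * z')"]) (auto simp: mult_ac)
  next
    fix e y
    assume "e \<in> D" "y \<in> (*) d ` D"
    then obtain y' where "y = d * y'" "y' \<in> D"
      by blast
    then show "e * y \<in> (*) d ` D"
      using D(4) \<open>e \<in> D\<close> by (intro image_eqI[of _ _ "e * y'"]) (auto simp: mult_ac)
  qed
  then obtain I where I: "proper_submodule D I" and dI: "(*) d ` D \<subseteq> I"
    and max: "\<And>X. \<lbrakk>proper_submodule D X; I \<subseteq> X\<rbrakk> \<Longrightarrow> X = I"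
    by (rule subset_Zorn_above) (assumption | rule proper_submodule_Union | blast)+
  note I' = proper_submoduleD[OF I]
  have neg: "- x \<in> I" if "x \<in> I" for x
    using I'(5)[OF D(2) that] by simp
  have diff: "x - y \<in> I" if "x \<in> I" "y \<in> I" for x y
    using I'(3)[OF that(1) neg[OF that(2)]] by simp
  \<comment> \<open>Inverting \<open>1 - j\<close> keeps the module proper, since
    \<open>1 = i / (1 - j)\<close> would give \<open>1 = i + j\<close> in \<open>I\<close>; by
    maximality nothing new arises.\<close>
  have loc: "i / (1 - j) \<in> I" if "i \<in> I" "j \<in> I" for i j
  proof -
    let ?L = "{i / (1 - j) | i j. i \<in> I \<and> j \<in> I}"
    have nz: "1 - j \<noteq> 0" if "j \<in> I" for j
      using that I'(2) by auto
    have "proper_submodule D ?L"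
      unfolding proper_submodule_def
    proof (intro conjI ballI)
      show "0 \<in> ?L"
        using I'(1) by force
      show "1 \<notin> ?L"
      proof
        assume "1 \<in> ?L"
        then obtain i j where "1 = i / (1 - j)" "i \<in> I" "j \<in> I"
          by blast
        then have "1 = i + j"
          using nz[of j] by (simp add: field_simps)
        then show False
          using I'(2) I'(3)[OF \<open>i \<in> I\<close> \<open>j \<in> I\<close>] by simp
      qed
    next
      fix y z
      assume "y \<in> ?L" "z \<in> ?L"
      then obtain i j k l where *: "y = i / (1 - j)" "z = k / (1 - l)" "i \<in> I" "j \<in> I" "k \<in> I" "l \<in> I"
        by blast
      have den: "1 - (j + l - j * l) = (1 - j) * (1 - l)"
        by (simp add: algebra_simps)
      have "y + z = (i - i * l + (k - k * j)) / (1 - (j + l - j * l))"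
        unfolding den * using nz[OF *(4)] nz[OF *(6)]
        by (subst add_frac_eq) (simp_all add: right_diff_distrib)
      moreover have "y * z = (i * k) / (1 - (j + l - j * l))"
        unfolding den * by simp
      moreover have "i - i * l + (k - k * j) \<in> I" "i * k \<in> I" "j + l - j * l \<in> I"
        using * by (auto intro!: I'(3,4) diff)
      ultimately show "y + z \<in> ?L" "y * z \<in> ?L"
        by blast+
    next
      fix e y
      assume "e \<in> D" "y \<in> ?L"
      then obtain i j where "e * y = (e * i) / (1 - j)" "e * i \<in> I" "j \<in> I"
        using I'(5) by force
      then show "e * y \<in> ?L"
        by blast
    qed
    moreover have "I \<subseteq> ?L"
    proof
      fix i
      assume "i \<in> I"
      then show "i \<in> ?L"
        using I'(1) by (intro CollectI exI[of _ i] exI[of _ 0]) simp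
    qed
    ultimately have "?L = I"
      by (rule max)
    then show ?thesis
      using that by blast
  qed
  define R where "R = {x. \<forall>i\<in>I. x * i \<in> I}"
  have equation: "\<exists>a m. (\<forall>i. a i \<in> I) \<and> (\<Sum>i\<le>m. a i * x ^ i) = 1" if "x \<notin> R" for x
  proof (rule ccontr)
    assume no: "\<not> ?thesis"
    let ?J = "{y. \<exists>a m. (\<forall>i. a i \<in> I) \<and> y = (\<Sum>i\<le>m::nat. a i * x ^ i)}"
    have *: "\<exists>a m. (\<forall>i. a i \<in> I) \<and> i * x ^ k = (\<Sum>i\<le>m. a i * x ^ i)" if "i \<in> I" for i k
      using that I'(1) by (intro exI[of _ "\<lambda>j. if j = k then i else 0"] exI[of _ k])
        (simp add: if_distrib[of "\<lambda>t. t * _"] cong: if_cong)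
    have "I \<subseteq> ?J"
      using *[of _ 0] by auto
    then have "?J = I"
      by (intro max adjoin_proper_submodule[OF I no])
    moreover have "x * i \<in> ?J" if "i \<in> I" for i
      using *[OF that, of 1] by (simp add: mult.commute)
    ultimately show False
      using \<open>x \<notin> R\<close> by (auto simp: R_def)
  qed
  have R: "valring R"
  proof
    show "1 \<in> R"
      by (simp add: R_def)
    fix x y
    show "x + y \<in> R" "x * y \<in> R" if "x \<in> R" "y \<in> R"
      using that by (auto simp: R_def distrib_right mult.assoc intro: I'(3))
    show "x \<in> R \<or> inverse x \<in> R"
    proof (rule ccontr)
      assume "\<not> ?thesis"
      moreover from this have "x \<noteq> 0"
        using I'(1) by (auto simp: R_def)
      ultimately show False
        using equation[of x] equation[of "inverse x"] no_equations[OF I loc, of x] by blast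
    qed
  qed
  have sub: "I \<subseteq> nonunits R"
  proof
    fix i
    assume "i \<in> I"
    then have "i = 0 \<or> inverse i \<notin> R"
      using I'(2) by (force simp: R_def)
    then show "i \<in> nonunits R"
      by (simp add: nonunits_def)
  qed
  show ?thesis
  proof (rule that[OF R])
    show "D \<subseteq> R"
      using I'(5) by (auto simp: R_def)
    have "d \<in> nonunits R"
      using dI sub D(1) by force
    then show "R \<noteq> UNIV"
      using d(2) by (auto simp: nonunits_def)
  next
    fix e
    assume e: "e \<in> D" "e \<notin> nonunits R"
    let ?E = "{i + e * x | i x. i \<in> I \<and> x \<in> D}"
    have "I \<subseteq> ?E"
      using D0 by force
    have "0 + e * 1 \<in> ?E"
      using I'(1) D(1) by blast
    then have "?E \<noteq> I"
      using e sub by auto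
    then have not_proper: "\<not> proper_submodule D ?E"
      using max[OF _ \<open>I \<subseteq> ?E\<close>] by blast
    have E0: "0 \<in> ?E"
      using I'(1) D0 by force
    have E1: "y + z \<in> ?E" "y * z \<in> ?E" if yz: "y \<in> ?E" "z \<in> ?E" for y z
    proof -
      obtain i j a b where *: "y = i + e * a" "z = j + e * b" "i \<in> I" "j \<in> I" "a \<in> D" "b \<in> D"
        using yz by blast
      have "y + z = (i + j) + e * (a + b)"
        "y * z = (i * j + (e * b) * i + (e * a) * j) + e * (a * (e * b))"
        using * by (auto simp: algebra_simps)
      moreover have "i + j \<in> I" "a + b \<in> D" "a * (e * b) \<in> D"
        using * e(1) by (auto intro: I'(3) D(3,4))
      moreover have "i * j + (e * b) * i + (e * a) * j \<in> I"
        using * e(1) by (intro I'(3) I'(4)[of i j] I'(5)[of "e * b"] I'(5)[of "e * a"] D(4))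
      ultimately show "y + z \<in> ?E" "y * z \<in> ?E"
        by blast+
    qed
    have E2: "f * y \<in> ?E" if f: "f \<in> D" and y: "y \<in> ?E" for f y
    proof -
      obtain i a where "y = i + e * a" "i \<in> I" "a \<in> D"
        using y by blast
      then have "f * y = f * i + e * (f * a)" "f * i \<in> I" "f * a \<in> D"
        using f by (auto simp: algebra_simps intro: I'(5) D(4))
      then show ?thesis
        by blast
    qed
    have "1 \<in> ?E"
    proof (rule ccontr)
      assume "1 \<notin> ?E"
      then have "proper_submodule D ?E"
        unfolding proper_submodule_def by (intro conjI ballI E0 E1 E2)
      then show False
        using not_proper by simp
    qed
    then obtain i a where "1 = i + e * a" "i \<in> I" "a \<in> D"
      by blast
    moreover from this have "1 - e * a = i"
      by (metis add_diff_cancel_right')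
    ultimately have "1 - e * a \<in> nonunits R"
      using sub by auto
    then show "\<exists>e'\<in>D. 1 - e * e' \<in> nonunits R"
      using \<open>a \<in> D\<close> by blast
  qed
qed

section \<open>Definable sets\<close>

definition definable :: "nat set \<Rightarrow> ((nat \<Rightarrow> 'a::comm_ring_1) \<Rightarrow> bool) \<Rightarrow> bool" where
  "definable V P \<longleftrightarrow> (\<exists>\<phi>. free_vars \<phi> \<subseteq> V \<and> (\<forall>e. satisfies e \<phi> \<longleftrightarrow> P e))"

lemma definable_neg: "definable V P \<Longrightarrow> definable V (\<lambda>e. \<not> P e)"
proof -
  assume "definable V P"
  then obtain \<phi> where "free_vars \<phi> \<subseteq> V" "\<forall>e. satisfies e \<phi> \<longleftrightarrow> P e"
    unfolding definable_def by blast
  then show ?thesis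
    unfolding definable_def by (intro exI[of _ "Neg \<phi>"]) auto
qed

lemma definable_conj:
  assumes "definable V P" "definable V Q"
  shows "definable V (\<lambda>e. P e \<and> Q e)"
proof -
  from assms obtain \<phi> \<psi> where "free_vars \<phi> \<subseteq> V" "free_vars \<psi> \<subseteq> V"
    "\<forall>e. satisfies e \<phi> \<longleftrightarrow> P e" "\<forall>e. satisfies e \<psi> \<longleftrightarrow> Q e"
    unfolding definable_def by blast
  then show ?thesis
    unfolding definable_def by (intro exI[of _ "Conj \<phi> \<psi>"]) auto
qed

lemma definable_disj:
  assumes "definable V P" "definable V Q"
  shows "definable V (\<lambda>e. P e \<or> Q e)"
proof -
  have "definable V (\<lambda>e. \<not> (\<not> P e \<and> \<not> Q e))"
    by (rule definable_neg, rule definable_conj) (rule assms[THEN definable_neg])+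
  then show ?thesis
    by simp
qed

lemma definable_Ex:
  assumes "definable W (\<lambda>e. P e (e n))" "W \<subseteq> insert n V" and "\<And>e x y. P (e(n := x)) y \<longleftrightarrow> P e y"
  shows "definable V (\<lambda>e. \<exists>x. P e x)"
proof -
  from assms(1) obtain \<phi> where "free_vars \<phi> \<subseteq> W" "\<forall>e. satisfies e \<phi> \<longleftrightarrow> P e (e n)"
    unfolding definable_def by blast
  then show ?thesis
    using assms(2,3) unfolding definable_def by (intro exI[of _ "Exists n \<phi>"]) auto
qed

definition term_fun :: "nat set \<Rightarrow> ((nat \<Rightarrow> 'a::comm_ring_1) \<Rightarrow> 'a) \<Rightarrow> bool" where
  "term_fun V f \<longleftrightarrow> (\<exists>t. term_vars t \<subseteq> V \<and> (\<forall>e. term_value e t = f e))"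

lemma definable_eq:
  assumes "term_fun V f" "term_fun V g"
  shows "definable V (\<lambda>e. f e = g e)"
proof -
  from assms obtain s t where "term_vars s \<subseteq> V" "term_vars t \<subseteq> V"
    "\<forall>e. term_value e s = f e" "\<forall>e. term_value e t = g e"
    unfolding term_fun_def by blast
  then show ?thesis
    unfolding definable_def by (intro exI[of _ "Equal s t"]) auto
qed

lemma term_fun_var: "n \<in> V \<Longrightarrow> term_fun V (\<lambda>e. e n)"
  unfolding term_fun_def by (intro exI[of _ "Var n"]) auto

lemma term_fun_0: "term_fun V (\<lambda>e. 0)"
  unfolding term_fun_def by (intro exI[of _ Zero]) auto

lemma term_fun_1: "term_fun V (\<lambda>e. 1)"
  unfolding term_fun_def by (intro exI[of _ One]) auto

lemma term_fun_uminus: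
  assumes "term_fun V f"
  shows "term_fun V (\<lambda>e. - f e)"
proof -
  from assms obtain t where "term_vars t \<subseteq> V" "\<forall>e. term_value e t = f e"
    unfolding term_fun_def by blast
  then show ?thesis
    unfolding term_fun_def by (intro exI[of _ "Minus t"]) auto
qed

lemma term_fun_add:
  assumes "term_fun V f" "term_fun V g"
  shows "term_fun V (\<lambda>e. f e + g e)"
proof -
  from assms obtain s t where "term_vars s \<subseteq> V" "term_vars t \<subseteq> V"
    "\<forall>e. term_value e s = f e" "\<forall>e. term_value e t = g e"
    unfolding term_fun_def by blast
  then show ?thesis
    unfolding term_fun_def by (intro exI[of _ "Plus s t"]) auto
qed

lemma term_fun_mult:
  assumes "term_fun V f" "term_fun V g"
  shows "term_fun V (\<lambda>e. f e * g e)"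
proof -
  from assms obtain s t where "term_vars s \<subseteq> V" "term_vars t \<subseteq> V"
    "\<forall>e. term_value e s = f e" "\<forall>e. term_value e t = g e"
    unfolding term_fun_def by blast
  then show ?thesis
    unfolding term_fun_def by (intro exI[of _ "Times s t"]) auto
qed

lemma term_fun_diff:
  assumes "term_fun V f" "term_fun V g"
  shows "term_fun V (\<lambda>e. f e - g e)"
  unfolding diff_conv_add_uminus by (rule term_fun_add[OF assms(1) term_fun_uminus[OF assms(2)]])

lemma term_fun_power: "term_fun V f \<Longrightarrow> term_fun V (\<lambda>e. f e ^ n)"
proof (induction n)
  case 0
  then show ?case
    by (simp add: term_fun_1)
next
  case (Suc n)
  then show ?case
    unfolding power_Suc by (intro term_fun_mult)
qed

lemmas term_fun_intros = term_fun_var term_fun_0 term_fun_1 term_fun_uminus term_fun_add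
  term_fun_mult term_fun_diff term_fun_power

text \<open>Asking for a formula in every variable makes it unnecessary to substitute into formulas.\<close>

definition definable_set :: "'a::comm_ring_1 set \<Rightarrow> bool" where
  "definable_set S \<longleftrightarrow> (\<forall>i V. i \<in> V \<longrightarrow> definable V (\<lambda>e. e i \<in> S))"

lemma empty_definableI:
  assumes "definable_set S"
  shows "empty_definable S"
proof -
  have "definable {0} (\<lambda>e. e 0 \<in> S)"
    using assms unfolding definable_set_def by blast
  then obtain \<phi> where "free_vars \<phi> \<subseteq> {0}" "\<forall>e. satisfies e \<phi> \<longleftrightarrow> e 0 \<in> S"
    unfolding definable_def by blast
  then show ?thesis
    unfolding empty_definable_def by (intro exI[of _ \<phi>]) auto
qed

lemma term_value_cong: "(\<And>n. n \<in> term_vars t \<Longrightarrow> e n = e' n) \<Longrightarrow> term_value e t = term_value e' t"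
  by (induction t) auto

lemma finite_term_vars: "finite (term_vars t)"
  by (induction t) auto

text \<open>A term is substituted by quantifying over a variable equal to it; freshness of the
  variable keeps the value of the term unchanged under the quantifier.\<close>

lemma definable_mem:
  assumes "definable_set S" "term_fun V f"
  shows "definable V (\<lambda>e. f e \<in> S)"
proof -
  obtain t where t: "term_vars t \<subseteq> V" "\<And>e. term_value e t = f e"
    using assms(2) unfolding term_fun_def by blast
  obtain n where n: "n \<notin> term_vars t"
    using ex_new_if_finite[OF infinite_UNIV_nat finite_term_vars] by blast
  let ?W = "insert n (term_vars t)"
  have "definable ?W (\<lambda>e. e n = f e \<and> e n \<in> S)"
  proof (intro definable_conj definable_eq)
    show "term_fun ?W (\<lambda>e. e n)"
      by (rule term_fun_var) simp
    show "term_fun ?W f"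
      using t(2) unfolding term_fun_def by blast
    show "definable ?W (\<lambda>e. e n \<in> S)"
      using assms(1) unfolding definable_set_def by blast
  qed
  then have "definable V (\<lambda>e. \<exists>x. x = f e \<and> x \<in> S)"
  proof (rule definable_Ex[where P = "\<lambda>e x. x = f e \<and> x \<in> S"])
    show "?W \<subseteq> insert n V"
      using t(1) by blast
    fix e :: "nat \<Rightarrow> 'a" and x y
    have "f (e(n := x)) = f e"
      unfolding t(2)[symmetric] using n by (intro term_value_cong) auto
    then show "(y = f (e(n := x)) \<and> y \<in> S) \<longleftrightarrow> (y = f e \<and> y \<in> S)"
      by simp
  qed
  then show ?thesis
    by simp
qed

lemmas definable_intros = definable_neg definable_conj definable_disj definable_eq
  definable_mem term_fun_intros

lemma definable_set_unary:
  assumes "\<And>i V. i \<in> V \<Longrightarrow> definable V (\<lambda>e. Q (e i))"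
  shows "definable_set {x. Q x}"
  using assms unfolding definable_set_def by simp

lemma definable_set_Ex:
  assumes "\<And>i j V. \<lbrakk>i \<in> V; j \<in> V\<rbrakk> \<Longrightarrow> definable V (\<lambda>e. Q (e i) (e j))"
  shows "definable_set {x. \<exists>y. Q x y}"
  unfolding definable_set_def
proof (intro allI impI)
  fix i :: nat and V :: "nat set"
  assume "i \<in> V"
  then show "definable V (\<lambda>e. e i \<in> {x. \<exists>y. Q x y})"
    using assms[of i "{i, Suc i}" "Suc i"]
    by (auto intro!: definable_Ex[where n = "Suc i" and W = "{i, Suc i}"])
qed

lemma definable_set_Ex2:
  assumes "\<And>i j k V. \<lbrakk>i \<in> V; j \<in> V; k \<in> V\<rbrakk> \<Longrightarrow> definable V (\<lambda>e. Q (e i) (e j) (e k))"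
  shows "definable_set {x. \<exists>y z. Q x y z}"
  unfolding definable_set_def
proof (intro allI impI)
  fix i :: nat and V :: "nat set"
  assume "i \<in> V"
  have "definable {i, i + 1} (\<lambda>e. \<exists>z. Q (e i) (e (i + 1)) z)"
    using assms[of i "{i, i + 1, i + 2}" "i + 1" "i + 2"]
    by (intro definable_Ex[where n = "i + 2" and W = "{i, i + 1, i + 2}"]) auto
  then show "definable V (\<lambda>e. e i \<in> {x. \<exists>y z. Q x y z})"
    using \<open>i \<in> V\<close>
    by (auto intro!: definable_Ex[where n = "i + 1" and W = "{i, i + 1}" and P = "\<lambda>e y. \<exists>z. Q (e i) y z"])
qed

lemma definable_set_Ex3:
  assumes "\<And>i j k l V. \<lbrakk>i \<in> V; j \<in> V; k \<in> V; l \<in> V\<rbrakk> \<Longrightarrow> definable V (\<lambda>e. Q (e i) (e j) (e k) (e l))"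
  shows "definable_set {x. \<exists>y z w. Q x y z w}"
  unfolding definable_set_def
proof (intro allI impI)
  fix i :: nat and V :: "nat set"
  assume "i \<in> V"
  have "definable {i, i + 1, i + 2} (\<lambda>e. \<exists>w. Q (e i) (e (i + 1)) (e (i + 2)) w)"
    using assms[of i "{i, i + 1, i + 2, i + 3}" "i + 1" "i + 2" "i + 3"]
    by (intro definable_Ex[where n = "i + 3" and W = "{i, i + 1, i + 2, i + 3}"]) auto
  then have "definable {i, i + 1} (\<lambda>e. \<exists>z w. Q (e i) (e (i + 1)) z w)"
    by (intro definable_Ex[where n = "i + 2" and W = "{i, i + 1, i + 2}" and
      P = "\<lambda>e z. \<exists>w. Q (e i) (e (i + 1)) z w"]) auto
  then have "definable V (\<lambda>e. \<exists>y z w. Q (e i) y z w)"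
  proof (rule definable_Ex[where P = "\<lambda>e y. \<exists>z w. Q (e i) y z w"])
    show "{i, i + 1} \<subseteq> insert (i + 1) V"
      using \<open>i \<in> V\<close> by blast
    fix e :: "nat \<Rightarrow> 'a" and x y
    show "(\<exists>z w. Q ((e(i + 1 := x)) i) y z w) \<longleftrightarrow> (\<exists>z w. Q (e i) y z w)"
      by simp
  qed
  then show "definable V (\<lambda>e. e i \<in> {x. \<exists>y z w. Q x y z w})"
    by simp
qed

lemma definable_set_Un: "\<lbrakk>definable_set S; definable_set T\<rbrakk> \<Longrightarrow> definable_set (S \<union> T)"
  unfolding definable_set_def Un_iff by (intro allI impI definable_disj) blast+

lemma definable_set_Compl: "definable_set S \<Longrightarrow> definable_set (- S)"
  unfolding definable_set_def Compl_iff by (intro allI impI definable_neg) blast+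

lemma definable_set_insert_0: "definable_set S \<Longrightarrow> definable_set (insert 0 S)"
  unfolding definable_set_def insert_iff
  by (intro allI impI definable_disj definable_eq term_fun_var term_fun_0) blast+

section \<open>The valuation of a valuation ring\<close>

definition unit_coset :: "'a::field set \<Rightarrow> 'a \<Rightarrow> 'a set" where
  "unit_coset V x = {y. y \<noteq> 0 \<and> y / x \<in> val_units V}"

text \<open>The multiplicative group modulo the units of \<open>V\<close>. The cosets themselves
  serve as values, which puts the group on the type \<open>'a set\<close>; the order is divisibility
  in \<open>V\<close>.\<close>

definition value_group :: "'a::field set \<Rightarrow> 'a set monoid" where
  "value_group V = \<lparr>carrier = unit_coset V ` (- {0}),
     mult = \<lambda>A B. {a * b | a b. a \<in> A \<and> b \<in> B}, one = val_units V\<rparr>"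

definition value_order :: "'a::field set \<Rightarrow> 'a set rel" where
  "value_order V = {(unit_coset V x, unit_coset V y) | x y. x \<noteq> 0 \<and> y \<noteq> 0 \<and> y / x \<in> V}"

definition coset_value :: "'a::field set \<Rightarrow> 'a \<Rightarrow> 'a set option" where
  "coset_value V x = (if x = 0 then None else Some (unit_coset V x))"

context valring
begin

lemma unit_coset_eq_iff:
  assumes "x \<noteq> 0" "y \<noteq> 0"
  shows "unit_coset V x = unit_coset V y \<longleftrightarrow> y / x \<in> val_units V"
proof
  assume "unit_coset V x = unit_coset V y"
  moreover have "y \<in> unit_coset V y"
    using assms one_unit by (simp add: unit_coset_def)
  ultimately have "y \<in> unit_coset V x"
    by simp
  then show "y / x \<in> val_units V"
    by (simp add: unit_coset_def)
next
  assume *: "y / x \<in> val_units V"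
  have "z / x \<in> val_units V \<longleftrightarrow> z / y \<in> val_units V" for z
    using mult_unit[OF _ *, of "z / y"] divide_unit[OF _ *, of "z / x"] assms by auto
  then show "unit_coset V x = unit_coset V y"
    by (auto simp: unit_coset_def)
qed

lemma unit_coset_1: "unit_coset V 1 = val_units V"
  by (rule Set.set_eqI) (simp only: unit_coset_def val_units_def mem_Collect_eq div_by_1, blast)

lemma unit_coset_mult:
  assumes "x \<noteq> 0" "y \<noteq> 0"
  shows "unit_coset V x \<otimes>\<^bsub>value_group V\<^esub> unit_coset V y = unit_coset V (x * y)"
proof -
  have "\<exists>a b. z = a * b \<and> a \<in> unit_coset V x \<and> b \<in> unit_coset V y" if "z \<in> unit_coset V (x * y)" for z
    using that assms one_unit
    by (intro exI[of _ "z / y"] exI[of _ y]) (auto simp: unit_coset_def mult.commute)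
  moreover have "a * b \<in> unit_coset V (x * y)" if "a \<in> unit_coset V x" "b \<in> unit_coset V y" for a b
    using that mult_unit[of "a / x" "b / y"] by (simp add: unit_coset_def)
  ultimately show ?thesis
    by (auto simp: value_group_def)
qed

lemma value_order_iff:
  assumes "x \<noteq> 0" "y \<noteq> 0"
  shows "(unit_coset V x, unit_coset V y) \<in> value_order V \<longleftrightarrow> y / x \<in> V"
proof
  assume "(unit_coset V x, unit_coset V y) \<in> value_order V"
  then obtain x' y' where *: "unit_coset V x = unit_coset V x'" "unit_coset V y = unit_coset V y'"
    "x' \<noteq> 0" "y' \<noteq> 0" "y' / x' \<in> V"
    by (auto simp: value_order_def)
  then have "x' / x \<in> V" "y / y' \<in> V"
    using unit_coset_eq_iff[of x x'] unit_coset_eq_iff[of y' y] assms by (auto intro: unit_mem)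
  then have "y' / x' * (x' / x) * (y / y') \<in> V"
    using * by (intro mult_mem)
  then show "y / x \<in> V"
    using * assms by simp
qed (use assms in \<open>auto simp: value_order_def\<close>)

lemma valuation_coset_value: "valuation (value_group V) (value_order V) (coset_value V)"
proof -
  have carrierI [simp]: "unit_coset V x \<in> carrier (value_group V)" if "x \<noteq> 0" for x
    using that by (simp add: value_group_def)
  have carrierE: thesis if "A \<in> carrier (value_group V)"
    "\<And>x. \<lbrakk>x \<noteq> 0; A = unit_coset V x\<rbrakk> \<Longrightarrow> thesis" for A thesis
    using that by (auto simp: value_group_def)
  have one: "\<one>\<^bsub>value_group V\<^esub> = unit_coset V 1"
    by (simp add: unit_coset_1) (simp add: value_group_def)
  interpret comm_group "value_group V"
  proof (rule comm_groupI)
    fix A assume "A \<in> carrier (value_group V)"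
    then obtain x where x: "x \<noteq> 0" "A = unit_coset V x"
      by (rule carrierE)
    show "\<one>\<^bsub>value_group V\<^esub> \<otimes>\<^bsub>value_group V\<^esub> A = A"
      using x by (simp add: one unit_coset_mult)
    show "\<exists>B\<in>carrier (value_group V). B \<otimes>\<^bsub>value_group V\<^esub> A = \<one>\<^bsub>value_group V\<^esub>"
      using x by (intro bexI[of _ "unit_coset V (inverse x)"]) (simp_all add: one unit_coset_mult)
    fix B assume "B \<in> carrier (value_group V)"
    then obtain y where y: "y \<noteq> 0" "B = unit_coset V y"
      by (rule carrierE)
    show "A \<otimes>\<^bsub>value_group V\<^esub> B \<in> carrier (value_group V)"
      "A \<otimes>\<^bsub>value_group V\<^esub> B = B \<otimes>\<^bsub>value_group V\<^esub> A"
      using x y by (simp_all add: unit_coset_mult mult.commute)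
    fix C assume "C \<in> carrier (value_group V)"
    then obtain z where "z \<noteq> 0" "C = unit_coset V z"
      by (rule carrierE)
    then show "A \<otimes>\<^bsub>value_group V\<^esub> B \<otimes>\<^bsub>value_group V\<^esub> C =
        A \<otimes>\<^bsub>value_group V\<^esub> (B \<otimes>\<^bsub>value_group V\<^esub> C)"
      using x y by (simp add: unit_coset_mult mult.assoc)
  qed (simp add: one)
  show ?thesis
  proof unfold_locales
    show "linear_order_on (carrier (value_group V)) (value_order V)"
      unfolding linear_order_on_def partial_order_on_def preorder_on_def
    proof (intro conjI)
      show "value_order V \<subseteq> carrier (value_group V) \<times> carrier (value_group V)"
        by (auto simp: value_order_def)
      show "refl_on (carrier (value_group V)) (value_order V)"
        by (auto simp: refl_on_def value_order_iff one_mem elim!: carrierE)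
      show "trans (value_order V)"
      proof (rule transI)
        fix A B C
        assume "(A, B) \<in> value_order V" "(B, C) \<in> value_order V"
        then obtain x y y' z where *: "A = unit_coset V x" "B = unit_coset V y" "B = unit_coset V y'"
          "C = unit_coset V z" "x \<noteq> 0" "y \<noteq> 0" "y' \<noteq> 0" "z \<noteq> 0" "y / x \<in> V" "z / y' \<in> V"
          by (auto simp: value_order_def)
        then have "z / y \<in> V"
          using value_order_iff[of y z] by (auto simp: value_order_def)
        then have "z / y * (y / x) \<in> V"
          using * by (intro mult_mem)
        then show "(A, C) \<in> value_order V"
          using * by (simp add: value_order_iff)
      qed
      show "antisym (value_order V)"
      proof (rule antisymI)
        fix A B
        assume "(A, B) \<in> value_order V" "(B, A) \<in> value_order V"
        then obtain x y where *: "A = unit_coset V x" "B = unit_coset V y" "x \<noteq> 0" "y \<noteq> 0" "y / x \<in> V"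
          "(B, A) \<in> value_order V"
          by (auto simp: value_order_def)
        then have "x / y \<in> V"
          by (simp add: value_order_iff)
        then show "A = B"
          using * by (simp add: unit_coset_eq_iff val_units_def)
      qed
      show "total_on (carrier (value_group V)) (value_order V)"
        unfolding total_on_def by (metis carrierE value_order_iff quotient_cases)
    qed
  next
    fix A B C
    assume "(A, B) \<in> value_order V" "C \<in> carrier (value_group V)"
    then obtain x y z where "A = unit_coset V x" "B = unit_coset V y" "C = unit_coset V z"
      "x \<noteq> 0" "y \<noteq> 0" "z \<noteq> 0" "y / x \<in> V"
      by (auto simp: value_order_def elim!: carrierE)
    then show "(A \<otimes>\<^bsub>value_group V\<^esub> C, B \<otimes>\<^bsub>value_group V\<^esub> C) \<in> value_order V"
      by (simp add: unit_coset_mult value_order_iff)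
  next
    fix x
    show "coset_value V x = None \<longleftrightarrow> x = 0"
      by (simp add: coset_value_def)
    show "A \<in> carrier (value_group V)" if "coset_value V x = Some A" for A
      using that by (auto simp: coset_value_def split: if_splits)
    fix y
    show "coset_value V (x * y) = Some (A \<otimes>\<^bsub>value_group V\<^esub> B)"
      if "coset_value V x = Some A" "coset_value V y = Some B" for A B
      using that by (auto simp: coset_value_def unit_coset_mult split: if_splits)
    show "value_le (value_order V) (coset_value V x) (coset_value V (x + y)) \<or>
      value_le (value_order V) (coset_value V y) (coset_value V (x + y))"
    proof (cases "x = 0 \<or> y = 0 \<or> x + y = 0")
      case True
      then show ?thesis
        using one_mem by (auto simp: coset_value_def value_order_iff)
    next
      case False
      then have "(x + y) / x \<in> V \<or> (x + y) / y \<in> V"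
        using quotient_cases[of x y] add_mem[OF one_mem, of "y / x"] add_mem[OF _ one_mem, of "x / y"]
        by (auto simp: add_divide_distrib)
      then show ?thesis
        using False by (auto simp: coset_value_def value_order_iff)
    qed
  qed
qed

lemma valuation_ring_coset_value:
  "valuation_ring (value_group V) (value_order V) (coset_value V) = V"
proof -
  have one: "\<one>\<^bsub>value_group V\<^esub> = unit_coset V 1"
    by (simp add: unit_coset_1) (simp add: value_group_def)
  show ?thesis
    by (auto simp: valuation_ring_def coset_value_def one value_order_iff zero_mem split: if_splits)
qed

theorem admits_definable_valuation:
  assumes "V \<noteq> UNIV" "definable_set V"
  shows "admits_nontrivial_empty_definable_valuation TYPE('a)"
proof -
  obtain x where "x \<notin> V"
    using assms(1) by blast
  then have "x \<noteq> 0" "inverse x \<notin> val_units V"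
    using zero_mem by (auto simp: val_units_def)
  then have "unit_coset V x \<noteq> val_units V"
    using unit_coset_eq_iff[of x 1] by (simp add: unit_coset_1 inverse_eq_divide)
  then have "nontrivial_valuation (value_group V) (coset_value V)"
    unfolding nontrivial_valuation_def using \<open>x \<noteq> 0\<close>
    by (intro exI[of _ x]) (simp add: coset_value_def value_group_def)
  moreover have "empty_definable (valuation_ring (value_group V) (value_order V) (coset_value V))"
    using empty_definableI[OF assms(2)] by (simp add: valuation_ring_coset_value)
  ultimately show ?thesis
    unfolding admits_nontrivial_empty_definable_valuation_def
    using valuation_coset_value
    by (intro exI[of _ "value_group V"] exI[of _ "value_order V"] exI[of _ "coset_value V"] conjI)
qed

end

section \<open>Absolute values up to a constant\<close>

text \<open>Homogenization along powers of two: consecutive terms of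
  \<open>k (x ^ (2 ^ n)) / 2 ^ n\<close> differ by at most \<open>c / 2 ^ Suc n\<close>, so they
  converge within distance \<open>c\<close> of \<open>k x\<close>. The defect of additivity is at
  most \<open>c / 2 ^ n\<close> and vanishes in the limit.\<close>

lemma quasimorphism_limit:
  fixes k :: "'a::comm_monoid_mult \<Rightarrow> real"
  assumes mult: "\<And>x y. \<lbrakk>x \<in> U; y \<in> U\<rbrakk> \<Longrightarrow> x * y \<in> U"
    and k: "\<And>x y. \<lbrakk>x \<in> U; y \<in> U\<rbrakk> \<Longrightarrow> \<bar>k (x * y) - k x - k y\<bar> \<le> c"
  obtains \<phi> where "\<And>x y. \<lbrakk>x \<in> U; y \<in> U\<rbrakk> \<Longrightarrow> \<phi> (x * y) = \<phi> x + \<phi> y"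
    "\<And>x. x \<in> U \<Longrightarrow> \<bar>\<phi> x - k x\<bar> \<le> c"
proof -
  define s where "s x n = k (x ^ (2 ^ n)) / 2 ^ n" for x n
  have pow: "x ^ (2 ^ n) \<in> U" if "x \<in> U" for x n
    using that by (induction n) (simp_all add: mult_2 power_add mult)
  have sq: "x ^ (2 ^ Suc n) = x ^ (2 ^ n) * x ^ (2 ^ n)" for x :: 'a and n
    unfolding power_Suc mult_2 power_add ..
  have step: "\<bar>s x (Suc n) - s x n\<bar> \<le> c / 2 ^ Suc n" if "x \<in> U" for x n
  proof -
    have "\<bar>k (x ^ (2 ^ n) * x ^ (2 ^ n)) - k (x ^ (2 ^ n)) - k (x ^ (2 ^ n))\<bar> \<le> c"
      by (intro k pow that)
    moreover have "s x (Suc n) - s x n = (k (x ^ (2 ^ n) * x ^ (2 ^ n)) - k (x ^ (2 ^ n)) - k (x ^ (2 ^ n))) / 2 ^ Suc n"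
      unfolding s_def sq by (simp add: diff_divide_distrib)
    ultimately show ?thesis
      by (simp add: divide_right_mono)
  qed
  have dist: "\<bar>s x n - k x\<bar> \<le> c * (1 - 1 / 2 ^ n)" if "x \<in> U" for x n
  proof (induction n)
    case 0
    show ?case
      by (simp add: s_def)
  next
    case (Suc n)
    have "\<bar>s x (Suc n) - k x\<bar> \<le> \<bar>s x (Suc n) - s x n\<bar> + \<bar>s x n - k x\<bar>"
      by simp
    also have "\<dots> \<le> c / 2 ^ Suc n + c * (1 - 1 / 2 ^ n)"
      using Suc step[OF that, of n] by simp
    also have "\<dots> = c * (1 - 1 / 2 ^ Suc n)"
      by (simp add: field_simps)
    finally show ?case .
  qed
  have conv: "convergent (s x)" if "x \<in> U" for x
  proof -
    have "summable (\<lambda>n. s x (Suc n) - s x n)"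
    proof (rule summable_comparison_test')
      show "summable (\<lambda>n. c / 2 * (1 / 2) ^ n)"
        by (intro summable_mult summable_geometric) simp
      show "norm (s x (Suc n) - s x n) \<le> c / 2 * (1 / 2) ^ n" if "0 \<le> n" for n
        using step[OF \<open>x \<in> U\<close>, of n] by (simp add: power_divide)
    qed
    then have "convergent (\<lambda>n. \<Sum>i<n. s x (Suc i) - s x i)"
      by (simp add: summable_iff_convergent)
    then have "convergent (\<lambda>n. s x n - s x 0)"
      by (simp add: sum_lessThan_telescope)
    from convergent_add[OF this convergent_const[of "s x 0"]] show ?thesis
      by simp
  qed
  define \<phi> where "\<phi> x = lim (s x)" for x
  have lim: "s x \<longlonglongrightarrow> \<phi> x" if "x \<in> U" for x
    using conv[OF that] by (simp add: \<phi>_def convergent_LIMSEQ_iff)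
  show ?thesis
  proof
    fix x y
    assume xy: "x \<in> U" "y \<in> U"
    have "(\<lambda>n. s (x * y) n - s x n - s y n) \<longlonglongrightarrow> \<phi> (x * y) - \<phi> x - \<phi> y"
      by (intro tendsto_diff lim mult xy)
    moreover have "(\<lambda>n. s (x * y) n - s x n - s y n) \<longlonglongrightarrow> 0"
    proof (rule Lim_null_comparison)
      show "\<forall>\<^sub>F n in sequentially. norm (s (x * y) n - s x n - s y n) \<le> c * (1 / 2) ^ n"
      proof (rule always_eventually, rule allI)
        fix n
        have "\<bar>k (x ^ (2 ^ n) * y ^ (2 ^ n)) - k (x ^ (2 ^ n)) - k (y ^ (2 ^ n))\<bar> \<le> c"
          by (intro k pow xy)
        moreover have "s (x * y) n - s x n - s y n =
            (k (x ^ (2 ^ n) * y ^ (2 ^ n)) - k (x ^ (2 ^ n)) - k (y ^ (2 ^ n))) / 2 ^ n"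
          by (simp add: s_def power_mult_distrib diff_divide_distrib)
        ultimately show "norm (s (x * y) n - s x n - s y n) \<le> c * (1 / 2) ^ n"
          by (simp add: divide_right_mono power_divide)
      qed
      show "(\<lambda>n. c * (1 / 2) ^ n) \<longlonglongrightarrow> 0"
        by (intro tendsto_mult_right_zero LIMSEQ_power_zero) simp
    qed
    ultimately show "\<phi> (x * y) = \<phi> x + \<phi> y"
      using LIMSEQ_unique by fastforce
  next
    fix x
    assume x: "x \<in> U"
    have c: "0 \<le> c"
      using k[OF x x] by linarith
    have "\<bar>s x n - k x\<bar> \<le> c" for n
      using dist[OF x, of n] by (rule order_trans) (use c in \<open>simp add: mult_left_le\<close>)
    moreover have "(\<lambda>n. \<bar>s x n - k x\<bar>) \<longlonglongrightarrow> \<bar>\<phi> x - k x\<bar>"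
      by (intro tendsto_intros lim x)
    ultimately show "\<bar>\<phi> x - k x\<bar> \<le> c"
      by (intro LIMSEQ_le_const2[of "\<lambda>n. \<bar>s x n - k x\<bar>"]) auto
  qed
qed

text \<open>Roots of order \<open>2 ^ m\<close> remove the constants, because
  \<open>(ln A + m ln B) / 2 ^ m\<close> tends to \<open>0\<close>.\<close>

lemma root_growth:
  fixes a b A B :: real
  assumes le: "\<And>m::nat. a ^ (2 ^ m) \<le> A * B ^ m * b ^ (2 ^ m)" and "b \<ge> 0" "A > 0" "B > 0"
  shows "a \<le> b"
proof (rule ccontr)
  assume "\<not> a \<le> b"
  then have "b > 0" "a > 0"
    using le[of 0] assms(2-) by (auto simp: le_less)
  have "ln (a / b) \<le> ln A * (1 / 2 ^ m) + ln B * (real m / 2 ^ m)" for m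
  proof -
    have "(a / b) ^ (2 ^ m) \<le> A * B ^ m"
      using le[of m] \<open>b > 0\<close> by (simp add: power_divide divide_le_eq)
    then have "ln ((a / b) ^ (2 ^ m)) \<le> ln (A * B ^ m)"
      using \<open>a > 0\<close> \<open>b > 0\<close> assms(3,4) by (subst ln_le_cancel_iff) auto
    then have "2 ^ m * ln (a / b) \<le> ln A + real m * ln B"
      using \<open>a > 0\<close> \<open>b > 0\<close> assms(3,4) by (simp add: ln_realpow ln_mult)
    then show ?thesis
      by (simp add: field_simps)
  qed
  moreover have "(\<lambda>m. ln A * (1 / 2 ^ m) + ln B * (real m / 2 ^ m)) \<longlonglongrightarrow> ln A * 0 + ln B * 0"
  proof (intro tendsto_intros)
    show "(\<lambda>m. 1 / 2 ^ m :: real) \<longlonglongrightarrow> 0" "(\<lambda>m. real m / 2 ^ m) \<longlonglongrightarrow> 0"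
      by real_asymp+
  qed
  ultimately have "ln (a / b) \<le> 0"
    by (intro LIMSEQ_le_const[of "\<lambda>m. ln A * (1 / 2 ^ m) + ln B * (real m / 2 ^ m)"]) auto
  then show False
    using \<open>\<not> a \<le> b\<close> \<open>b > 0\<close> \<open>a > 0\<close> by (simp add: ln_div)
qed

section \<open>Absolute values with a weakened triangle inequality\<close>

text \<open>In essence an absolute value on the residue field of \<open>D\<close>, pulled back to
  \<open>D\<close>, with the triangle inequality relaxed by the factor \<open>C\<close>. Outside
  \<open>D\<close> only the sign is prescribed.\<close>

locale quasi_absolute_value = valring D for D :: "'a::field set" +
  fixes N :: "'a \<Rightarrow> real" and C :: real
  assumes N_nonneg: "N x \<ge> 0"
    and N_zero_iff: "x \<in> D \<Longrightarrow> N x = 0 \<longleftrightarrow> x \<in> nonunits D"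
    and N_mult: "\<lbrakk>x \<in> D; y \<in> D\<rbrakk> \<Longrightarrow> N (x * y) = N x * N y"
    and N_add: "\<lbrakk>x \<in> D; y \<in> D\<rbrakk> \<Longrightarrow> N (x + y) \<le> C * max (N x) (N y)"
    and C_ge_1: "C \<ge> 1"
begin

lemma N_0: "N 0 = 0"
  using N_zero_iff[of 0] zero_mem by simp

lemma N_1: "N 1 = 1"
  using N_mult[of 1 1] N_zero_iff[of 1] one_mem one_not_nonunit by simp

lemma N_power: "x \<in> D \<Longrightarrow> N (x ^ n) = N x ^ n"
  by (induction n) (simp_all add: N_1 N_mult power_mem)

lemma N_neg_1: "N (- 1) = 1"
proof -
  have "N (- 1) ^ 2 = 1"
    using N_power[of "- 1" 2] neg_mem[OF one_mem] by (simp add: N_1)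
  then show ?thesis
    using N_nonneg[of "- 1"] by (simp add: power2_eq_1_iff)
qed

lemma N_neg: "x \<in> D \<Longrightarrow> N (- x) = N x"
  using N_mult[of "- 1" x] neg_mem[OF one_mem] by (simp add: N_neg_1)

lemma N_diff: "\<lbrakk>x \<in> D; y \<in> D\<rbrakk> \<Longrightarrow> N (x - y) \<le> C * max (N x) (N y)"
  using N_add[of x "- y"] neg_mem N_neg by simp

lemma N_inverse: "x \<in> val_units D \<Longrightarrow> N (inverse x) = inverse (N x)"
  using N_mult[of x "inverse x"] unit_mem[of x] unit_mem[OF inverse_unit, of x] unit_nonzero[of x]
  by (intro inverse_unique[symmetric]) (simp add: N_1)

lemma N_pos: "x \<in> val_units D \<Longrightarrow> N x > 0"
  using N_zero_iff[of x] N_nonneg[of x] by (auto simp: unit_iff less_le)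

lemma N_divide: "\<lbrakk>x \<in> D; y \<in> val_units D\<rbrakk> \<Longrightarrow> N (x / y) = N x / N y"
  by (simp add: divide_inverse N_mult N_inverse unit_mem inverse_unit)

text \<open>Each halving of the sum costs one factor \<open>C\<close>, so the constant grows only
  with the logarithm of the number of summands, which \<open>root_growth\<close> tolerates.\<close>

lemma N_sum_power2:
  fixes m :: nat
  assumes "\<And>i::nat. i < 2 ^ m \<Longrightarrow> f i \<in> D \<and> N (f i) \<le> b"
  shows "N (\<Sum>i<2 ^ m. f i) \<le> C ^ m * b"
  using assms
proof (induction m arbitrary: f)
  case (Suc m)
  have "(\<Sum>i<2 ^ Suc m. f i) = (\<Sum>i<2 ^ m. f i) + (\<Sum>i=2 ^ m..<2 ^ m + 2 ^ m. f i)"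
    unfolding lessThan_atLeast0 by (subst sum.atLeastLessThan_concat) (simp_all add: mult_2)
  also have "(\<Sum>i=2 ^ m..<2 ^ m + 2 ^ m. f i) = (\<Sum>i<2 ^ m. f (i + 2 ^ m))"
    using sum.shift_bounds_nat_ivl[of f 0 "2 ^ m" "2 ^ m"] by (simp add: lessThan_atLeast0)
  finally have split: "(\<Sum>i<2 ^ Suc m. f i) = (\<Sum>i<2 ^ m. f i) + (\<Sum>i<2 ^ m. f (i + 2 ^ m))" .
  have *: "N (\<Sum>i<2 ^ m. f i) \<le> C ^ m * b" "N (\<Sum>i<2 ^ m. f (i + 2 ^ m)) \<le> C ^ m * b"
    using Suc.prems by (auto intro!: Suc.IH)
  have "N (\<Sum>i<2 ^ Suc m. f i) \<le> C * max (N (\<Sum>i<2 ^ m. f i)) (N (\<Sum>i<2 ^ m. f (i + 2 ^ m)))"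
    unfolding split using Suc.prems by (intro N_add sum_mem) auto
  also have "\<dots> \<le> C * (C ^ m * b)"
    using * C_ge_1 by (intro mult_left_mono) auto
  finally show ?case
    by (simp add: mult.assoc)
qed auto

lemma N_sum:
  fixes n m :: nat
  assumes "\<And>i. i < n \<Longrightarrow> f i \<in> D \<and> N (f i) \<le> b" "n \<le> 2 ^ m" "b \<ge> 0"
  shows "N (\<Sum>i<n. f i) \<le> C ^ m * b"
proof -
  have "(\<Sum>i<n. f i) = (\<Sum>i<2 ^ m. if i < n then f i else 0)"
    using assms(2) by (intro sum.mono_neutral_cong_left) auto
  also have "N \<dots> \<le> C ^ m * b"
    using assms by (intro N_sum_power2) (auto simp: N_0 zero_mem)
  finally show ?thesis .
qed

text \<open>The binomial expansion of \<open>(x + y) ^ (2 ^ m)\<close> has \<open>2 ^ m + 1\<close>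
  terms with coefficients of size at most \<open>1\<close>; summing them costs
  \<open>C ^ Suc m\<close>, which disappears after taking roots.\<close>

lemma ultrametric:
  assumes nat: "\<And>n. N (of_nat n) \<le> 1" and xy: "x \<in> D" "y \<in> D"
  shows "N (x + y) \<le> max (N x) (N y)"
proof (rule root_growth)
  let ?b = "max (N x) (N y)"
  show b: "?b \<ge> 0"
    using N_nonneg[of x] by linarith
  fix m :: nat
  have "N ((x + y) ^ (2 ^ m)) \<le> C ^ Suc m * ?b ^ (2 ^ m)"
    unfolding binomial_ring lessThan_Suc_atMost[symmetric]
  proof (intro N_sum conjI)
    fix k
    assume "k < Suc (2 ^ m)"
    have "N x ^ k * N y ^ (2 ^ m - k) \<le> ?b ^ k * ?b ^ (2 ^ m - k)"
      using b by (intro mult_mono power_mono zero_le_power N_nonneg) auto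
    also have "\<dots> = ?b ^ (2 ^ m)"
      using \<open>k < Suc (2 ^ m)\<close> by (simp flip: power_add)
    finally have "N (of_nat (2 ^ m choose k)) * (N x ^ k * N y ^ (2 ^ m - k)) \<le> 1 * ?b ^ (2 ^ m)"
      by (intro mult_mono nat) (auto simp: N_nonneg)
    then show "N (of_nat (2 ^ m choose k) * x ^ k * y ^ (2 ^ m - k)) \<le> ?b ^ (2 ^ m)"
      by (simp add: N_mult N_power mult_mem power_mem of_nat_mem xy mult.assoc)
    show "of_nat (2 ^ m choose k) * x ^ k * y ^ (2 ^ m - k) \<in> D"
      by (intro mult_mem power_mem of_nat_mem xy)
  qed (use b in auto)
  then show "N (x + y) ^ 2 ^ m \<le> C * C ^ m * ?b ^ 2 ^ m"
    by (simp add: N_power add_mem xy)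
qed (use C_ge_1 in auto)

text \<open>Ostrowski's argument: expand the powers of \<open>a\<close> to the base \<open>b\<close>.\<close>

lemma base_expansion:
  fixes b x L :: nat
  assumes "b \<ge> 2" "x < b ^ L"
  obtains d where "\<And>i. d i < b" "x = (\<Sum>i<L. d i * b ^ i)"
proof -
  have "\<exists>d. (\<forall>i. d i < b) \<and> x = (\<Sum>i<L. d i * b ^ i)"
    using assms(2)
  proof (induction L arbitrary: x)
    case 0
    then show ?case
      using assms(1) by (intro exI[of _ "\<lambda>_. 0"]) auto
  next
    case (Suc L)
    have "x div b < b ^ L"
      using Suc.prems assms(1) by (simp add: div_less_iff_less_mult mult.commute)
    then obtain d where d: "\<forall>i. d i < b" "x div b = (\<Sum>i<L. d i * b ^ i)"
      using Suc.IH by blast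
    have "x = x mod b + b * (x div b)"
      by simp
    also have "\<dots> = (\<Sum>i<Suc L. (case i of 0 \<Rightarrow> x mod b | Suc j \<Rightarrow> d j) * b ^ i)"
      unfolding d(2) sum.lessThan_Suc_shift by (simp add: sum_distrib_left mult_ac)
    finally show ?case
      using d(1) assms(1)
      by (intro exI[of _ "\<lambda>i. case i of 0 \<Rightarrow> x mod b | Suc j \<Rightarrow> d j"]) (auto split: nat.split)
  qed
  then show ?thesis
    using that by blast
qed

text \<open>In base \<open>b\<close> the number \<open>a ^ (2 ^ m)\<close> has about
  \<open>2 ^ m * \<theta>\<close> digits, each contributing at most a constant times a power of
  \<open>\<beta>\<close>. Their number enters only through \<open>C ^ (l + m)\<close>, which is lost
  on taking roots.\<close>

lemma N_nat_bound:
  fixes a b :: nat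
  assumes "a \<ge> 2" "b \<ge> 2"
  shows "N (of_nat a) \<le> max 1 (N (of_nat b)) powr (ln a / ln b)"
proof -
  define \<beta> where "\<beta> = max 1 (N (of_nat b))"
  define \<theta> where "\<theta> = ln a / ln b"
  define K where "K = Max ((\<lambda>d. N (of_nat d)) ` {..<b})"
  obtain l :: nat where l: "\<theta> + 2 \<le> 2 ^ l"
    using real_arch_pow[of 2 "\<theta> + 2"] by (auto intro: less_imp_le)
  have \<theta>: "\<theta> > 0"
    using assms by (simp add: \<theta>_def)
  have K: "N (of_nat d) \<le> K" if "d < b" for d
    unfolding K_def using that by (intro Max_ge) auto
  have "K \<ge> 1"
    using K[of 1] assms N_1 by simp
  have "\<beta> \<ge> 1"
    by (simp add: \<beta>_def)
  have bound: "N (of_nat a) ^ (2 ^ m) \<le> C ^ l * K * \<beta> ^ 2 * C ^ m * (\<beta> powr \<theta>) ^ (2 ^ m)" for m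
  proof -
    \<comment> \<open>The lower bound for \<open>L\<close> makes \<open>b ^ L\<close> exceed the
      number to be expanded; the slack of at most \<open>2\<close> above
      \<open>2 ^ m * \<theta>\<close> is the source of the factor
      \<open>\<beta> ^ 2\<close>.\<close>
    define L where "L = nat \<lceil>2 ^ m * \<theta>\<rceil> + 1"
    have L: "2 ^ m * \<theta> < L" "L \<le> 2 ^ m * \<theta> + 2"
      using \<theta> by (auto simp: L_def) linarith+
    have "ln (real a ^ (2 ^ m)) = 2 ^ m * \<theta> * ln b"
      using assms by (simp add: \<theta>_def ln_realpow)
    also have "\<dots> < L * ln b"
      using L(1) assms by (intro mult_strict_right_mono) auto
    also have "\<dots> = ln (real b ^ L)"
      using assms by (simp add: ln_realpow)
    finally have "real a ^ (2 ^ m) < real b ^ L"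
      using assms by (subst (asm) ln_less_cancel_iff) auto
    then have "a ^ (2 ^ m) < b ^ L"
      by (metis of_nat_less_iff of_nat_power)
    then obtain d where d: "\<And>i. d i < b" "a ^ (2 ^ m) = (\<Sum>i<L. d i * b ^ i)"
      using base_expansion[OF assms(2)] by blast
    have "N (of_nat a ^ (2 ^ m)) = N (\<Sum>i<L. of_nat (d i) * of_nat b ^ i)"
      using arg_cong[OF d(2), of "of_nat :: nat \<Rightarrow> 'a"] by simp
    also have "\<dots> \<le> C ^ (l + m) * (K * \<beta> ^ L)"
    proof (intro N_sum conjI)
      fix i
      assume "i < L"
      show "of_nat (d i) * of_nat b ^ i \<in> D"
        by (intro mult_mem power_mem of_nat_mem)
      have "N (of_nat (d i)) * N (of_nat b) ^ i \<le> K * \<beta> ^ L"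
      proof (intro mult_mono K d)
        have "N (of_nat b) ^ i \<le> \<beta> ^ i"
          by (intro power_mono N_nonneg) (simp add: \<beta>_def)
        also have "\<dots> \<le> \<beta> ^ L"
          using \<open>i < L\<close> \<open>\<beta> \<ge> 1\<close> by (intro power_increasing) auto
        finally show "N (of_nat b) ^ i \<le> \<beta> ^ L" .
      qed (use \<open>K \<ge> 1\<close> in \<open>auto simp: N_nonneg\<close>)
      then show "N (of_nat (d i) * of_nat b ^ i) \<le> K * \<beta> ^ L"
        by (simp add: N_mult N_power of_nat_mem power_mem)
    next
      have "real L \<le> 2 ^ m * (\<theta> + 2)"
        using L(2) by (rule order_trans) (simp add: distrib_left)
      also have "\<dots> \<le> 2 ^ m * 2 ^ l"
        using l by simp
      finally have "real L \<le> real (2 ^ (l + m))"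
        by (simp add: power_add mult.commute)
      then show "L \<le> 2 ^ (l + m)"
        by (simp only: of_nat_le_iff)
    qed (use \<open>K \<ge> 1\<close> \<open>\<beta> \<ge> 1\<close> in auto)
    finally have "N (of_nat a) ^ (2 ^ m) \<le> C ^ (l + m) * (K * \<beta> ^ L)"
      by (simp add: N_power of_nat_mem)
    also have "\<dots> \<le> C ^ (l + m) * (K * (\<beta> ^ 2 * (\<beta> powr \<theta>) ^ (2 ^ m)))"
    proof -
      have "\<beta> ^ L \<le> \<beta> powr (2 ^ m * \<theta> + 2)"
        using powr_realpow[of \<beta> L] powr_mono[OF L(2), of \<beta>] \<open>\<beta> \<ge> 1\<close> by simp
      also have "\<dots> = \<beta> powr 2 * (\<beta> powr \<theta>) powr (2 ^ m)"
        by (simp add: powr_add powr_powr mult.commute)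
      also have "\<dots> = \<beta> ^ 2 * (\<beta> powr \<theta>) ^ (2 ^ m)"
        using powr_realpow[of \<beta> 2] powr_realpow[of "\<beta> powr \<theta>" "2 ^ m"] \<open>\<beta> \<ge> 1\<close> by simp
      finally show ?thesis
        using C_ge_1 \<open>K \<ge> 1\<close> by (intro mult_left_mono) auto
    qed
    finally show ?thesis
      by (simp add: power_add mult_ac)
  qed
  have "N (of_nat a) \<le> \<beta> powr \<theta>"
    by (rule root_growth[OF bound]) (use C_ge_1 \<open>K \<ge> 1\<close> \<open>\<beta> \<ge> 1\<close> in auto)
  then show ?thesis
    by (simp add: \<beta>_def \<theta>_def)
qed

text \<open>If \<open>N\<close> were at most \<open>1\<close> at some \<open>m \<ge> 2\<close>,
  expansion to the base \<open>m\<close> would bound it by \<open>1\<close> at \<open>n\<close> too.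
  Exchanging the roles of two integers then shows that \<open>ln (N a) / ln a\<close> does not
  depend on \<open>a\<close>.\<close>

lemma ostrowski:
  assumes "N (of_nat n) > 1"
  obtains s where "s > 0" "\<And>m::nat. m > 0 \<Longrightarrow> N (of_nat m) = real m powr s"
proof -
  have n: "n \<ge> 2"
  proof (rule ccontr)
    assume "\<not> n \<ge> 2"
    then have "n = 0 \<or> n = 1"
      by linarith
    then show False
      using assms N_0 N_1 by auto
  qed
  have gt1: "N (of_nat m) > 1" if "m \<ge> 2" for m
  proof (rule ccontr)
    assume "\<not> ?thesis"
    then have "max 1 (N (of_nat m)) = 1"
      by simp
    then show False
      using N_nat_bound[OF n that] assms by simp
  qed
  have le: "ln (N (of_nat a)) / ln a \<le> ln (N (of_nat b)) / ln b" if "a \<ge> 2" "b \<ge> 2" for a b :: nat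
  proof -
    have "ln (N (of_nat a)) \<le> ln (N (of_nat b) powr (ln a / ln b))"
      using N_nat_bound[OF that] gt1[OF that(1)] gt1[OF that(2)]
      by (subst ln_le_cancel_iff) (auto simp: max_def)
    also have "\<dots> = ln a / ln b * ln (N (of_nat b))"
      using gt1[OF that(2)] by (simp add: ln_powr)
    finally show ?thesis
      using that by (simp add: field_simps)
  qed
  define s where "s = ln (N (of_nat n)) / ln n"
  show ?thesis
  proof
    show "s > 0"
      using assms n by (simp add: s_def)
    fix m :: nat
    assume "m > 0"
    show "N (of_nat m) = real m powr s"
    proof (cases "m = 1")
      case False
      then have m: "m \<ge> 2"
        using \<open>m > 0\<close> by linarith
      then have "ln (N (of_nat m)) / ln m = s"
        unfolding s_def using le n by (intro antisym) auto
      then have "ln (N (of_nat m)) = s * ln m"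
        using m by (simp add: field_simps)
      then show ?thesis
        using m gt1[OF m] exp_ln[of "N (of_nat m)"] by (simp add: powr_def)
    qed (simp add: N_1)
  qed
qed

end

section \<open>Stages of a generated ring and the absolute value they define\<close>

text \<open>The single operation \<open>x * y + z\<close> yields sums by \<open>y = 1\<close>,
  products by \<open>z = 0\<close> and differences by the initial \<open>- 1\<close>, so one rule
  serves for definability and for boundedness.\<close>

primrec ring_stage :: "'a::comm_ring_1 set \<Rightarrow> nat \<Rightarrow> 'a set" where
  "ring_stage T 0 = T \<union> {0, 1, - 1}"
| "ring_stage T (Suc n) =
    {x * y + z | x y z. x \<in> ring_stage T n \<and> y \<in> ring_stage T n \<and> z \<in> ring_stage T n}"

declare ring_stage.simps(2) [simp del]

lemma ring_stage_SucI:
  "\<lbrakk>x \<in> ring_stage T n; y \<in> ring_stage T n; z \<in> ring_stage T n\<rbrakk> \<Longrightarrow> x * y + z \<in> ring_stage T (Suc n)"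
  unfolding ring_stage.simps(2) by blast

lemma ring_stage_01: "0 \<in> ring_stage T n" "1 \<in> ring_stage T n"
proof (induction n)
  case (Suc n)
  then show "0 \<in> ring_stage T (Suc n)" "1 \<in> ring_stage T (Suc n)"
    using ring_stage_SucI[of 0 T n 0 0] ring_stage_SucI[of 0 T n 0 1] by simp_all
qed simp_all

lemma ring_stage_mult: "\<lbrakk>x \<in> ring_stage T n; y \<in> ring_stage T n\<rbrakk> \<Longrightarrow> x * y \<in> ring_stage T (Suc n)"
  using ring_stage_SucI[of x T n y 0] by (simp add: ring_stage_01)

lemma ring_stage_add: "\<lbrakk>x \<in> ring_stage T n; y \<in> ring_stage T n\<rbrakk> \<Longrightarrow> x + y \<in> ring_stage T (Suc n)"
  using ring_stage_SucI[of x T n 1 y] by (simp add: ring_stage_01)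

lemma ring_stage_mono: "m \<le> n \<Longrightarrow> ring_stage T m \<subseteq> ring_stage T n"
proof (induction n rule: dec_induct)
  case (step n)
  then show ?case
    using ring_stage_mult[OF _ ring_stage_01(2), of _ T n] by force
qed simp

lemma subset_ring_stage: "T \<subseteq> ring_stage T n"
  using ring_stage_mono[of 0 n T] by auto

lemma neg_1_ring_stage: "- 1 \<in> ring_stage T n"
  using ring_stage_mono[of 0 n T] by auto

lemma ring_stage_diff: "\<lbrakk>x \<in> ring_stage T n; y \<in> ring_stage T n\<rbrakk> \<Longrightarrow> x - y \<in> ring_stage T (Suc n)"
  using ring_stage_SucI[of "- 1" T n y x] by (simp add: neg_1_ring_stage)

text \<open>The position of an element in the filtration by the sets \<open>c\<^sup>j B\<close>, where \<open>B\<close> is the stage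
  \<open>n0\<close>, is a quasimorphism; its homogenization is the logarithm of the absolute value.\<close>

locale bounded_exhaustion = valring D for D :: "'a::field set" +
  fixes T :: "'a set" and n0 :: nat
  assumes exhaustion: "D = (\<Union>n. ring_stage T n)"
    and nonunits_bounded: "nonunits D \<subseteq> ring_stage T n0"
    and unit_or_inverse_bounded: "x \<in> val_units D \<Longrightarrow> x \<in> ring_stage T n0 \<or> inverse x \<in> ring_stage T n0"
    and unbounded: "ring_stage T n \<noteq> D"
begin

lemma B_subset: "ring_stage T n \<subseteq> D"
  using exhaustion by blast

theorem quasi_absolute_value_exists:
  obtains N C where "quasi_absolute_value D N C"
    "\<And>n. \<exists>b. \<forall>x\<in>ring_stage T n. N x \<le> b" "\<exists>x\<in>D. N x > 1"
proof -
  \<comment> \<open>The margin \<open>2\<close> is what division by \<open>c\<close> needs: if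
    \<open>x\<close> is in stage \<open>Suc n0\<close> and \<open>x / c\<close> were outside stage
    \<open>n0\<close>, then \<open>c / x\<close> would be inside, and \<open>x * (c / x)\<close>
    would bring \<open>c\<close> into stage \<open>n0 + 2\<close>.\<close>
  obtain c where c: "c \<in> D" "c \<notin> ring_stage T (n0 + 2)"
    using unbounded[of "n0 + 2"] B_subset[of "n0 + 2"] by blast
  have cu: "c \<in> val_units D"
    using c nonunits_bounded ring_stage_mono[of n0 "n0 + 2" T] by (auto simp: unit_iff)
  have c0: "c \<noteq> 0"
    using cu by (rule unit_nonzero)
  have step: "x / c \<in> ring_stage T n0" if "x \<in> ring_stage T (Suc n0)" for x
  proof (cases "x \<in> nonunits D")
    case True
    then show ?thesis
      using nonunit_divide[OF _ cu] nonunits_bounded by blast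
  next
    case False
    then have xu: "x \<in> val_units D"
      using that B_subset by (auto simp: unit_iff)
    show ?thesis
    proof (rule ccontr)
      assume "x / c \<notin> ring_stage T n0"
      then have "c / x \<in> ring_stage T (Suc n0)"
        using unit_or_inverse_bounded[OF divide_unit[OF xu cu]] ring_stage_mono[of n0 "Suc n0" T]
        by (auto simp: inverse_eq_divide)
      then have "x * (c / x) \<in> ring_stage T (Suc (Suc n0))"
        using that by (intro ring_stage_mult)
      then show False
        using c(2) unit_nonzero[OF xu] by simp
    qed
  qed
  have cpow: "c ^ Suc j \<notin> ring_stage T n0" for j
  proof (induction j)
    case 0
    then show ?case
      using c(2) ring_stage_mono[of n0 "n0 + 2" T] by auto
  next
    case (Suc j)
    show ?case
    proof
      assume *: "c ^ Suc (Suc j) \<in> ring_stage T n0"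
      have "inverse (c ^ Suc j) \<in> ring_stage T n0"
        using unit_or_inverse_bounded[OF power_unit[OF cu]] Suc by blast
      then have "c ^ Suc (Suc j) * inverse (c ^ Suc j) \<in> ring_stage T (Suc n0)"
        using * by (intro ring_stage_mult)
      also have "c ^ Suc (Suc j) * inverse (c ^ Suc j) = c"
        using c0 by (simp add: field_simps)
      finally show False
        using c(2) ring_stage_mono[of "Suc n0" "n0 + 2" T] by auto
    qed
  qed
  have cinv: "inverse (c ^ j) \<in> ring_stage T n0" for j
    using unit_or_inverse_bounded[OF power_unit[OF cu], of j] cpow[of "j - 1"] ring_stage_01
    by (cases j) auto
  \<comment> \<open>\<open>F j\<close> plays the role of \<open>c ^ j B\<close>; the union over
    \<open>i\<close> makes it increase with \<open>j\<close>. Passing back from \<open>F j\<close>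
    to \<open>B\<close> costs one factor \<open>1 / c\<close>.\<close>
  define F where "F = (\<lambda>j::int. {x. \<exists>i::nat. x * c powi (int i - j) \<in> ring_stage T n0})"
  have F_mono: "F i \<subseteq> F j" if "i \<le> j" for i j
  proof
    fix x
    assume "x \<in> F i"
    then obtain k :: nat where "x * c powi (int k - i) \<in> ring_stage T n0"
      by (auto simp: F_def)
    then show "x \<in> F j"
      using that by (auto simp: F_def intro!: exI[of _ "nat (int k + j - i)"])
  qed
  have F_B: "x * c powi (- 1 - j) \<in> ring_stage T n0" if xj: "x \<in> F j" for x j
  proof -
    obtain i :: nat where i: "x * c powi (int i - j) \<in> ring_stage T n0"
      using xj by (auto simp: F_def)
    have "x * c powi (int i - j) * inverse (c ^ i) / c \<in> ring_stage T n0"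
      by (intro step ring_stage_mult i cinv)
    also have "x * c powi (int i - j) * inverse (c ^ i) / c = x * c powi (- 1 - j)"
      using c0 by (simp add: power_int_diff power_int_minus field_simps)
    finally show ?thesis .
  qed
  have B_F: "x \<in> F j" if "x * c powi (- j) \<in> ring_stage T n0" for x j
    using that by (auto simp: F_def intro!: exI[of _ 0])
  \<comment> \<open>Of the shift \<open>3\<close>, each factor contributes \<open>1\<close> through
    \<open>F_B\<close>, and the return from the next stage to \<open>n0\<close> contributes
    \<open>1\<close>.\<close>
  have F_mult: "x * y \<in> F (i + j + 3)" if "x \<in> F i" "y \<in> F j" for x y i j
  proof (rule B_F)
    have "x * c powi (- 1 - i) * (y * c powi (- 1 - j)) / c \<in> ring_stage T n0"
      by (intro step ring_stage_mult F_B that)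
    also have "x * c powi (- 1 - i) * (y * c powi (- 1 - j)) / c = x * y * c powi (- (i + j + 3))"
      using c0 by (simp add: power_int_diff power_int_add power_int_minus field_simps numeral_3_eq_3)
    finally show "x * y * c powi (- (i + j + 3)) \<in> ring_stage T n0" .
  qed
  have F_add: "x + y \<in> F (j + 2)" if "x \<in> F j" "y \<in> F j" for x y j
  proof (rule B_F)
    have "(x * c powi (- 1 - j) + y * c powi (- 1 - j)) / c \<in> ring_stage T n0"
      by (intro step ring_stage_add F_B that)
    also have "(x * c powi (- 1 - j) + y * c powi (- 1 - j)) / c = (x + y) * c powi (- (j + 2))"
      using c0 by (simp add: power_int_diff power_int_add power_int_minus field_simps numeral_2_eq_2)
    finally show "(x + y) * c powi (- (j + 2)) \<in> ring_stage T n0" .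
  qed
  have c_powi: "c powi j \<in> val_units D" for j
    using power_unit[OF cu] power_unit[OF inverse_unit[OF cu]] by (simp add: power_int_def)
  have nonunits_F: "x \<in> F j" if "x \<in> nonunits D" for x j
    using nonunit_mult[OF that unit_mem[OF c_powi]] nonunits_bounded by (intro B_F) auto
  have B_le_F: "\<exists>j\<ge>0. ring_stage T n \<subseteq> F j" for n
  proof (induction n)
    case 0
    have "ring_stage T 0 \<subseteq> F 0"
      using ring_stage_mono[of 0 n0 T] by (auto intro!: B_F)
    then show ?case
      by blast
  next
    case (Suc n)
    then obtain j where j: "j \<ge> 0" "ring_stage T n \<subseteq> F j"
      by blast
    have "ring_stage T (Suc n) \<subseteq> F (j + j + 3 + 2)"
    proof
      fix w
      assume "w \<in> ring_stage T (Suc n)"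
      then obtain x y z where w: "w = x * y + z" "x \<in> ring_stage T n" "y \<in> ring_stage T n" "z \<in> ring_stage T n"
        unfolding ring_stage.simps(2) by blast
      show "w \<in> F (j + j + 3 + 2)"
        unfolding w(1) using w(2-) j F_mono[of j "j + j + 3"] by (intro F_add F_mult) auto
    qed
    then show ?case
      using j(1) by (intro exI[of _ "j + j + 3 + 2"]) auto
  qed
  have F_c: "j \<ge> i - 1" if "c powi i \<in> F j" for i j
  proof (rule ccontr)
    assume "\<not> j \<ge> i - 1"
    then have eq: "i + (- 1 - j) = int (Suc (nat (i - 2 - j)))"
      by simp
    have "c powi i * c powi (- 1 - j) \<in> ring_stage T n0"
      by (intro F_B that)
    then have "c powi (i + (- 1 - j)) \<in> ring_stage T n0"
      using c0 by (simp only: power_int_add simp_thms)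
    then have "c ^ Suc (nat (i - 2 - j)) \<in> ring_stage T n0"
      unfolding eq power_int_of_nat .
    then show False
      using cpow by blast
  qed
  have "\<exists>j. x \<in> F j \<and> x \<notin> F (j - 1)" if x: "x \<in> val_units D" for x
  proof -
    have ex: "\<exists>j. y \<in> F j" if "y \<in> val_units D" for y
      using B_le_F exhaustion unit_mem[OF that] by blast
    obtain i where i: "inverse x \<in> F i"
      using ex[OF inverse_unit[OF x]] by blast
    obtain l where l: "x \<in> F l"
      using ex[OF x] by blast
    \<comment> \<open>If \<open>x\<close> were in \<open>F m\<close>, then
      \<open>1 = x * inverse x\<close> would lie in \<open>F (- 2)\<close>, which \<open>F_c\<close>
      forbids.\<close>
    define m where "m = - i - 5"
    have m: "x \<notin> F m"
    proof
      assume "x \<in> F m"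
      then have "x * inverse x \<in> F (m + i + 3)"
        using i by (rule F_mult)
      then have "c powi 0 \<in> F (m + i + 3)"
        using unit_nonzero[OF x] by simp
      then show False
        using F_c[of 0 "m + i + 3"] by (simp add: m_def)
    qed
    define n where "n = (LEAST n::nat. x \<in> F (m + int n))"
    have "l > m"
      using l m F_mono[of l m] by force
    then have "x \<in> F (m + int (nat (l - m)))"
      using l by simp
    then have n: "x \<in> F (m + int n)"
      unfolding n_def by (rule LeastI)
    then have "n > 0"
      using m by (cases n) auto
    then have "x \<notin> F (m + int (n - 1))"
      unfolding n_def by (intro not_less_Least) auto
    moreover have "m + int (n - 1) = m + int n - 1"
      using \<open>n > 0\<close> by simp
    ultimately show ?thesis
      using n by metis
  qed
  then obtain k where k: "\<And>x. x \<in> val_units D \<Longrightarrow> x \<in> F (k x)" "\<And>x. x \<in> val_units D \<Longrightarrow> x \<notin> F (k x - 1)"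
    by metis
  have k_le: "k x \<le> j" if "x \<in> val_units D" "x \<in> F j" for x j
    using k(2)[OF that(1)] that(2) F_mono[of j "k x - 1"] by force
  have k_inv: "k (inverse x) \<le> 1 - k x" if x: "x \<in> val_units D" for x
  proof (rule k_le[OF inverse_unit[OF x]], rule B_F)
    have "x * c powi (- (k x - 1)) \<notin> ring_stage T n0"
      using k(2)[OF x] B_F by blast
    then have "inverse (x * c powi (- (k x - 1))) \<in> ring_stage T n0"
      using unit_or_inverse_bounded[OF mult_unit[OF x c_powi]] by blast
    then show "inverse x * c powi (- (1 - k x)) \<in> ring_stage T n0"
      by (simp add: power_int_minus[symmetric])
  qed
  have k_mult: "k (x * y) \<le> k x + k y + 3" if "x \<in> val_units D" "y \<in> val_units D" for x y
    by (intro k_le mult_unit F_mult k(1) that)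
  \<comment> \<open>The constant is \<open>3 + 1\<close>: the lower bound comes from
    \<open>x = (x y) (1 / y)\<close>, which costs \<open>3\<close> by \<open>k_mult\<close> and
    \<open>1\<close> by \<open>k_inv\<close>.\<close>
  have "\<bar>real_of_int (k (x * y)) - k x - k y\<bar> \<le> 4" if "x \<in> val_units D" "y \<in> val_units D" for x y
    using k_mult[OF that] k_mult[OF mult_unit[OF that] inverse_unit[OF that(2)]] k_inv[OF that(2)]
      unit_nonzero[OF that(2)] by (simp add: mult.assoc)
  then obtain \<phi> where \<phi>: "\<And>x y. \<lbrakk>x \<in> val_units D; y \<in> val_units D\<rbrakk> \<Longrightarrow> \<phi> (x * y) = \<phi> x + \<phi> y"
    "\<And>x. x \<in> val_units D \<Longrightarrow> \<bar>\<phi> x - real_of_int (k x)\<bar> \<le> 4"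
    using quasimorphism_limit[of "val_units D" "\<lambda>x. real_of_int (k x)" 4] mult_unit by blast
  define N where "N x = (if x \<in> val_units D then exp (\<phi> x) else 0)" for x
  have N_F: "x \<in> F \<lfloor>ln r + 4\<rfloor>" if "x \<in> D" "N x \<le> r" "r > 0" for x r
  proof (cases "x \<in> val_units D")
    case True
    then have "\<phi> x \<le> ln r"
      using that by (simp add: N_def ln_ge_iff)
    then have "k x \<le> \<lfloor>ln r + 4\<rfloor>"
      using \<phi>(2)[OF True] by linarith
    then show ?thesis
      using k(1)[OF True] F_mono by blast
  qed (use nonunits_F that in \<open>auto simp: unit_iff\<close>)
  have F_N: "N x \<le> exp (j + 4)" if "x \<in> F j" for x j
    using k_le[OF _ that] \<phi>(2)[of x] by (auto simp: N_def)
  \<comment> \<open>In the exponent \<open>10\<close>, passing from \<open>\<phi>\<close> to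
    \<open>k\<close> contributes \<open>4\<close>, \<open>F_add\<close> contributes
    \<open>2\<close>, and passing back contributes \<open>4\<close>.\<close>
  have "quasi_absolute_value D N (exp 10)"
  proof
    show "N x \<ge> 0" for x
      by (simp add: N_def)
    show "N x = 0 \<longleftrightarrow> x \<in> nonunits D" if "x \<in> D" for x
      using that by (auto simp: N_def unit_iff)
    show "N (x * y) = N x * N y" if "x \<in> D" "y \<in> D" for x y
      using that \<phi>(1)[of x y] unit_of_mult[of x y] unit_of_mult[of y x]
      by (auto simp: N_def exp_add mult_unit mult.commute)
    show "N (x + y) \<le> exp 10 * max (N x) (N y)" if xy: "x \<in> D" "y \<in> D" for x y
    proof (cases "max (N x) (N y) > 0")
      case True
      let ?r = "max (N x) (N y)"
      have "x + y \<in> F (\<lfloor>ln ?r + 4\<rfloor> + 2)"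
        using xy True by (intro F_add N_F) auto
      then have "N (x + y) \<le> exp (\<lfloor>ln ?r + 4\<rfloor> + 2 + 4)"
        using F_N by force
      also have "\<dots> \<le> exp (10 + ln ?r)"
        unfolding exp_le_cancel_iff by linarith
      also have "\<dots> = exp 10 * ?r"
        using True by (simp add: exp_add)
      finally show ?thesis .
    next
      case False
      then have "x \<in> nonunits D" "y \<in> nonunits D"
        using xy by (auto simp: N_def unit_iff less_max_iff_disj split: if_splits)
      then have "x + y \<in> nonunits D"
        by (rule nonunit_add)
      then show ?thesis
        by (auto simp: N_def unit_iff le_max_iff_disj zero_le_mult_iff)
    qed
  qed simp
  moreover have "\<exists>b. \<forall>x\<in>ring_stage T n. N x \<le> b" for n
  proof -
    obtain j where "ring_stage T n \<subseteq> F j"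
      using B_le_F by blast
    then show ?thesis
      using F_N by blast
  qed
  moreover have "\<exists>x\<in>D. N x > 1"
  proof
    \<comment> \<open>\<open>F_c\<close> loses \<open>1\<close> and the homogenization at most
      \<open>4\<close>, so the power \<open>6\<close> leaves at least \<open>1\<close>.\<close>
    have "c powi 6 \<in> F (k (c powi 6))"
      by (intro k(1) c_powi)
    then have "k (c powi 6) \<ge> 5"
      using F_c[of 6 "k (c powi 6)"] by simp
    then have "\<phi> (c powi 6) > 0"
      using \<phi>(2)[OF c_powi, of 6] by linarith
    then show "N (c powi 6) > 1"
      using c_powi[of 6] by (simp add: N_def)
  qed (intro unit_mem c_powi)
  ultimately show ?thesis
    by (rule that)
qed

end

section \<open>Valuation rings whose units lie in a definable subgroup\<close>

locale unit_subgroup =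
  fixes G :: "'a::field set"
  assumes G_1: "1 \<in> G"
    and G_mult: "\<lbrakk>x \<in> G; y \<in> G\<rbrakk> \<Longrightarrow> x * y \<in> G"
    and G_inverse: "x \<in> G \<Longrightarrow> inverse x \<in> G"
    and G_0: "0 \<notin> G"
begin

lemma G_divide: "\<lbrakk>x \<in> G; y \<in> G\<rbrakk> \<Longrightarrow> x / y \<in> G"
  by (simp add: divide_inverse G_inverse G_mult)

lemma G_nonzero: "x \<in> G \<Longrightarrow> x \<noteq> 0"
  using G_0 by blast

lemma G_inverse_iff: "inverse x \<in> G \<longleftrightarrow> x \<in> G"
  using G_inverse[of x] G_inverse[of "inverse x"] by auto

end

text \<open>The largest coarsening of \<open>V\<close> all of whose units lie in \<open>G\<close>.\<close>

definition coarsening_in :: "'a::field set \<Rightarrow> 'a set \<Rightarrow> 'a set" where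
  "coarsening_in G V = {x. \<forall>z\<in>V. x * z \<noteq> 0 \<and> inverse (x * z) \<in> V \<longrightarrow> x * z \<in> G}"

locale units_in_subgroup = valring V + unit_subgroup G for V G :: "'a::field set" +
  assumes units_subset: "val_units V \<subseteq> G"
begin

lemma subset_coarsening: "V \<subseteq> coarsening_in G V"
proof
  fix x
  assume "x \<in> V"
  then have "x * z \<in> G" if "z \<in> V" "x * z \<noteq> 0" "inverse (x * z) \<in> V" for z
    using that units_subset mult_mem[of x z] by (auto simp: val_units_def)
  then show "x \<in> coarsening_in G V"
    by (simp add: coarsening_in_def)
qed

text \<open>In terms of values, \<open>x\<close> belongs to the coarsening iff every element whose
  value lies between that of \<open>x\<close> and zero is in \<open>G\<close>. For an element
  \<open>x y z\<close> of value at most zero, either one membership applies to it as a whole, or it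
  splits into \<open>x\<close> and \<open>y z\<close>, both of negative value and thus both in
  \<open>G\<close>.\<close>

lemma coarsening_in_mult:
  assumes "x \<in> coarsening_in G V" "y \<in> coarsening_in G V"
  shows "x * y \<in> coarsening_in G V"
  unfolding coarsening_in_def
proof (intro CollectI ballI impI)
  fix z
  assume z: "z \<in> V" "x * y * z \<noteq> 0 \<and> inverse (x * y * z) \<in> V"
  then have nz: "x \<noteq> 0" "y \<noteq> 0" "z \<noteq> 0"
    by auto
  show "x * y * z \<in> G"
  proof (cases "y * z \<in> V")
    case True
    then show ?thesis
      using assms(1) z by (auto simp: coarsening_in_def mult.assoc)
  next
    case False
    then have yz: "inverse (y * z) \<in> V"
      using mem_or_inverse by blast
    then have "y * z \<in> G"
      using assms(2) z(1) nz by (auto simp: coarsening_in_def)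
    moreover have "x \<in> G \<or> x * y * z \<in> G"
    proof (cases "x \<in> V")
      case True
      then have "y * (x * z) \<in> G"
        using assms(2) z mult_mem[OF True z(1)] unfolding coarsening_in_def by (auto simp: mult_ac)
      then show ?thesis
        by (simp add: mult_ac)
    next
      case False
      then have "inverse x \<in> V"
        using mem_or_inverse by blast
      then show ?thesis
        using assms(1) nz one_mem by (auto simp: coarsening_in_def dest!: bspec[of _ _ 1])
    qed
    ultimately show ?thesis
      by (auto simp: mult.assoc intro: G_mult)
  qed
qed

lemma coarsening_in_smult: "\<lbrakk>x \<in> coarsening_in G V; z \<in> V\<rbrakk> \<Longrightarrow> x * z \<in> coarsening_in G V"
  using coarsening_in_mult subset_coarsening by blast

lemma valring_coarsening_in: "valring (coarsening_in G V)"
proof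
  show "1 \<in> coarsening_in G V"
    using subset_coarsening one_mem by blast
  show "x \<in> coarsening_in G V \<or> inverse x \<in> coarsening_in G V" for x
    using subset_coarsening mem_or_inverse by blast
  fix x y
  assume xy: "x \<in> coarsening_in G V" "y \<in> coarsening_in G V"
  show "x * y \<in> coarsening_in G V"
    by (rule coarsening_in_mult[OF xy])
  show "x + y \<in> coarsening_in G V"
    by (rule submodule_add[OF coarsening_in_smult xy])
qed

lemma units_coarsening_in: "val_units (coarsening_in G V) \<subseteq> G"
proof
  fix x
  assume x: "x \<in> val_units (coarsening_in G V)"
  have *: "y \<in> G" if "y \<in> coarsening_in G V" "y \<noteq> 0" "inverse y \<in> V" for y
    using that one_mem by (auto simp: coarsening_in_def dest!: bspec[of _ _ 1])
  show "x \<in> G"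
    using *[of x] *[of "inverse x"] x mem_or_inverse[of x] by (auto simp: val_units_def G_inverse_iff)
qed

lemma coarsening_in_proper:
  assumes "x \<noteq> 0" "x \<notin> G"
  shows "coarsening_in G V \<noteq> UNIV"
proof -
  have "y \<notin> coarsening_in G V" if "y \<noteq> 0" "y \<notin> G" "inverse y \<in> V" for y
    using that one_mem by (auto simp: coarsening_in_def intro!: bexI[of _ 1])
  from this[of x] this[of "inverse x"] show ?thesis
    using assms mem_or_inverse[of x] by (auto simp: G_inverse_iff)
qed

text \<open>A nonzero element of the maximal ideal outside \<open>G\<close> is in \<open>S\<close>,
  as \<open>1 + x\<close> is a unit. Conversely, if \<open>x\<close> in \<open>S\<close> were not in
  the maximal ideal, \<open>1 / x\<close> would be, since \<open>x\<close> is no unit, and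
  \<open>(1 + x) / (1 + 1 / x) = x\<close> would be in \<open>G\<close>. Nonunits inside
  \<open>G\<close> factor into two elements of \<open>S\<close> because the coarsening is the
  largest possible.\<close>

lemma nonunits_coarsening_in:
  defines "S \<equiv> {x. x \<noteq> 0 \<and> x \<notin> G \<and> 1 + x \<in> G}"
  shows "nonunits (coarsening_in G V) = insert 0 S \<union> {x * y | x y. x \<in> S \<and> y \<in> S}"
proof -
  interpret W: valring "coarsening_in G V"
    by (rule valring_coarsening_in)
  have S: "x \<in> S" if "x \<in> nonunits (coarsening_in G V)" "x \<noteq> 0" "x \<notin> G" for x
    using that W.one_plus_unit[OF that(1)] units_coarsening_in by (auto simp: S_def)
  have S_sub: "x \<in> nonunits (coarsening_in G V)" if "x \<in> S" for x
  proof (rule ccontr)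
    assume "x \<notin> nonunits (coarsening_in G V)"
    then have *: "x \<noteq> 0" "inverse x \<in> coarsening_in G V" "x \<notin> G" "1 + x \<in> G"
      using that by (auto simp: nonunits_def S_def)
    have "inverse x \<notin> val_units (coarsening_in G V)"
      using * units_coarsening_in by (auto simp: G_inverse_iff)
    then have "1 + inverse x \<in> G"
      using * units_coarsening_in W.one_plus_unit by (auto simp: W.unit_iff)
    then have "(1 + x) / (1 + inverse x) \<in> G"
      by (intro G_divide *)
    moreover have "(1 + x) / (1 + inverse x) = x"
      using \<open>x \<noteq> 0\<close> \<open>1 + inverse x \<in> G\<close> G_0 by (auto simp: divide_simps)
    ultimately show False
      using \<open>x \<notin> G\<close> by simp
  qed
  have "\<exists>y z. x = y * z \<and> y \<in> S \<and> z \<in> S" if x: "x \<in> nonunits (coarsening_in G V)" "x \<noteq> 0" "x \<in> G" for x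
  proof -
    have "inverse x \<notin> coarsening_in G V"
      using x by (simp add: nonunits_def)
    then obtain z where z: "z \<in> V" "z \<noteq> 0" "x / z \<in> V" "z / x \<notin> G"
      using x(2) by (auto simp: coarsening_in_def field_simps)
    have "z \<notin> G"
      using z(4) x(3) G_divide by blast
    moreover have "x / z \<notin> G"
      using z(4) G_inverse_iff[of "x / z"] by (simp add: inverse_eq_divide)
    ultimately have "z \<in> nonunits (coarsening_in G V)" "x / z \<in> nonunits (coarsening_in G V)"
      using z(1,3) subset_coarsening units_coarsening_in by (auto simp: W.unit_iff subset_iff)
    then have "z \<in> S" "x / z \<in> S"
      using S \<open>z \<notin> G\<close> \<open>x / z \<notin> G\<close> z(2) x(2) by auto
    then show ?thesis
      using z(2) by (intro exI[of _ z] exI[of _ "x / z"]) auto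
  qed
  then show ?thesis
    using S S_sub W.nonunit_mult W.nonunit_mem by auto
qed

theorem definable_if_units_in_subgroup:
  assumes "definable_set G" "x \<noteq> 0" "x \<notin> G"
  shows "admits_nontrivial_empty_definable_valuation TYPE('a)"
proof -
  interpret W: valring "coarsening_in G V"
    by (rule valring_coarsening_in)
  let ?S = "{x. x \<noteq> 0 \<and> x \<notin> G \<and> 1 + x \<in> G}" and ?M = "nonunits (coarsening_in G V)"
  have S: "definable_set ?S"
    by (intro definable_set_unary definable_intros assms(1))
  have "definable_set {x. \<exists>y z. x = y * z \<and> y \<in> ?S \<and> z \<in> ?S}"
    by (rule definable_set_Ex2) (intro definable_intros S)
  then have "definable_set ?M"
    unfolding nonunits_coarsening_in
    by (intro definable_set_Un definable_set_insert_0 S)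
  then have "definable_set {x. \<exists>y. x * y = 1 \<and> y \<in> ?M}"
    by (intro definable_set_Ex definable_intros)
  then have "definable_set (- {x. \<exists>y. x * y = 1 \<and> y \<in> ?M})"
    by (rule definable_set_Compl)
  also have "- {x. \<exists>y. x * y = 1 \<and> y \<in> ?M} = coarsening_in G V"
  proof (rule Set.set_eqI)
    fix x
    have "(\<exists>y. x * y = 1 \<and> y \<in> ?M) \<longleftrightarrow> x \<notin> coarsening_in G V"
      using W.not_mem_iff[of x] inverse_unique[of x] by (auto intro!: exI[of _ "inverse x"])
    then show "x \<in> - {x. \<exists>y. x * y = 1 \<and> y \<in> ?M} \<longleftrightarrow> x \<in> coarsening_in G V"
      by blast
  qed
  finally show ?thesis
    using coarsening_in_proper[OF assms(2,3)] by (intro W.admits_definable_valuation)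
qed

end

section \<open>The archimedean case\<close>

locale archimedean = quasi_absolute_value D N C + unit_subgroup G
  for D N C and G :: "'a::field set" +
  fixes s \<epsilon> :: real
  assumes s_pos: "s > 0" and N_nat_pos: "m > 0 \<Longrightarrow> N (of_nat m) = real m powr s"
    and \<epsilon>_pos: "\<epsilon> > 0" and near_1: "\<lbrakk>w \<in> D; N (w - 1) < \<epsilon>\<rbrakk> \<Longrightarrow> w \<in> G"
begin

lemma N_nat: "N (of_nat m) = real m powr s"
  using N_nat_pos[of m] N_0 by (cases "m = 0") auto

lemma of_nat_unit: "m > 0 \<Longrightarrow> of_nat m \<in> val_units D"
  using N_zero_iff[OF of_nat_mem, of m] by (simp add: unit_iff of_nat_mem N_nat)

lemma fraction_mem: "n > 0 \<Longrightarrow> of_nat m / of_nat n \<in> D"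
  by (intro divide_mem of_nat_mem of_nat_unit)

lemma N_fraction: "n > 0 \<Longrightarrow> N (of_nat m / of_nat n) = (real m / real n) powr s"
  by (simp add: N_divide of_nat_mem of_nat_unit N_nat powr_divide)

lemma exists_small:
  assumes "b > 0"
  obtains J :: nat where "J > 0" "\<And>j. j \<ge> J \<Longrightarrow> a * (1 / real j) powr s < b"
proof -
  have "(\<lambda>j. a * (1 / real j) powr s) \<longlonglongrightarrow> a * 0"
    using s_pos by (intro tendsto_intros) real_asymp
  then have "\<forall>\<^sub>F j in sequentially. a * (1 / real j) powr s < b"
    using assms by (intro order_tendstoD(2)) auto
  then obtain J where "\<And>j. j \<ge> J \<Longrightarrow> a * (1 / real j) powr s < b"
    unfolding eventually_sequentially by blast
  then show ?thesis
    using that[of "Suc J"] by simp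
qed

text \<open>The quotients \<open>(j + 1) / j\<close> tend to \<open>1\<close>, so they lie in
  \<open>G\<close> from some \<open>J\<close> on, and by telescoping so does \<open>k / J\<close>
  for \<open>k \<ge> J\<close>. The instances \<open>J J / J\<close> and \<open>m J / J\<close> give
  \<open>J\<close> and \<open>m\<close>.\<close>

lemma of_nat_in_G:
  assumes "m > 0"
  shows "of_nat m \<in> G"
proof -
  obtain J where J: "J > 0" "\<And>j. j \<ge> J \<Longrightarrow> 1 * (1 / real j) powr s < \<epsilon>"
    using exists_small[OF \<epsilon>_pos, of 1] by blast
  have nz: "of_nat k \<noteq> (0::'a)" if "k > 0" for k
    using unit_nonzero[OF of_nat_unit[OF that]] .
  have ratio: "of_nat (J + k) / of_nat J \<in> G" for k
  proof (induction k)
    case 0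
    then show ?case
      using nz[OF J(1)] G_1 by simp
  next
    case (Suc k)
    let ?w = "of_nat (Suc (J + k)) / of_nat (J + k) :: 'a"
    have "?w - 1 = of_nat 1 / of_nat (J + k)"
      using nz[of "J + k"] J(1) by (simp add: field_simps)
    then have "N (?w - 1) < \<epsilon>"
      using N_fraction[of "J + k" 1] J(1) J(2)[of "J + k"] by simp
    then have "?w \<in> G"
      using J(1) by (intro near_1 fraction_mem) auto
    then have "?w * (of_nat (J + k) / of_nat J) \<in> G"
      using Suc by (intro G_mult)
    then show ?case
      using nz[of "J + k"] J(1) by simp
  qed
  have ge: "of_nat k / of_nat J \<in> G" if "k \<ge> J" for k
    using ratio[of "k - J"] that by simp
  have "of_nat J \<in> G"
    using ge[of "J * J"] J(1) nz[OF J(1)] by simp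
  moreover have "of_nat m * of_nat J / of_nat J \<in> G"
    using ge[of "m * J"] assms by simp
  ultimately show ?thesis
    using nz[OF J(1)] by simp
qed

text \<open>Consecutive points of the path \<open>t \<mapsto> 1 + t y\<close> have a quotient close to \<open>1\<close>, unless the path
  comes close to \<open>0\<close>.\<close>

lemma path:
  assumes y: "y \<in> D" "1 + y \<notin> G" and "\<delta> > 0"
  obtains n i :: nat where "n > 0" "i \<le> n" "N (1 + of_nat i / of_nat n * y) < \<delta>"
proof -
  have "\<exists>n i. n > 0 \<and> i \<le> n \<and> N (1 + of_nat i / of_nat n * y) < \<delta>"
  proof (rule ccontr)
    assume no: "\<not> ?thesis"
    have far: "N (1 + of_nat i / of_nat n * y) \<ge> \<delta>" if "n > 0" "i \<le> n" for n i :: nat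
      using no that not_less by blast
    obtain n where n: "n > 0" "N y / \<delta> * (1 / real n) powr s < \<epsilon>"
      using exists_small[OF \<epsilon>_pos, of "N y / \<delta>"] by blast
    define p where "p i = 1 + of_nat i / of_nat n * y" for i
    have pD: "p i \<in> D" for i
      unfolding p_def using n(1) y(1) by (intro add_mem one_mem mult_mem fraction_mem)
    have N_p: "N (p i) \<ge> \<delta>" if "i \<le> n" for i
      using far[OF n(1) that] by (simp add: p_def)
    have pu: "p i \<in> val_units D" if "i \<le> n" for i
      using N_p[OF that] \<open>\<delta> > 0\<close> N_zero_iff[OF pD, of i] pD by (auto simp: unit_iff)
    have "i \<le> n \<Longrightarrow> p i \<in> G" for i
    proof (induction i)
      case 0
      then show ?case
        by (simp add: p_def G_1)
    next
      case (Suc i)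
      then have i: "i \<le> n" "p i \<in> G"
        by auto
      have "p (Suc i) = p i + of_nat 1 / of_nat n * y"
        by (simp add: p_def add_divide_distrib distrib_right)
      then have "p (Suc i) / p i - 1 = of_nat 1 / of_nat n * y / p i"
        using unit_nonzero[OF pu[OF i(1)]] by (simp add: add_divide_distrib)
      then have "N (p (Suc i) / p i - 1) = (1 / real n) powr s * N y / N (p i)"
        using N_fraction[OF n(1), of 1] n(1) y(1) fraction_mem[OF n(1), of 1]
        by (simp only: N_divide[OF mult_mem pu[OF i(1)]] N_mult) simp
      also have "\<dots> \<le> (1 / real n) powr s * N y / \<delta>"
        using N_p[OF i(1)] \<open>\<delta> > 0\<close> by (intro divide_left_mono mult_nonneg_nonneg N_nonneg) auto
      also have "\<dots> < \<epsilon>"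
        using n(2) by (simp add: mult.commute)
      finally have "p (Suc i) / p i \<in> G"
        by (intro near_1 divide_mem pD pu[OF i(1)])
      then have "p (Suc i) / p i * p i \<in> G"
        using i(2) by (intro G_mult)
      then show ?case
        using unit_nonzero[OF pu[OF i(1)]] by simp
    qed
    from this[of n] show False
      using y(2) unit_nonzero[OF of_nat_unit[OF n(1)]] by (simp add: p_def)
  qed
  then show ?thesis
    using that by blast
qed

text \<open>The path from \<open>1\<close> to \<open>x\<close> must pass near \<open>0\<close>, at a
  point where \<open>- i x\<close> and \<open>n - i\<close> almost agree. Their quotient is then
  near \<open>1\<close>, hence in \<open>G\<close>, and the integers \<open>i\<close> and
  \<open>n - i\<close> lie in \<open>G\<close> as well.\<close>

lemma neg_in_G:
  assumes x: "x \<in> val_units D" and "x \<notin> G"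
  shows "- x \<in> G"
proof -
  \<comment> \<open>\<open>K\<close> bounds \<open>N (i / n * x)\<close> from below when
    \<open>i / n\<close> is at least \<open>1 / 2\<close>. With \<open>\<eta>\<close> and
    \<open>\<delta>\<close> this small, the path cannot be near \<open>0\<close> while
    \<open>1 - i / n < \<eta>\<close>; the bound \<open>\<epsilon> * \<eta> powr s\<close> for
    \<open>\<delta>\<close> later brings \<open>w\<close> close enough to \<open>1\<close>.\<close>
  define K where "K = N x * (1 / 2) powr s"
  have K: "K > 0"
    using N_pos[OF x] by (simp add: K_def)
  define \<eta> where "\<eta> = min (1 / 2) ((K / (2 * C)) powr (1 / s))"
  have \<eta>: "0 < \<eta>" "\<eta> \<le> 1 / 2"
    using K C_ge_1 by (auto simp: \<eta>_def)
  have "\<eta> powr s \<le> ((K / (2 * C)) powr (1 / s)) powr s"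
    using \<eta> s_pos by (intro powr_mono2) (auto simp: \<eta>_def)
  also have "\<dots> = K / (2 * C)"
    using s_pos K C_ge_1 by (simp add: powr_powr)
  finally have \<eta>s: "C * \<eta> powr s < K"
    using K C_ge_1 by (simp add: field_simps)
  define \<delta> where "\<delta> = min (\<epsilon> * \<eta> powr s) (K / (2 * C))"
  have \<delta>: "\<delta> > 0" "\<delta> \<le> \<epsilon> * \<eta> powr s" "C * \<delta> < K"
  proof -
    show "\<delta> > 0" "\<delta> \<le> \<epsilon> * \<eta> powr s"
      using \<eta>(1) \<epsilon>_pos K C_ge_1 by (auto simp: \<delta>_def)
    have "C * \<delta> \<le> C * (K / (2 * C))"
      using C_ge_1 by (intro mult_left_mono) (auto simp: \<delta>_def)
    also have "\<dots> < K"
      using C_ge_1 K by simp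
    finally show "C * \<delta> < K" .
  qed
  have xD: "x \<in> D"
    using x by (rule unit_mem)
  obtain n i where ni: "n > 0" "i \<le> n" "N (1 + of_nat i / of_nat n * (x - 1)) < \<delta>"
    using path[of "x - 1" \<delta>] \<open>x \<notin> G\<close> xD \<delta>(1) diff_mem[OF xD one_mem] by auto
  define p where "p = 1 + of_nat i / of_nat n * (x - 1)"
  have pD: "p \<in> D"
    unfolding p_def using ni(1) xD by (intro add_mem one_mem mult_mem fraction_mem diff_mem)
  have n0: "of_nat n \<noteq> (0::'a)"
    using unit_nonzero[OF of_nat_unit[OF ni(1)]] .
  have p_eq: "p = of_nat (n - i) / of_nat n + of_nat i / of_nat n * x"
    using n0 ni(2) by (simp add: p_def of_nat_diff field_simps)
  have "real (n - i) / real n \<ge> \<eta>"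
  proof (rule ccontr)
    assume small: "\<not> ?thesis"
    have "real i / real n = 1 - real (n - i) / real n"
      using ni(1,2) by (simp add: of_nat_diff field_simps)
    then have "1 / 2 \<le> real i / real n"
      using small \<eta>(2) by linarith
    then have "K \<le> (real i / real n) powr s * N x"
      unfolding K_def using s_pos N_nonneg[of x]
      by (subst mult.commute) (intro mult_right_mono powr_mono2, auto)
    also have "\<dots> = N (of_nat i / of_nat n * x)"
      by (simp only: N_mult[OF fraction_mem[OF ni(1)] xD] N_fraction[OF ni(1)])
    also have "of_nat i / of_nat n * x = p - of_nat (n - i) / of_nat n"
      by (simp add: p_eq)
    also have "N \<dots> \<le> C * max (N p) ((real (n - i) / real n) powr s)"
      using N_diff[OF pD fraction_mem[OF ni(1)], of "n - i"] by (simp add: N_fraction ni(1))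
    also have "\<dots> \<le> C * max \<delta> (\<eta> powr s)"
      using small C_ge_1 ni(3) s_pos
      by (intro mult_left_mono max.mono powr_mono2) (auto simp: p_def)
    also have "\<dots> < K"
      using \<eta>s \<delta>(3) by (simp add: max_def)
    finally show False
      by simp
  qed
  then have "n - i > 0"
    using \<eta>(1) by (cases "n - i = 0") auto
  define w where "w = - (of_nat i * x / of_nat (n - i))"
  have m0: "of_nat (n - i) \<noteq> (0::'a)"
    using unit_nonzero[OF of_nat_unit[OF \<open>n - i > 0\<close>]] .
  have fu: "of_nat (n - i) / of_nat n \<in> val_units D"
    using \<open>n - i > 0\<close> ni(1) by (intro divide_unit of_nat_unit)
  have "w - 1 = - (p / (of_nat (n - i) / of_nat n))"
    using n0 m0 by (simp add: w_def p_eq field_simps)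
  then have "N (w - 1) = N (p / (of_nat (n - i) / of_nat n))"
    by (simp only: N_neg[OF divide_mem[OF pD fu]])
  also have "\<dots> = N p / (real (n - i) / real n) powr s"
    by (simp only: N_divide[OF pD fu] N_fraction[OF ni(1)])
  also have "\<dots> \<le> N p / \<eta> powr s"
  proof -
    have "N p / t powr s \<le> N p / \<eta> powr s" if "t \<ge> \<eta>" for t
      using that \<eta>(1) s_pos N_nonneg[of p]
      by (intro divide_left_mono powr_mono2 mult_pos_pos) auto
    then show ?thesis
      using \<open>real (n - i) / real n \<ge> \<eta>\<close> .
  qed
  also have "\<dots> < \<delta> / \<eta> powr s"
    using ni(3) \<eta>(1) by (simp add: p_def divide_strict_right_mono)
  also have "\<dots> \<le> \<epsilon>"
    using \<delta>(2) \<eta>(1) by (simp add: field_simps)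
  finally have "w \<in> G"
    unfolding w_def using \<open>n - i > 0\<close> xD
    by (intro near_1 neg_mem divide_mem mult_mem of_nat_mem of_nat_unit)
  then have "i > 0"
    using G_0 by (cases "i = 0") (auto simp: w_def)
  have "w * (of_nat (n - i) / of_nat i) \<in> G"
    using \<open>w \<in> G\<close> \<open>i > 0\<close> \<open>n - i > 0\<close> by (intro G_mult G_divide of_nat_in_G)
  also have "w * (of_nat (n - i) / of_nat i) = - x"
    using m0 unit_nonzero[OF of_nat_unit[OF \<open>i > 0\<close>]] by (simp add: w_def)
  finally show "- x \<in> G" .
qed

text \<open>If \<open>1 + x\<close> were outside \<open>G\<close>, the path from \<open>1\<close> to
  \<open>1 + x\<close> would pass near \<open>0\<close>. There \<open>- (i / n) x\<close> is near
  \<open>1\<close> and so in \<open>G\<close>, as are \<open>x\<close> and \<open>i / n\<close>,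
  which puts \<open>- 1\<close> into \<open>G\<close>.\<close>

lemma one_plus_in_G:
  assumes "- 1 \<notin> G" and x: "x \<in> D" "x \<in> G"
  shows "1 + x \<in> G"
proof (rule ccontr)
  assume "1 + x \<notin> G"
  then obtain n i where ni: "n > 0" "i \<le> n" "N (1 + of_nat i / of_nat n * x) < \<epsilon>"
    using path[OF x(1) _ \<epsilon>_pos] by blast
  define w where "w = - (of_nat i / of_nat n * x)"
  have wD: "w \<in> D"
    unfolding w_def using ni(1) x(1) by (intro neg_mem mult_mem fraction_mem)
  have "- a - 1 = - (1 + a)" for a :: 'a
    by simp
  then have "N (w - 1) = N (- (1 + of_nat i / of_nat n * x))"
    by (simp only: w_def)
  also have "\<dots> < \<epsilon>"
  proof -
    have "1 + of_nat i / of_nat n * x \<in> D"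
      using ni(1) x(1) by (intro add_mem one_mem mult_mem fraction_mem)
    then show ?thesis
      using ni(3) by (simp only: N_neg)
  qed
  finally have "w \<in> G"
    using wD by (intro near_1)
  then have "i > 0"
    using G_0 by (cases "i = 0") (auto simp: w_def)
  then have "of_nat i / of_nat n * x \<in> G"
    using ni(1) x(2) by (intro G_mult G_divide of_nat_in_G)
  then have "w / (of_nat i / of_nat n * x) \<in> G"
    using \<open>w \<in> G\<close> by (intro G_divide)
  moreover have "w / (of_nat i / of_nat n * x) = - 1"
    using \<open>of_nat i / of_nat n * x \<in> G\<close> G_0 by (auto simp: w_def)
  ultimately show False
    using assms(1) by simp
qed

end

section \<open>Images of the Artin--Schreier and Kummer maps\<close>

text \<open>Artin--Schreier and Kummer theory in one family: \<open>u = - 1\<close> and \<open>\<pi> = 0\<close> give \<open>x ^ q - x\<close> in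
  characteristic \<open>q\<close>, while \<open>\<pi> = \<zeta> - 1\<close> gives \<open>((1 + \<pi> x) ^ q - 1) / \<pi> ^ q\<close>.\<close>

definition power_poly :: "nat \<Rightarrow> 'a::field \<Rightarrow> 'a \<Rightarrow> 'a \<Rightarrow> 'a" where
  "power_poly q \<pi> u x = x ^ q + u * x * (\<Sum>k<q - 1. of_nat ((q choose Suc k) div q) * (\<pi> * x) ^ k)"

lemma power_poly_eq:
  fixes \<pi> u x :: "'a::field"
  assumes "prime q" "u * \<pi> ^ (q - 1) = of_nat q"
  shows "1 + \<pi> ^ q * power_poly q \<pi> u x = (1 + \<pi> * x) ^ q"
proof -
  obtain r where r: "q = Suc r"
    using assms(1) prime_gt_0_nat gr0_implies_Suc by blast
  have "u * \<pi> ^ (q - 1) * (\<pi> * x) = \<pi> ^ q * (u * x)"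
    by (simp add: r mult_ac)
  then have eq: "of_nat q * (\<pi> * x) = \<pi> ^ q * (u * x)"
    by (simp only: assms(2))
  show ?thesis
    unfolding binomial_prime[OF assms(1)] eq
    by (simp add: power_poly_def distrib_left power_mult_distrib mult_ac add_ac)
qed

text \<open>In the Kummer case \<open>u = q / (\<zeta> - 1) ^ (q - 1)\<close>. That \<open>u\<close>
  is a unit of all valuation rings at once lets one polynomial serve for every ring that
  occurs.\<close>

locale power_map =
  fixes q :: nat and \<pi> u :: "'a::field"
  assumes prime_q: "prime q"
    and u_\<pi>: "u * \<pi> ^ (q - 1) = of_nat q"
    and u_unit: "valring V \<Longrightarrow> u \<in> val_units V"
begin

definition c :: 'a where
  "c = \<pi> ^ q"

abbreviation P :: "'a \<Rightarrow> 'a" where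
  "P \<equiv> power_poly q \<pi> u"

definition H :: "'a set" where
  "H = {P x | x. 1 + c * P x \<noteq> 0}"

end

text \<open>The map \<open>y \<mapsto> 1 + c y\<close> turns \<open>y + z + c y z\<close> into multiplication; for \<open>c = 0\<close> it is addition.\<close>

locale power_group = power_map q \<pi> u for q and \<pi> u :: "'a::field" +
  fixes T :: "'a set"
  assumes H_op: "\<lbrakk>y \<in> H; z \<in> H\<rbrakk> \<Longrightarrow> y + z * (1 + c * y) \<in> H"
    and H_inverse: "y \<in> H \<Longrightarrow> - (y / (1 + c * y)) \<in> H"
    and H_proper: "\<exists>y. y \<notin> H \<and> 1 + c * y \<noteq> 0"
    and T_inverse: "y \<notin> H \<Longrightarrow> inverse y \<in> T"
    and T_cases: "t \<in> T \<Longrightarrow> \<exists>e y. y \<notin> H \<and> t = e * inverse y \<and> (\<forall>V. valring V \<longrightarrow> e \<in> V)"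
begin

lemma q_ge_2: "q \<ge> 2"
  using prime_ge_2_nat[OF prime_q] .

lemma q_pos: "q > 0"
  using q_ge_2 by linarith

lemma P_eq: "1 + c * P x = (1 + \<pi> * x) ^ q"
  unfolding c_def by (rule power_poly_eq[OF prime_q u_\<pi>])

lemma P_0: "P 0 = 0"
  using q_pos by (simp add: power_poly_def)

lemma H_0: "0 \<in> H"
  unfolding H_def by (auto intro!: exI[of _ 0] simp: P_0)

lemma H_nonzero: "y \<in> H \<Longrightarrow> 1 + c * y \<noteq> 0"
  unfolding H_def by auto

text \<open>Under \<open>y \<mapsto> 1 + c y\<close> the operation multiplies by
  \<open>1 + c m\<close>, a member of the subgroup, so membership in the subgroup does not
  change.\<close>

lemma H_op_iff:
  assumes "m \<in> H" "1 + c * y \<noteq> 0"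
  shows "y + m * (1 + c * y) \<in> H \<longleftrightarrow> y \<in> H"
proof
  assume "y + m * (1 + c * y) \<in> H"
  then have "- (m / (1 + c * m)) + (y + m * (1 + c * y)) * (1 + c * (- (m / (1 + c * m)))) \<in> H"
    by (rule H_op[OF H_inverse[OF assms(1)]])
  also have "- (m / (1 + c * m)) + (y + m * (1 + c * y)) * (1 + c * (- (m / (1 + c * m)))) = y"
  proof -
    have nz: "1 + c * m \<noteq> 0"
      by (rule H_nonzero[OF assms(1)])
    have "1 + c * (- (m / (1 + c * m))) = 1 / (1 + c * m)"
      using nz by (simp add: field_simps)
    moreover have "y + m * (1 + c * y) = m + y * (1 + c * m)"
      by (simp add: algebra_simps)
    ultimately have "- (m / (1 + c * m)) + (y + m * (1 + c * y)) * (1 + c * (- (m / (1 + c * m)))) =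
        - (m / (1 + c * m)) + (m + y * (1 + c * m)) / (1 + c * m)"
      by simp
    also have "\<dots> = y"
      using nz by (simp add: add_divide_distrib)
    finally show ?thesis .
  qed
  finally show "y \<in> H" .
qed (intro H_op assms(1))

lemma \<pi>_mem:
  assumes "valring V"
  shows "\<pi> \<in> V"
proof -
  interpret valring V by (rule assms)
  have "\<pi> ^ (q - 1) = of_nat q / u"
    using u_\<pi> unit_nonzero[OF u_unit[OF assms]] by (simp add: field_simps)
  then have "\<pi> ^ (q - 1) \<in> V"
    using divide_mem[OF of_nat_mem u_unit[OF assms]] by simp
  then show ?thesis
    using q_ge_2 by (simp add: power_mem_iff)
qed

lemma c_mem: "valring V \<Longrightarrow> c \<in> V"
  unfolding c_def by (intro valring.power_mem \<pi>_mem)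

lemma c_nonunit_iff: "valring V \<Longrightarrow> c \<in> nonunits V \<longleftrightarrow> \<pi> \<in> nonunits V"
  unfolding c_def by (intro valring.power_nonunit_iff q_pos)

lemma q_nonunit: 
  assumes "valring V" "c \<in> nonunits V"
  shows "of_nat q \<in> nonunits V"
proof -
  interpret valring V by (rule assms)
  have "u * \<pi> ^ (q - 1) \<in> nonunits V"
    using assms q_ge_2 unit_mem[OF u_unit[OF assms(1)]]
    by (intro nonunit_mult' power_nonunit) (simp_all add: c_nonunit_iff)
  then show ?thesis
    by (simp only: u_\<pi>)
qed

section \<open>Leading terms of \<open>P\<close> and Newton approximation\<close>

lemma P_remainder:
  assumes "valring V" "\<pi> * x \<in> V"
  shows "\<exists>a\<in>V. P x = x ^ q + x * a"
proof -
  interpret valring V by (rule assms)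
  have "u * (\<Sum>k<q - 1. of_nat ((q choose Suc k) div q) * (\<pi> * x) ^ k) \<in> V"
    by (intro mult_mem[OF unit_mem[OF u_unit[OF assms(1)]]] sum_mem mult_mem[OF of_nat_mem]
      power_mem assms(2))
  then show ?thesis
    by (rule rev_bexI) (simp add: power_poly_def mult_ac)
qed

text \<open>The sum in \<open>P\<close> starts with the coefficient \<open>1\<close>, so the linear
  coefficient is exactly \<open>u\<close>. This expansion governs small arguments,
  \<open>P_remainder\<close> the large ones.\<close>

lemma P_linear:
  assumes "valring V" "x \<in> V"
  shows "\<exists>a\<in>V. P x = u * x + x ^ 2 * a"
proof -
  interpret valring V by (rule assms)
  let ?e = "\<lambda>k. of_nat ((q choose Suc k) div q) :: 'a"
  obtain r where r: "q = r + 2"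
    using q_ge_2 le_Suc_ex by (metis add.commute)
  have "(\<Sum>k<q - 1. ?e k * (\<pi> * x) ^ k) = 1 + (\<Sum>k<r. ?e (Suc k) * (\<pi> * x) ^ Suc k)"
    using r by (simp add: sum.lessThan_Suc_shift del: sum.lessThan_Suc)
  also have "(\<Sum>k<r. ?e (Suc k) * (\<pi> * x) ^ Suc k) = \<pi> * x * (\<Sum>k<r. ?e (Suc k) * (\<pi> * x) ^ k)"
    by (simp add: sum_distrib_left mult_ac)
  finally have "P x = u * x + x ^ 2 * (x ^ r + u * \<pi> * (\<Sum>k<r. ?e (Suc k) * (\<pi> * x) ^ k))"
    unfolding power_poly_def by (simp add: r power_add power2_eq_square algebra_simps)
  moreover have "x ^ r + u * \<pi> * (\<Sum>k<r. ?e (Suc k) * (\<pi> * x) ^ k) \<in> V"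
    using assms \<pi>_mem unit_mem[OF u_unit[OF assms(1)]]
    by (intro add_mem mult_mem sum_mem power_mem of_nat_mem) auto
  ultimately show ?thesis
    by blast
qed

lemma one_plus_c_unit: "\<lbrakk>valring V; y \<in> nonunits V\<rbrakk> \<Longrightarrow> 1 + c * y \<in> val_units V"
  by (intro valring.one_plus_unit valring.nonunit_mult' c_mem)

text \<open>Newton's approximation of a preimage under \<open>P\<close>.\<close>

lemma contraction:
  assumes V: "valring V" and y: "y \<in> nonunits V"
  shows "\<exists>h\<in>H. \<exists>a\<in>V. y = h + y ^ 2 * a * (1 + c * h)"
proof -
  interpret valring V by (rule V)
  have uu: "u \<in> val_units V" and u0: "u \<noteq> 0"
    using u_unit[OF V] unit_nonzero by auto
  \<comment> \<open>\<open>y / u\<close> solves the linear part of \<open>P x = y\<close>; the error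
    is of second order in \<open>y\<close>.\<close>
  define x where "x = y / u"
  have x: "x \<in> nonunits V"
    unfolding x_def by (intro nonunit_divide y uu)
  obtain a where a: "a \<in> V" "P x = u * x + x ^ 2 * a"
    using P_linear[OF V nonunit_mem[OF x]] by blast
  have "P x \<in> nonunits V"
    unfolding a(2) power2_eq_square
    by (intro nonunit_add nonunit_mult'[OF unit_mem[OF uu] x]
      nonunit_mult[OF nonunit_mult[OF x nonunit_mem[OF x]] a(1)])
  then have h: "1 + c * P x \<in> val_units V"
    by (rule one_plus_c_unit[OF V])
  then have "P x \<in> H"
    using unit_nonzero by (auto simp: H_def)
  moreover have "- a / (u ^ 2 * (1 + c * P x)) \<in> V"
    using a(1) h uu by (intro divide_mem neg_mem mult_unit power_unit)
  moreover have "y = P x + y ^ 2 * (- a / (u ^ 2 * (1 + c * P x))) * (1 + c * P x)"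
  proof -
    have "y ^ 2 * (- a / (u ^ 2 * (1 + c * P x))) * (1 + c * P x) = - (x ^ 2 * a)"
      using unit_nonzero[OF h] u0 by (simp add: x_def power_divide)
    then show ?thesis
      using a(2) u0 by (simp add: x_def)
  qed
  ultimately show ?thesis
    by blast
qed

lemma contraction_step:
  assumes V: "valring V" and y: "y \<in> nonunits V"
  shows "\<exists>m\<in>nonunits V. (m \<in> H \<longrightarrow> y \<in> H) \<and> (\<exists>a\<in>V. m = y ^ 2 * a)"
proof -
  interpret valring V by (rule V)
  obtain h a where "h \<in> H" "a \<in> V" "y = h + y ^ 2 * a * (1 + c * h)"
    using contraction[OF V y] by blast
  moreover have "y ^ 2 * a \<in> nonunits V"
    unfolding power2_eq_square by (intro nonunit_mult[OF nonunit_mult[OF y nonunit_mem[OF y]] \<open>a \<in> V\<close>])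
  ultimately show ?thesis
    using H_op by metis
qed

lemma nonunits_in_H:
  assumes "T \<subseteq> V"
  shows "nonunits V \<subseteq> H"
  using assms T_inverse H_0 by (auto simp: nonunits_def)

text \<open>The factor \<open>e\<close> from \<open>T_cases\<close> comes from exchanging one root
  of unity for another; it lies in every valuation ring, so the pooled set \<open>T\<close> still
  fits into \<open>V\<close>.\<close>

lemma T_subset_if_nonunits:
  assumes V: "valring V" and "nonunits V \<subseteq> H"
  shows "T \<subseteq> V"
proof
  fix t
  assume "t \<in> T"
  then obtain e y where "y \<notin> H" "t = e * inverse y" "e \<in> V"
    using T_cases V by blast
  moreover have "inverse y \<in> V"
    using \<open>y \<notin> H\<close> assms(2) by (auto simp: nonunits_def)
  ultimately show "t \<in> V"
    using valring.mult_mem[OF V] by simp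
qed

section \<open>The ring generated by \<open>T\<close>\<close>

abbreviation B :: "nat \<Rightarrow> 'a set" where
  "B \<equiv> ring_stage T"

definition D :: "'a set" where
  "D = (\<Union>n. B n)"

lemma B_D: "B n \<subseteq> D"
  by (auto simp: D_def)

lemma common_B:
  assumes "x \<in> D" "y \<in> D"
  obtains n where "x \<in> B n" "y \<in> B n"
proof -
  obtain m n where "x \<in> B m" "y \<in> B n"
    using assms unfolding D_def by blast
  then have "x \<in> B (max m n)" "y \<in> B (max m n)"
    using ring_stage_mono[of m "max m n" T] ring_stage_mono[of n "max m n" T] by (auto simp del: ring_stage.simps)
  then show ?thesis
    by (rule that)
qed

lemma D_mult:
  assumes "x \<in> D" "y \<in> D"
  shows "x * y \<in> D"
proof -
  obtain n where "x \<in> B n" "y \<in> B n"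
    using common_B[OF assms] .
  then have "x * y \<in> B (Suc n)"
    by (rule ring_stage_mult)
  then show ?thesis
    using B_D by blast
qed

lemma D_add:
  assumes "x \<in> D" "y \<in> D"
  shows "x + y \<in> D"
proof -
  obtain n where "x \<in> B n" "y \<in> B n"
    using common_B[OF assms] .
  then have "x + y \<in> B (Suc n)"
    by (rule ring_stage_add)
  then show ?thesis
    using B_D by blast
qed

lemma T_D: "T \<subseteq> D"
  using subset_ring_stage B_D by blast

lemma D_one: "1 \<in> D" "- 1 \<in> D" "0 \<in> D"
  using ring_stage_01 neg_1_ring_stage B_D by blast+

lemma inverse_D: "y \<notin> H \<Longrightarrow> inverse y \<in> D"
  using T_inverse T_D by blast

lemma c_D: "c \<in> D"
proof (cases "c = 0")
  case False
  then have "- (1 / c) \<notin> H"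
    using H_nonzero[of "- (1 / c)"] by auto
  then have "- 1 * - c \<in> D"
    using D_mult[OF D_one(2) inverse_D[of "- (1 / c)"]] by simp
  then show ?thesis
    by simp
qed (simp add: D_one)

lemma B_subset_valring:
  assumes "valring V" "T \<subseteq> V"
  shows "B n \<subseteq> V"
proof -
  interpret valring V by (rule assms)
  show ?thesis
    using assms(2)
    by (induction n) (auto simp: ring_stage.simps(2) intro: add_mem mult_mem zero_mem one_mem neg_mem)
qed

lemma D_subset_valring: "\<lbrakk>valring V; T \<subseteq> V\<rbrakk> \<Longrightarrow> D \<subseteq> V"
  using B_subset_valring by (auto simp: D_def)

text \<open>\<open>D\<close> contains the inverses of the elements outside \<open>H\<close>. If the residue field of \<open>V\<close> were larger
  than that of \<open>D\<close>, adding an element outside the latter to \<open>y0\<close> would show \<open>y0 \<in> H\<close>.\<close>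

lemma valring_eq_D:
  assumes V: "valring V" and DV: "D \<subseteq> V"
    and res: "\<And>e. \<lbrakk>e \<in> D; e \<notin> nonunits V\<rbrakk> \<Longrightarrow> \<exists>e'\<in>D. 1 - e * e' \<in> nonunits V"
    and y0: "y0 \<in> V" "y0 \<notin> H" "1 + c * y0 \<in> val_units V"
  shows "D = V" "nonunits V \<subseteq> B 1"
proof -
  interpret valring V by (rule V)
  define K where "K = {d + m | d m. d \<in> D \<and> m \<in> nonunits V}"
  have MH: "nonunits V \<subseteq> H"
    using T_D DV by (intro nonunits_in_H) auto
  have KI: "x \<in> K" if "x - d \<in> nonunits V" "d \<in> D" for x d
    unfolding K_def using that by (intro CollectI exI[of _ d] exI[of _ "x - d"]) simp
  have DV': "d \<in> V" if "d \<in> D" for d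
    using DV that by blast
  \<comment> \<open>Here \<open>y\<close> is a unit of \<open>V\<close> and \<open>1 / y\<close>
    lies in \<open>D\<close>; the inverse of \<open>1 / y\<close> modulo nonunits that
    \<open>res\<close> supplies approximates \<open>y\<close>.\<close>
  have outside: "y \<in> K" if y: "y \<in> V" "y \<notin> H" for y
  proof -
    have "y \<notin> nonunits V"
      using y MH by blast
    then have "inverse y \<notin> nonunits V"
      using y(1) by (auto simp: nonunits_def)
    then obtain e where e: "e \<in> D" "1 - inverse y * e \<in> nonunits V"
      using res[OF inverse_D[OF y(2)]] by blast
    have "y \<noteq> 0"
      using y(2) H_0 by blast
    have "y * (1 - inverse y * e) \<in> nonunits V"
      by (intro nonunit_mult' y e)
    also have "y * (1 - inverse y * e) = y - e"
      using \<open>y \<noteq> 0\<close> by (simp add: right_diff_distrib)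
    finally show ?thesis
      using e(1) by (rule KI)
  qed
  let ?w = "1 + c * y0"
  have w0: "?w \<noteq> 0"
    using y0(3) by (rule unit_nonzero)
  have VK: "V \<subseteq> K"
  proof (rule subsetI, rule ccontr)
    fix f
    assume f: "f \<in> V" "f \<notin> K"
    have fH: "f \<in> H"
      using outside f by blast
    have "y0 + f * ?w \<notin> H"
      using H_op_iff[OF fH w0] y0(2) by blast
    then have "y0 + f * ?w \<in> K"
      by (intro outside add_mem mult_mem f(1) y0(1) one_mem c_mem V)
    then obtain d1 m1 where 1: "y0 + f * ?w = d1 + m1" "d1 \<in> D" "m1 \<in> nonunits V"
      by (auto simp: K_def)
    obtain d0 m0 where 0: "y0 = d0 + m0" "d0 \<in> D" "m0 \<in> nonunits V"
      using outside[OF y0(1,2)] by (auto simp: K_def)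
    let ?e = "1 + c * d0"
    have "?e = ?w - c * m0"
      by (simp add: 0(1) algebra_simps)
    also have "\<dots> \<in> val_units V"
      by (intro unit_diff_nonunit y0 nonunit_mult' 0 c_mem V)
    finally have "?e \<notin> nonunits V"
      by (simp add: unit_iff)
    moreover have eD: "?e \<in> D"
      by (intro D_add D_mult D_one c_D 0)
    ultimately obtain e' where e': "e' \<in> D" "1 - ?e * e' \<in> nonunits V"
      using res by blast
    \<comment> \<open>Modulo nonunits, \<open>y0 + f * ?w\<close> is \<open>d1\<close>,
      \<open>y0\<close> is \<open>d0\<close> and \<open>?w\<close> is \<open>?e\<close>, so
      \<open>f\<close> is \<open>(d1 - d0) * e'\<close>; the left-hand side collects the
      errors.\<close>
    have "f * (1 - ?e * e') + (m1 - m0 - f * c * m0) * e' \<in> nonunits V"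
      by (intro nonunit_add nonunit_mult'[OF f(1) e'(2)] nonunit_mult[OF _ DV'[OF e'(1)]]
        nonunit_diff[OF nonunit_diff[OF 1(3) 0(3)] nonunit_mult'[OF mult_mem[OF f(1) c_mem[OF V]] 0(3)]])
    also have "f * (1 - ?e * e') + (m1 - m0 - f * c * m0) * e' = f - (d1 + - 1 * d0) * e'"
    proof -
      have m1: "m1 = d0 + m0 + f * (1 + c * (d0 + m0)) - d1"
        using 1(1) by (simp add: 0(1))
      show ?thesis
        unfolding m1 by (simp add: algebra_simps)
    qed
    finally have "f \<in> K"
      by (rule KI) (intro D_mult D_add D_one e' 0 1)
    then show False
      using f(2) by blast
  qed
  show MB: "nonunits V \<subseteq> B 1"
  proof
    fix x
    assume x: "x \<in> nonunits V"
    have y00: "y0 \<noteq> 0"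
      using y0(2) H_0 by blast
    have xy: "x * y0 \<in> nonunits V"
      by (intro nonunit_mult x y0)
    have un: "1 - x * y0 \<in> val_units V"
      by (intro unit_diff_nonunit one_unit xy)
    \<comment> \<open>Chosen such that \<open>1 / y0 - 1 / y' = x\<close>. The group operation with
      the nonunit \<open>m\<close>, an element of \<open>H\<close>, leads from \<open>y0\<close> to
      \<open>y'\<close>, so \<open>y'\<close> stays outside \<open>H\<close>.\<close>
    define y' where "y' = y0 / (1 - x * y0)"
    define m where "m = x * y0 * (y0 / ((1 - x * y0) * ?w))"
    have "m \<in> nonunits V"
      unfolding m_def by (intro nonunit_mult xy divide_mem mult_unit un y0)
    then have "m \<in> H"
      using MH by blast
    have "y' = y0 + m * ?w"
    proof -
      have "m * ?w = x * y0 * y0 / (1 - x * y0)"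
        using w0 by (simp add: m_def)
      then have "(y0 + m * ?w) * (1 - x * y0) = y0"
        using unit_nonzero[OF un] by (simp add: distrib_right) (simp add: algebra_simps)
      then show ?thesis
        by (simp only: y'_def nonzero_divide_eq_eq[OF unit_nonzero[OF un]])
    qed
    then have "y' \<notin> H"
      using H_op_iff[OF \<open>m \<in> H\<close> w0] y0(2) by simp
    then have "inverse y0 - inverse y' \<in> B (Suc 0)"
      using y0(2) T_inverse subset_ring_stage[of T 0] by (intro ring_stage_diff) auto
    also have "inverse y0 - inverse y' = x"
      using y00 unit_nonzero[OF un] by (simp add: y'_def field_simps)
    finally show "x \<in> B 1"
      by simp
  qed
  have "K \<subseteq> D"
    using MB B_D[of 1] by (auto simp: K_def intro: D_add)
  then show "D = V"
    using VK DV by blast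
qed

text \<open>If \<open>x\<close> and \<open>1 / x\<close> are both far out, then \<open>1 / (1 + x)\<close> and \<open>x / (1 + x)\<close> are both small,
  although their sum is \<open>1\<close>.\<close>

lemma unit_or_inverse_bounded:
  assumes D: "valring D" and y0: "y0 \<in> D" "y0 \<notin> H" "1 + c * y0 \<in> val_units D"
  shows "\<exists>n\<ge>1. \<forall>x\<in>val_units D. x \<in> B n \<or> inverse x \<in> B n"
proof -
  interpret valring D by (rule D)
  let ?w = "1 + c * y0"
  have w0: "?w \<noteq> 0"
    using y0(3) by (rule unit_nonzero)
  obtain m where m: "y0 \<in> B m" "inverse ?w \<in> B m"
    using common_B[OF y0(1) unit_mem[OF inverse_unit[OF y0(3)]]] .
  have "x \<in> B (m + 4) \<or> inverse x \<in> B (m + 4)" if x: "x \<in> val_units D" for x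
  proof (rule ccontr)
    assume "\<not> ?thesis"
    then have no: "x \<notin> B (Suc (m + 3))" "inverse x \<notin> B (Suc (m + 3))"
      by (simp_all add: numeral_eq_Suc)
    have x0: "x \<noteq> 0"
      using x by (rule unit_nonzero)
    have "x \<noteq> - 1"
      using no(1) neg_1_ring_stage by blast
    then have x1: "1 + x \<noteq> 0"
      by (metis add.right_neutral add_minus_cancel add.commute)
    \<comment> \<open>If \<open>z s\<close> were outside \<open>H\<close>, its inverse would be in
      \<open>T\<close>, and multiplication by \<open>s\<close> would put \<open>1 / z\<close> into
      the next stage.\<close>
    have small: "z * s \<in> H" if "inverse z \<notin> B (m + 3)" "s \<in> B (m + 2)" for z s
    proof (rule ccontr)
      assume "z * s \<notin> H"
      then have "z * s \<noteq> 0" "inverse (z * s) \<in> B (m + 2)"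
        using H_0 T_inverse subset_ring_stage by (metis, blast)
      then have "s * inverse (z * s) \<in> B (Suc (m + 2))"
        using that(2) by (intro ring_stage_mult)
      moreover have "s * inverse (z * s) = inverse z"
        using \<open>z * s \<noteq> 0\<close> by (simp add: field_simps)
      ultimately have "inverse z \<in> B (Suc (m + 2))"
        by (simp only:)
      then show False
        using that(1) by (simp add: numeral_eq_Suc)
    qed
    define b where "b = inverse (1 + x)"
    define a where "a = x * b"
    have ab: "a = 1 - b"
      using x1 by (simp add: a_def b_def field_simps)
    have "inverse b \<notin> B (m + 3)"
    proof
      assume "inverse b \<in> B (m + 3)"
      then have "inverse b - 1 \<in> B (Suc (m + 3))"
        by (intro ring_stage_diff ring_stage_01)
      then show False
        using no(1) by (simp add: b_def)
    qed
    then have "b * y0 \<in> H"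
      using m(1) ring_stage_mono[of m "m + 2" T] by (intro small) auto
    have "inverse a \<notin> B (m + 3)"
    proof
      assume "inverse a \<in> B (m + 3)"
      then have "inverse a - 1 \<in> B (Suc (m + 3))"
        by (intro ring_stage_diff ring_stage_01)
      moreover have "inverse a - 1 = inverse x"
        using x0 x1 by (simp add: a_def b_def field_simps)
      ultimately show False
        using no(2) by (simp)
    qed
    moreover have "- 1 * (y0 * inverse ?w) \<in> B (Suc (Suc m))"
      by (intro ring_stage_mult neg_1_ring_stage m)
    ultimately have *: "a * (- 1 * (y0 * inverse ?w)) \<in> H"
      by (intro small) (simp_all add: numeral_eq_Suc)
    \<comment> \<open>Since \<open>a + b = 1\<close>, the group operation on \<open>y0\<close> with
      \<open>- a y0 / ?w\<close> gives \<open>b y0\<close>; as both of these are in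
      \<open>H\<close>, \<open>y0\<close> would be too.\<close>
    have "a * (- 1 * (y0 * inverse ?w)) * ?w = - (a * y0)"
      using w0 by (simp add: mult.assoc)
    then have "y0 + a * (- 1 * (y0 * inverse ?w)) * ?w = b * y0"
      by (simp add: ab left_diff_distrib)
    then show False
      using H_op_iff[OF * w0] \<open>b * y0 \<in> H\<close> y0(2) by simp
  qed
  then show ?thesis
    by (intro exI[of _ "m + 4"]) auto
qed

section \<open>Excluding nonarchimedean absolute values\<close>

text \<open>Elements outside \<open>H\<close> have their inverses in stage \<open>0\<close>, where
  \<open>N\<close> is bounded; this yields \<open>\<epsilon>\<close>. If \<open>N\<close> were at
  most \<open>1\<close> on the integers, it would be ultrametric, and its unit ball a valuation ring
  whose maximal ideal lies in \<open>H\<close>. That ring would contain \<open>D\<close>, although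
  \<open>N\<close> exceeds \<open>1\<close> somewhere on \<open>D\<close>.\<close>

lemma rank_one_archimedean:
  assumes D: "valring D" and M: "nonunits D \<subseteq> B 1"
    and y0: "y0 \<in> D" "y0 \<notin> H" "1 + c * y0 \<in> val_units D" and unbounded: "\<And>n. B n \<noteq> D"
  obtains N C \<epsilon> n where "quasi_absolute_value D N C" "\<epsilon> > 0" "\<And>y. \<lbrakk>y \<in> D; N y < \<epsilon>\<rbrakk> \<Longrightarrow> y \<in> H"
    "N (of_nat n) > 1"
proof -
  obtain n0 where n0: "n0 \<ge> 1" "\<forall>x\<in>val_units D. x \<in> B n0 \<or> inverse x \<in> B n0"
    using unit_or_inverse_bounded[OF D y0] by blast
  interpret valring D by (rule D)
  interpret bounded_exhaustion D T n0
    by unfold_locales (use n0 M unbounded ring_stage_mono[of 1 n0 T] in \<open>auto simp: D_def ring_stage.simps(2)\<close>)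
  obtain N C where N: "quasi_absolute_value D N C" and bound: "\<And>n. \<exists>b. \<forall>x\<in>B n. N x \<le> b"
    and big: "\<exists>x\<in>D. N x > 1"
    using quasi_absolute_value_exists by blast
  interpret quasi_absolute_value D N C by (rule N)
  obtain b where b: "\<forall>x\<in>B 0. N x \<le> b"
    using bound by blast
  define \<epsilon> where "\<epsilon> = 1 / max b 1"
  have \<epsilon>: "\<epsilon> > 0"
    by (simp add: \<epsilon>_def)
  have near: "y \<in> H" if y: "y \<in> D" "N y < \<epsilon>" for y
  proof (rule ccontr)
    assume "y \<notin> H"
    then have inv: "inverse y \<in> T" "inverse y \<in> D" "y \<noteq> 0"
      using T_inverse inverse_D H_0 by auto
    then have u: "y \<in> val_units D"
      using y(1) by (simp add: val_units_def)
    have "N (inverse y) \<le> max b 1"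
      using b inv(1) subset_ring_stage[of T 0] by (auto simp: le_max_iff_disj)
    then have "inverse (N y) \<le> max b 1"
      using N_inverse[OF u] by simp
    then have "\<epsilon> \<le> N y"
      using N_pos[OF u] by (simp add: \<epsilon>_def field_simps)
    then show False
      using y(2) by simp
  qed
  have "\<exists>n. N (of_nat n) > 1"
  proof (rule ccontr)
    assume "\<not> ?thesis"
    then have ultra: "N (x + y) \<le> max (N x) (N y)" if "x \<in> D" "y \<in> D" for x y
      using ultrametric[OF _ that] not_less by blast
    define V where "V = {x \<in> D. N x \<le> 1}"
    have V: "valring V"
    proof
      show "1 \<in> V"
        by (simp add: V_def one_mem N_1)
      show "x + y \<in> V" "x * y \<in> V" if "x \<in> V" "y \<in> V" for x y
        using that ultra[of x y] by (auto simp: V_def add_mem mult_mem N_mult N_nonneg intro: mult_le_one)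
      show "x \<in> V \<or> inverse x \<in> V" for x
      proof (cases "x \<in> val_units D")
        case True
        then show ?thesis
          using N_inverse[OF True] N_pos[OF True] unit_mem[OF True] unit_mem[OF inverse_unit[OF True]]
          by (auto simp: V_def inverse_le_1_iff)
      next
        case False
        then have "x \<in> nonunits D \<or> inverse x \<in> nonunits D"
          using not_mem_iff[of x] by (auto simp: unit_iff)
        then show ?thesis
          using N_zero_iff[of x] N_zero_iff[of "inverse x"] nonunit_mem by (auto simp: V_def)
      qed
    qed
    have VM: "y \<in> D \<and> N y < 1" if "y \<in> nonunits V" for y
    proof -
      have yV: "y \<in> D" "N y \<le> 1"
        using valring.nonunit_mem[OF V that] by (auto simp: V_def)
      show ?thesis
      proof (cases "y \<in> val_units D")
        case True
        have "inverse y \<notin> V"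
          using that unit_nonzero[OF True] by (auto simp: nonunits_def)
        then have "inverse (N y) > 1"
          using unit_mem[OF inverse_unit[OF True]] N_inverse[OF True] by (auto simp: V_def)
        then show ?thesis
          using yV N_pos[OF True] by (simp add: field_simps)
      qed (use yV N_zero_iff[of y] in \<open>auto simp: unit_iff\<close>)
    qed
    \<comment> \<open>Each Newton step at least squares the smallness, so after finitely many steps
      the remainder is below \<open>\<epsilon>\<close>.\<close>
    have "y \<in> H" if "y \<in> nonunits V" "N y ^ (2 ^ n) < \<epsilon>" for n y
      using that
    proof (induction n arbitrary: y)
      case 0
      then show ?case
        using near VM by simp
    next
      case (Suc n)
      obtain m a where m: "m \<in> nonunits V" "m \<in> H \<longrightarrow> y \<in> H" "a \<in> V" "m = y ^ 2 * a"
        using contraction_step[OF V Suc.prems(1)] by blast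
      have yD: "y \<in> D"
        using VM Suc.prems(1) by blast
      have "N m = N y ^ 2 * N a"
        using m(3,4) yD by (simp add: V_def N_mult N_power power_mem)
      also have "\<dots> \<le> N y ^ 2"
        using m(3) by (intro mult_left_le) (auto simp: V_def)
      finally have "N m ^ (2 ^ n) \<le> (N y ^ 2) ^ (2 ^ n)"
        by (intro power_mono N_nonneg)
      also have "\<dots> < \<epsilon>"
        using Suc.prems(2) by (simp add: power_mult)
      finally show ?case
        using Suc.IH m(1,2) by blast
    qed
    moreover have "\<exists>n. N y ^ (2 ^ n) < \<epsilon>" if y: "y \<in> nonunits V" for y
    proof -
      obtain n where "N y ^ n < \<epsilon>"
        using real_arch_pow_inv[OF \<epsilon>] VM[OF y] by blast
      moreover have "N y ^ (2 ^ n) \<le> N y ^ n"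
        using VM[OF y] N_nonneg[of y] by (intro power_decreasing) auto
      ultimately show ?thesis
        by (intro exI[of _ n]) simp
    qed
    ultimately have "nonunits V \<subseteq> H"
      by blast
    then have "D \<subseteq> V"
      using T_subset_if_nonunits[OF V] D_subset_valring[OF V] by blast
    then show False
      using big by (force simp: V_def)
  qed
  then show ?thesis
    using that[OF N \<epsilon> near] by blast
qed

section \<open>Fractional ideals contained in \<open>H\<close>\<close>

lemma P_dominant:
  assumes W: "valring W" and x: "x \<notin> W" "\<pi> * x \<in> W"
  shows "\<exists>v. v - 1 \<in> nonunits W \<and> P x = x ^ q * v"
proof -
  interpret valring W by (rule W)
  obtain a where a: "a \<in> W" "P x = x ^ q + x * a"
    using P_remainder[OF W x(2)] by blast
  have x0: "x \<noteq> 0" "inverse x \<in> nonunits W"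
    using x(1) not_mem_iff by auto
  have "inverse x ^ (q - 1) * a \<in> nonunits W"
    using q_ge_2 by (intro nonunit_mult power_nonunit x0 a) simp
  moreover have "x ^ q * (1 + inverse x ^ (q - 1) * a) = P x"
  proof -
    have "x ^ q = x ^ (q - 1) * x"
      using q_pos by (simp flip: power_Suc2)
    moreover have "x ^ (q - 1) * inverse x ^ (q - 1) = 1"
      using x0(1) by (simp flip: power_mult_distrib)
    ultimately have "x ^ q * inverse x ^ (q - 1) = x"
      by (metis mult.commute mult.left_commute mult_1_right)
    then show ?thesis
      by (simp add: a(2) distrib_left flip: mult.assoc)
  qed
  ultimately show ?thesis
    by (intro exI[of _ "1 + inverse x ^ (q - 1) * a"]) simp
qed

text \<open>A preimage \<open>x\<close> of \<open>h\<close> cannot lie in \<open>W\<close>, so the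
  leading power dominates in \<open>P x\<close>, and \<open>h\<close> is a \<open>q\<close>-th power
  up to a factor that is \<open>1\<close> modulo nonunits.\<close>

lemma H_dominant:
  assumes W: "valring W" and h: "h \<in> H" "h \<notin> W" "c * h \<in> W"
  shows "\<exists>x v. v - 1 \<in> nonunits W \<and> x ^ q = h * v"
proof -
  interpret valring W by (rule W)
  obtain x where x: "h = P x"
    using h(1) by (auto simp: H_def)
  have "(1 + \<pi> * x) ^ q \<in> W"
    using add_mem[OF one_mem h(3)] by (simp add: P_eq x)
  then have "1 + \<pi> * x \<in> W"
    using q_pos by (simp add: power_mem_iff)
  then have px: "\<pi> * x \<in> W"
    using diff_mem[OF _ one_mem, of "1 + \<pi> * x"] by simp
  have "x \<notin> W"
  proof
    assume "x \<in> W"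
    moreover obtain a where "a \<in> W" "P x = x ^ q + x * a"
      using P_remainder[OF W px] by blast
    ultimately show False
      using h(2) x by (auto intro: add_mem mult_mem power_mem)
  qed
  then obtain v where "v - 1 \<in> nonunits W" "P x = x ^ q * v"
    using P_dominant[OF W _ px] by blast
  then show ?thesis
    using one_units_inverse[of v] unit_nonzero[OF one_unit_is_unit[of v]] x
    by (intro exI[of _ x] exI[of _ "inverse v"]) simp
qed

text \<open>Here \<open>A\<close> is a fractional ideal contained in \<open>H\<close> and maximal as such, and \<open>W\<close> is its
  multiplier ring. If some \<open>z r\<close> with \<open>r\<close> a nonunit is still outside \<open>A\<close>, there is room for a
  difference of inverses. Otherwise \<open>z\<close> generates the least fractional ideal above \<open>A\<close>, and modulo
  the nonunits \<open>H\<close> looks like the group of \<open>q\<close>-th powers of a field of characteristic \<open>q\<close>.\<close>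

context
  fixes W A :: "'a set"
  assumes W: "valring W" and A_1: "1 \<in> A"
    and A_smult: "\<And>x a. \<lbrakk>x \<in> A; a \<in> W\<rbrakk> \<Longrightarrow> x * a \<in> A"
    and stabilizer: "\<And>e. (\<And>a. a \<in> A \<Longrightarrow> e * a \<in> A) \<Longrightarrow> e \<in> W"
    and A_H: "A \<subseteq> H" and cA: "\<And>x. x \<in> A \<Longrightarrow> c * x \<in> nonunits W"
    and not_A: "\<And>z. z \<notin> A \<Longrightarrow> \<exists>a\<in>W. z * a \<notin> H \<and> 1 + c * (z * a) \<in> val_units W"
begin

interpretation valring W by (rule W)

lemma A_0: "0 \<in> A"
  using A_smult[OF A_1 zero_mem] by simp

text \<open>With \<open>\<rho> = y / z\<close> and \<open>y' = y / (1 - \<rho>)\<close> one has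
  \<open>1 / y - 1 / y' = 1 / z\<close>. If \<open>y\<close> is outside \<open>H\<close>, so is
  \<open>y'\<close> as soon as it arises from \<open>y\<close> by the group operation with an
  element of \<open>A\<close>, for which \<open>y \<rho>\<close> should be in \<open>A\<close>. The
  assumptions leave room for such a \<open>y\<close> among the multiples of
  \<open>z r\<close>.\<close>

lemma difference_if_not_maximal:
  assumes "z \<notin> A" "r \<in> nonunits W" "z * r \<notin> A"
  shows "\<exists>s\<in>T. \<exists>t\<in>T. inverse z = s - t"
proof -
  have z0: "z \<noteq> 0" and r0: "r \<noteq> 0"
    using assms(1,3) A_0 by auto
  have "inverse r \<notin> W"
    using assms(2) r0 by (simp add: nonunits_def)
  then obtain a where a: "a \<in> A" "inverse r * a \<notin> A"
    using stabilizer by blast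
  define g where "g = inverse r * a"
  have "g * r = a"
    using r0 by (simp add: g_def field_simps)
  then have g: "g * r \<in> A" "g \<notin> A"
    using a by (simp_all only: g_def not_False_eq_True)
  have g0: "g \<noteq> 0"
    using g(2) A_0 by auto
  \<comment> \<open>Of \<open>z r\<close> and \<open>g\<close>, the one divisible by the other is
    taken: it is a multiple of \<open>z r\<close> outside \<open>A\<close>, and multiplication by
    \<open>r\<close> brings it into \<open>A\<close>.\<close>
  obtain g' v where g': "g' \<notin> A" "g' * r \<in> A" "v \<in> W" "g' = z * r * v"
  proof (cases "z * r / g \<in> W")
    case True
    then have "g * r * (z * r / g) \<in> A"
      by (intro A_smult g)
    also have "g * r * (z * r / g) = z * r * r"
      using g0 by simp
    finally show ?thesis
      by (intro that[of "z * r" 1]) (simp_all only: assms(3) one_mem mult_1_right not_False_eq_True)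
  next
    case False
    then have "g / (z * r) \<in> W"
      using quotient_cases by blast
    then show ?thesis
      using that[of g "g / (z * r)"] g z0 r0 by simp
  qed
  obtain o' where o': "o' \<in> W" "g' * o' \<notin> H" "1 + c * (g' * o') \<in> val_units W"
    using not_A[OF g'(1)] by blast
  define y where "y = g' * o'"
  define \<rho> where "\<rho> = inverse z * y"
  have y0: "y \<noteq> 0"
    using o'(2) H_0 by (auto simp: y_def)
  have \<rho>_eq: "\<rho> = r * (v * o')"
    using z0 by (simp add: \<rho>_def y_def g'(4))
  have \<rho>: "\<rho> \<in> nonunits W"
    unfolding \<rho>_eq by (intro nonunit_mult assms(2) mult_mem g'(3) o'(1))
  have un: "1 - \<rho> \<in> val_units W"
    by (intro unit_diff_nonunit one_unit \<rho>)
  have un0: "1 - \<rho> \<noteq> 0" "1 + c * y \<noteq> 0"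
    using unit_nonzero[OF un] unit_nonzero[OF o'(3)] by (simp_all add: y_def)
  define y' where "y' = y / (1 - \<rho>)"
  define m where "m = g' * r * (o' * (v * o') / ((1 - \<rho>) * (1 + c * y)))"
  have "m \<in> A"
    unfolding m_def using o' un
    by (intro A_smult g' divide_mem mult_mem mult_unit) (simp_all add: y_def)
  then have "m \<in> H"
    using A_H by blast
  have "m * (1 + c * y) = y * \<rho> / (1 - \<rho>)"
    using un0 by (simp add: m_def y_def \<rho>_eq)
  then have "(y + m * (1 + c * y)) * (1 - \<rho>) = y"
    using un0 by (simp add: distrib_right) (simp add: algebra_simps)
  then have "y' = y + m * (1 + c * y)"
    by (simp only: y'_def nonzero_divide_eq_eq[OF un0(1)])
  then have "y' \<notin> H"
    using H_op_iff[OF \<open>m \<in> H\<close> un0(2)] o'(2) by (simp add: y_def)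
  moreover have "inverse z = inverse y - inverse y'"
    using y0 un0 z0 by (simp add: y'_def \<rho>_def field_simps)
  ultimately show ?thesis
    using T_inverse[of y] T_inverse[of y'] o'(2)
    by (intro bexI[of _ "inverse y"] bexI[of _ "inverse y'"]) (simp_all add: y_def)
qed

text \<open>Multiplying \<open>h\<close> by \<open>v\<close> amounts to the group operation with
  \<open>h (v - 1) / (1 + c h)\<close>, which lies in \<open>A\<close> and so in
  \<open>H\<close>.\<close>

lemma H_closed_modulo_A:
  assumes h: "h \<in> H" "y = h * v" "v - 1 \<in> nonunits W" "c * h \<in> W" "1 + c * y \<in> val_units W"
    and A: "\<And>r. r \<in> nonunits W \<Longrightarrow> h * r \<in> A"
  shows "y \<in> H"
proof -
  have "1 + c * h = 1 + c * y - c * h * (v - 1)"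
    by (simp add: h(2) algebra_simps)
  also have "\<dots> \<in> val_units W"
    by (intro unit_diff_nonunit h nonunit_mult')
  finally have u: "1 + c * h \<in> val_units W" .
  have "h * ((v - 1) / (1 + c * h)) \<in> H"
    using A_H A nonunit_divide[OF h(3) u] by blast
  then have "h + h * ((v - 1) / (1 + c * h)) * (1 + c * h) \<in> H"
    by (intro H_op h(1))
  also have "h + h * ((v - 1) / (1 + c * h)) * (1 + c * h) = y"
    using unit_nonzero[OF u] by (simp add: h(2) right_diff_distrib)
  finally show ?thesis .
qed

text \<open>With \<open>y = z / f\<close> outside \<open>H\<close> and
  \<open>y' = z / (f - 1)\<close> one has \<open>1 / y - 1 / y' = 1 / z\<close>. If
  \<open>y'\<close> were in \<open>H\<close>, then \<open>z\<close> and \<open>y'\<close> would both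
  be \<open>q\<close>-th powers up to factors that are \<open>1\<close> modulo nonunits. The same
  would hold for \<open>f - 1\<close>, then for \<open>f\<close>, because
  \<open>1 + \<rho> ^ q\<close> and \<open>(1 + \<rho>) ^ q\<close> agree modulo nonunits, and then
  for \<open>y\<close>, which would put \<open>y\<close> into \<open>H\<close>.\<close>

lemma difference_if_maximal:
  assumes z: "z \<notin> A" "z \<in> H" and max: "\<And>r. r \<in> nonunits W \<Longrightarrow> z * r \<in> A"
  shows "\<exists>s\<in>T. \<exists>t\<in>T. inverse z = s - t"
proof -
  have z0: "z \<noteq> 0"
    using z(1) A_0 by auto
  have cM: "c \<in> nonunits W"
    using cA[OF A_1] by simp
  have c_z: "c * z \<in> W"
  proof (rule ccontr)
    assume "c * z \<notin> W"
    then have "c * z \<noteq> 0" "inverse (c * z) \<in> nonunits W"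
      using not_mem_iff by blast+
    then have "c * (z * inverse (c * z)) \<in> nonunits W"
      by (intro cA max)
    moreover have "c * (z * inverse (c * z)) = 1"
      using \<open>c * z \<noteq> 0\<close> by (simp add: field_simps)
    ultimately show False
      using one_not_nonunit by (simp only:)
  qed
  have z_W: "z * v \<notin> W" if "v \<in> val_units W" for v
  proof
    assume "z * v \<in> W"
    then have "1 * (z * v / v) \<in> A"
      by (intro A_smult A_1 divide_mem that)
    then show False
      using z(1) unit_nonzero[OF that] by simp
  qed
  have maxu: "z * v * r \<in> A" if "v \<in> val_units W" "r \<in> nonunits W" for v r
    using max[OF nonunit_mult'[OF unit_mem[OF that(1)] that(2)]] by (simp add: mult.assoc)
  obtain o' where o': "o' \<in> W" "z * o' \<notin> H" "1 + c * (z * o') \<in> val_units W"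
    using not_A[OF z(1)] by blast
  have ou: "o' \<in> val_units W"
    using o' max A_H by (auto simp: unit_iff)
  define y where "y = z * o'"
  define f where "f = inverse o'"
  have f: "f \<in> val_units W"
    unfolding f_def by (intro inverse_unit ou)
  \<comment> \<open>If \<open>f\<close> were \<open>1\<close> modulo nonunits,
    \<open>y = z / f\<close> would be in \<open>H\<close> along with \<open>z\<close>.\<close>
  have f1: "f - 1 \<in> val_units W"
  proof (rule ccontr)
    assume "f - 1 \<notin> val_units W"
    then have "f - 1 \<in> nonunits W"
      using f diff_mem[OF unit_mem one_mem] by (auto simp: unit_iff)
    then have "o' - 1 \<in> nonunits W"
      using one_units_inverse[of f] by (simp add: f_def)
    then show False
      using H_closed_modulo_A[OF z(2) refl, of o'] c_z o' max by blast
  qed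
  define y' where "y' = z / (f - 1)"
  have "y' \<notin> H"
  proof
    assume "y' \<in> H"
    have "y' = z * inverse (f - 1)"
      by (simp add: y'_def divide_inverse)
    then have "y' \<notin> W" "c * y' \<in> W"
      using z_W[OF inverse_unit[OF f1]] mult_mem[OF c_z unit_mem[OF inverse_unit[OF f1]]]
      by (simp_all add: mult.assoc)
    then obtain x1 v1 where x1: "v1 - 1 \<in> nonunits W" "x1 ^ q = y' * v1"
      using H_dominant[OF W \<open>y' \<in> H\<close>] by blast
    obtain x0 v0 where x0: "v0 - 1 \<in> nonunits W" "x0 ^ q = z * v0"
      using H_dominant[OF W z(2)] z_W[OF one_unit] c_z by auto
    have v: "v0 \<in> val_units W" "v1 \<in> val_units W"
      using x0(1) x1(1) one_unit_is_unit by auto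
    have nz: "v0 \<noteq> 0" "v1 \<noteq> 0" "f - 1 \<noteq> 0" "f \<noteq> 0"
      using v f1 f unit_nonzero by blast+
    define \<rho> where "\<rho> = x0 / x1"
    define v2 where "v2 = v0 / v1"
    have v2: "v2 - 1 \<in> nonunits W"
      unfolding v2_def by (intro one_units_divide x0 x1)
    have \<rho>q: "\<rho> ^ q = (f - 1) * v2"
      using z0 nz by (simp add: \<rho>_def v2_def power_divide x0(2) x1(2) y'_def)
    then have "\<rho> \<in> val_units W"
      using mult_unit[OF f1 one_unit_is_unit[OF v2]] q_pos power_unit_iff[of q \<rho>] by simp
    then have "(1 + \<rho>) ^ q - (1 + \<rho> ^ q) \<in> nonunits W"
      by (intro freshmans_dream_mod_nonunits prime_q q_nonunit W cM unit_mem)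
    then have "((1 + \<rho>) ^ q - (1 + \<rho> ^ q) + (f - 1) * (v2 - 1)) / f \<in> nonunits W"
      by (intro nonunit_divide nonunit_add nonunit_mult' unit_mem f1 v2 f)
    moreover have "((1 + \<rho>) ^ q - (1 + \<rho> ^ q) + (f - 1) * (v2 - 1)) / f = (1 + \<rho>) ^ q / f - 1"
      using nz by (simp add: \<rho>q field_simps)
    ultimately have v3: "(1 + \<rho>) ^ q / f - 1 \<in> nonunits W"
      by simp
    define v3 where "v3 = (1 + \<rho>) ^ q / f"
    have v3': "v3 - 1 \<in> nonunits W"
      using v3 by (simp add: v3_def)
    have v3q: "(1 + \<rho>) ^ q = f * v3"
      using nz by (simp add: v3_def)
    \<comment> \<open>A \<open>q\<close>-th root of \<open>y\<close> up to a factor that is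
      \<open>1\<close> modulo nonunits, since \<open>x0\<close> is one of \<open>z\<close> and
      \<open>1 + \<rho>\<close> one of \<open>f\<close>.\<close>
    define x2 where "x2 = x0 / (1 + \<rho>)"
    define v4 where "v4 = v0 / v3"
    have v4: "v4 - 1 \<in> nonunits W"
      unfolding v4_def by (intro one_units_divide x0 v3')
    have "x2 ^ q = z * v0 / (f * v3)"
      by (simp add: x2_def power_divide x0(2) v3q)
    also have "\<dots> = y * v4"
      by (simp add: v4_def y_def f_def divide_inverse mult_ac)
    finally have x2q: "x2 ^ q = y * v4" .
    have v4u: "o' * v4 \<in> val_units W"
      by (intro mult_unit ou one_unit_is_unit v4)
    have "x2 ^ q \<notin> W"
      using z_W[OF v4u] by (simp add: x2q y_def mult.assoc)
    then have x2W: "x2 \<notin> W"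
      using power_mem by blast
    have "(\<pi> * x2) ^ q \<in> W"
      using mult_mem[OF c_z unit_mem[OF v4u]]
      by (simp add: power_mult_distrib x2q y_def c_def mult_ac)
    then have "\<pi> * x2 \<in> W"
      using q_pos by (simp add: power_mem_iff)
    then obtain v5 where v5: "v5 - 1 \<in> nonunits W" "P x2 = x2 ^ q * v5"
      using P_dominant[OF W x2W] by blast
    define v6 where "v6 = v4 * v5"
    have v6: "v6 - 1 \<in> nonunits W"
      unfolding v6_def by (intro one_units_mult v4 v5)
    have P6: "P x2 = y * v6"
      by (simp add: v5(2) x2q v6_def)
    have cy: "c * y \<in> W"
      using mult_mem[OF c_z o'(1)] by (simp add: y_def mult.assoc)
    have "1 + c * P x2 = 1 + c * y + c * y * (v6 - 1)"
      by (simp add: P6 algebra_simps)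
    also have "\<dots> \<in> val_units W"
      using o'(3) by (intro unit_add_nonunit[OF _ nonunit_mult'[OF cy v6]]) (simp add: y_def)
    finally have "1 + c * P x2 \<noteq> 0"
      by (rule unit_nonzero)
    then have "P x2 \<in> H"
      by (auto simp: H_def)
    then have "y \<in> H"
    proof (rule H_closed_modulo_A)
      show "y = P x2 * inverse v6"
        using unit_nonzero[OF one_unit_is_unit[OF v6]] by (simp add: P6)
      show "inverse v6 - 1 \<in> nonunits W"
        by (intro one_units_inverse v6)
      show "c * P x2 \<in> W"
        using mult_mem[OF cy unit_mem[OF one_unit_is_unit[OF v6]]] by (simp add: P6 mult.assoc)
      show "1 + c * y \<in> val_units W"
        using o'(3) by (simp add: y_def)
      show "P x2 * r \<in> A" if "r \<in> nonunits W" for r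
        using maxu[OF mult_unit[OF ou one_unit_is_unit[OF v6]] that] by (simp add: P6 y_def mult.assoc)
    qed
    then show False
      using o'(2) by (simp add: y_def)
  qed
  moreover have "inverse z = inverse y - inverse y'"
    using z0 unit_nonzero[OF ou] unit_nonzero[OF f1]
    by (simp add: y_def y'_def f_def field_simps)
  ultimately show ?thesis
    using T_inverse[of y] T_inverse[of y'] o'(2)
    by (intro bexI[of _ "inverse y"] bexI[of _ "inverse y'"]) (simp_all add: y_def)
qed

text \<open>An element outside \<open>A\<close> is outside \<open>H\<close> or falls under one of
  the two preceding lemmas. The right-hand side depends on \<open>T\<close> alone, as definability
  requires.\<close>

lemma cut_complement: "{t. t = 0 \<or> inverse t \<notin> A} = insert 0 T \<union> {s - t | s t. s \<in> T \<and> t \<in> T}"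
proof -
  let ?J = "{t. t = 0 \<or> inverse t \<notin> A}"
  have smult: "t * a \<in> ?J" if "t \<in> ?J" "a \<in> W" for t a
    by (rule inverse_complement_mult[OF A_smult that(2,1)])
  have diff: "s - t \<in> ?J" if "s \<in> ?J" "t \<in> ?J" for s t
    using submodule_add[OF smult that(1) smult[OF that(2) neg_mem[OF one_mem]]] by simp
  have T: "t \<in> ?J" if t: "t \<in> T" for t
  proof -
    obtain e y where "y \<notin> H" "t = e * inverse y" "e \<in> W"
      using T_cases[OF t] W by blast
    then show ?thesis
      using smult[of "inverse y" e] A_H by (auto simp: mult.commute)
  qed
  have sub: "t \<in> insert 0 T \<union> {s - t | s t. s \<in> T \<and> t \<in> T}" if "t \<in> ?J" for t
  proof (cases "t = 0")
    case False
    then have z: "inverse t \<notin> A"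
      using that by simp
    consider "inverse t \<notin> H" | r where "r \<in> nonunits W" "inverse t * r \<notin> A"
      | "inverse t \<in> H" "\<And>r. r \<in> nonunits W \<Longrightarrow> inverse t * r \<in> A"
      by blast
    then show ?thesis
    proof cases
      case 1
      then show ?thesis
        using T_inverse[of "inverse t"] by simp
    next
      case 2
      then show ?thesis
        using difference_if_not_maximal[OF z] by auto
    next
      case 3
      then show ?thesis
        using difference_if_maximal[OF z] by auto
    qed
  qed simp
  show ?thesis
  proof (intro equalityI subsetI)
    fix t
    assume "t \<in> insert 0 T \<union> {s - t | s t. s \<in> T \<and> t \<in> T}"
    then consider "t = 0" | "t \<in> T" | s s' where "t = s - s'" "s \<in> T" "s' \<in> T"
      by blast
    then show "t \<in> ?J"
    proof cases
      case 3
      then show ?thesis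
        using diff[OF T T] by blast
    qed (use T in auto)
  qed (rule sub)
qed

end

text \<open>If \<open>c x\<close> were not a nonunit for some \<open>x\<close> in \<open>A\<close>,
  every \<open>(w - 1) / c\<close> with \<open>w\<close> a unit would be a multiple of
  \<open>x\<close> by an element of \<open>V\<close> and hence in \<open>H\<close>, the case
  excluded by \<open>no\<close>. So \<open>c A\<close> consists of nonunits, and \<open>A\<close> is
  the largest fractional ideal of \<open>V\<close> inside \<open>H\<close>.\<close>

lemma definable_if_H_contains_units_part:
  assumes T: "definable_set T" and V: "valring V"
    and VH: "\<And>y. \<lbrakk>y \<in> V; 1 + c * y \<in> val_units V\<rbrakk> \<Longrightarrow> y \<in> H"
    and no: "\<not> (c \<noteq> 0 \<and> (\<forall>w\<in>val_units V. (w - 1) / c \<in> H))"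
  shows "admits_nontrivial_empty_definable_valuation TYPE('a)"
proof -
  interpret valring V by (rule V)
  define A where "A = {x. \<forall>a\<in>V. 1 + c * (x * a) \<in> val_units V \<longrightarrow> x * a \<in> H}"
  define W where "W = {e. \<forall>a\<in>A. e * a \<in> A}"
  have A_smult: "x * a \<in> A" if "x \<in> A" "a \<in> V" for x a
    using that mult_mem[OF that(2)] by (auto simp: A_def mult.assoc)
  have A_1: "1 \<in> A"
    using VH by (auto simp: A_def)
  have A_0: "0 \<in> A"
    using A_smult[OF A_1 zero_mem] by simp
  have A_add: "x + y \<in> A" if "x \<in> A" "y \<in> A" for x y
    by (rule submodule_add[OF A_smult that])
  have cA: "c * x \<in> nonunits V" if x: "x \<in> A" for x
  proof (rule ccontr)
    assume cx: "c * x \<notin> nonunits V"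
    then have nz: "c \<noteq> 0" "x \<noteq> 0" and inv: "inverse (c * x) \<in> V"
      by (auto simp: nonunits_def)
    have "(w - 1) / c \<in> H" if w: "w \<in> val_units V" for w
    proof -
      have "x * ((w - 1) * inverse (c * x)) = (w - 1) / c"
        using nz by (simp add: field_simps)
      moreover have "(w - 1) * inverse (c * x) \<in> V"
        by (intro mult_mem diff_mem unit_mem w one_mem inv)
      moreover have "1 + c * ((w - 1) / c) \<in> val_units V"
        using w nz by simp
      ultimately show ?thesis
        using x unfolding A_def by (metis (mono_tags, lifting) mem_Collect_eq)
    qed
    then show False
      using no nz by blast
  qed
  have V_W: "V \<subseteq> W"
  proof
    fix a
    assume "a \<in> V"
    then have "a * x \<in> A" if "x \<in> A" for x
      unfolding mult.commute[of a] by (intro A_smult that)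
    then show "a \<in> W"
      by (simp add: W_def)
  qed
  have W: "valring W"
  proof
    show "1 \<in> W"
      by (simp add: W_def)
    show "x \<in> W \<or> inverse x \<in> W" for x
      using V_W mem_or_inverse by blast
    fix x y
    assume "x \<in> W" "y \<in> W"
    then show "x + y \<in> W" "x * y \<in> W"
      by (auto simp: W_def distrib_right mult.assoc intro: A_add)
  qed
  have A_W: "x * a \<in> A" if "x \<in> A" "a \<in> W" for x a
    using that by (auto simp: W_def mult.commute)
  have A_H: "A \<subseteq> H"
  proof
    fix x
    assume x: "x \<in> A"
    then show "x \<in> H"
      using one_plus_unit[OF cA[OF x]] one_mem by (auto simp: A_def dest!: bspec[of _ _ 1])
  qed
  have cA_W: "c * x \<in> nonunits W" if x: "x \<in> A" for x
  proof (rule ccontr)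
    assume "c * x \<notin> nonunits W"
    then have nz: "c * x \<noteq> 0" and inv: "inverse (c * x) \<in> W"
      by (auto simp: nonunits_def)
    have "c * (x * inverse (c * x)) \<in> nonunits V"
      by (intro cA A_W x inv)
    moreover have "c * (x * inverse (c * x)) = 1"
      using nz by (simp add: field_simps)
    ultimately show False
      using one_not_nonunit by (simp only:)
  qed
  have not_A: "\<exists>a\<in>W. z * a \<notin> H \<and> 1 + c * (z * a) \<in> val_units W" if "z \<notin> A" for z
    using that V_W by (auto simp: A_def val_units_def)
  define J where "J = {t. t = 0 \<or> inverse t \<notin> A}"
  have J_T: "J = insert 0 T \<union> {s - t | s t. s \<in> T \<and> t \<in> T}"
    unfolding J_def
    by (rule cut_complement[OF W A_1 A_W _ A_H cA_W not_A]) (auto simp: W_def)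
  have J_smult: "t * a \<in> J" if "t \<in> J" "a \<in> V" for t a
    using that unfolding J_def by (intro inverse_complement_mult[of A] A_smult)
  have J_add: "x + y \<in> J" if "x \<in> J" "y \<in> J" for x y
    by (rule submodule_add[OF J_smult that])
  \<comment> \<open>The multiplier ring of \<open>J\<close>; it omits \<open>y\<close>, since
    \<open>1 / y\<close> lies in \<open>J\<close> and \<open>1\<close> does not.\<close>
  define R where "R = - {x. \<exists>t. t \<in> J \<and> x * t \<notin> J}"
  have R_iff: "x \<in> R \<longleftrightarrow> (\<forall>t\<in>J. x * t \<in> J)" for x
    by (auto simp: R_def)
  have "V \<subseteq> R"
  proof
    fix a
    assume "a \<in> V"
    then have "a * t \<in> J" if "t \<in> J" for t
      unfolding mult.commute[of a] by (intro J_smult that)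
    then show "a \<in> R"
      by (simp add: R_iff)
  qed
  then have "x \<in> R \<or> inverse x \<in> R" for x
    using mem_or_inverse by blast
  then have R: "valring R"
    by unfold_locales (auto simp: R_iff distrib_right mult.assoc intro: J_add)
  obtain y where "y \<notin> A"
    using A_H H_proper by blast
  then have y: "inverse y \<in> J" "y \<noteq> 0"
    using A_0 by (auto simp: J_def)
  have "1 \<notin> J"
    using A_1 by (simp add: J_def)
  then have "y \<notin> R"
    using y by (force simp: R_iff)
  have "definable_set {x. \<exists>s t. x = s - t \<and> s \<in> T \<and> t \<in> T}"
    by (rule definable_set_Ex2) (intro definable_intros T)
  then have J: "definable_set J"
    unfolding J_T by (intro definable_set_Un definable_set_insert_0 T)
  have "definable_set R"
    unfolding R_def by (intro definable_set_Compl definable_set_Ex definable_intros J)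
  then show ?thesis
    using valring.admits_definable_valuation[OF R] \<open>y \<notin> R\<close> by blast
qed

lemma definable_set_B: "definable_set T \<Longrightarrow> definable_set (B n)"
proof (induction n)
  case 0
  have "definable_set {x. x = 0 \<or> x = 1 \<or> x = - 1}"
    by (intro definable_set_unary definable_intros)
  then have "definable_set (T \<union> {x. x = 0 \<or> x = 1 \<or> x = - 1})"
    by (rule definable_set_Un[OF 0])
  also have "T \<union> {x. x = 0 \<or> x = 1 \<or> x = - 1} = B 0"
    by auto
  finally show ?case .
next
  case (Suc n)
  have "definable_set {w. \<exists>x y z. w = x * y + z \<and> x \<in> B n \<and> y \<in> B n \<and> z \<in> B n}"
    by (rule definable_set_Ex3) (intro definable_intros Suc)
  then show ?case
    by (simp add: ring_stage.simps(2))
qed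

section \<open>Definability up to two exceptional cases\<close>

theorem definable_or_exceptional:
  assumes T: "definable_set T" and proper: "\<And>n. B n \<noteq> UNIV"
  obtains "admits_nontrivial_empty_definable_valuation TYPE('a)"
  | V where "c \<noteq> 0" "valring V" "V \<noteq> UNIV" "\<And>w. w \<in> val_units V \<Longrightarrow> (w - 1) / c \<in> H"
  | V N C \<epsilon> n where "quasi_absolute_value V N C" "\<epsilon> > 0" "\<And>y. \<lbrakk>y \<in> V; N y < \<epsilon>\<rbrakk> \<Longrightarrow> y \<in> H"
      "N (of_nat n) > 1"
proof -
  note cases = that
  have D_case: thesis if D: "valring D" "nonunits D \<subseteq> B 1"
    and y0: "y0 \<in> D" "y0 \<notin> H" "1 + c * y0 \<in> val_units D" for y0
  proof (cases "\<exists>n. B n = D")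
    case True
    then obtain n where n: "B n = D" ..
    then have "D \<noteq> UNIV" "definable_set D"
      using proper[of n] definable_set_B[OF T, of n] by auto
    then show thesis
      by (intro cases(1) valring.admits_definable_valuation[OF D(1)])
  next
    case False
    then have unbounded: "B n \<noteq> D" for n
      by blast
    show thesis
      by (rule rank_one_archimedean[OF D y0 unbounded]) (rule cases(3))
  qed
  have UNIV: "valring (UNIV :: 'a set)" "nonunits (UNIV :: 'a set) = {0}"
    by unfold_locales (auto simp: nonunits_def)
  obtain y0 where y0: "y0 \<notin> H" "1 + c * y0 \<noteq> 0"
    using H_proper by blast
  have y0_UNIV: "1 + c * y0 \<in> val_units UNIV"
    using y0(2) by (simp add: val_units_def)
  show thesis
  proof (cases "D = UNIV")
    case True
    have "{0} \<subseteq> B 1"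
      using ring_stage_01(1) by blast
    then show thesis
      using D_case[of y0] y0 y0_UNIV by (simp add: True UNIV)
  next
    case False
    \<comment> \<open>If \<open>D\<close> were a field, comparison with the trivial valuation ring
      \<open>UNIV\<close> would give \<open>D = UNIV\<close>.\<close>
    have "\<exists>d\<in>D. d \<noteq> 0 \<and> inverse d \<notin> D"
    proof (rule ccontr)
      assume "\<not> ?thesis"
      then have inv: "inverse d \<in> D" if "d \<in> D" "d \<noteq> 0" for d
        using that by blast
      have "\<exists>e'\<in>D. 1 - e * e' \<in> nonunits UNIV" if "e \<in> D" "e \<notin> nonunits UNIV" for e
        using that inv[of e] by (intro bexI[of _ "inverse e"]) (auto simp: UNIV)
      then have "D = UNIV"
        by (rule valring_eq_D(1)[OF UNIV(1) subset_UNIV _ UNIV_I y0(1) y0_UNIV])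
      then show False
        using False by blast
    qed
    then obtain d where d: "d \<in> D" "d \<noteq> 0" "inverse d \<notin> D"
      by blast
    obtain V where V: "valring V" "D \<subseteq> V" "V \<noteq> UNIV"
      "\<And>e. \<lbrakk>e \<in> D; e \<notin> nonunits V\<rbrakk> \<Longrightarrow> \<exists>e'\<in>D. 1 - e * e' \<in> nonunits V"
      by (rule chevalley[OF D_one(1,2) D_add D_mult d]) (assumption | rule that)+
    show thesis
    proof (cases "\<exists>y\<in>V. y \<notin> H \<and> 1 + c * y \<in> val_units V")
      case True
      then obtain y where y: "y \<in> V" "y \<notin> H" "1 + c * y \<in> val_units V"
        by blast
      note eq = valring_eq_D[OF V(1,2,4) y]
      show thesis
        using D_case[of y] V(1) y eq by simp
    next
      case no: False
      show thesis
      proof (cases "c \<noteq> 0 \<and> (\<forall>w\<in>val_units V. (w - 1) / c \<in> H)")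
        case True
        then show thesis
          using cases(2)[OF _ V(1,3)] by blast
      next
        case False
        then show thesis
          using definable_if_H_contains_units_part[OF T V(1)] no by (intro cases(1)) blast
      qed
    qed
  qed
qed

end

section \<open>Bounded sets\<close>

locale field_neighbourhoods =
  fixes N :: "'a::field set set"
  assumes zero_nbhd: "U \<in> N \<Longrightarrow> 0 \<in> U"
    and V1: "\<Inter>N = {0}" "{0} \<notin> N"
    and V2: "\<lbrakk>U \<in> N; V \<in> N\<rbrakk> \<Longrightarrow> \<exists>W\<in>N. W \<subseteq> U \<inter> V"
    and V3: "U \<in> N \<Longrightarrow> \<exists>V\<in>N. \<forall>x\<in>V. \<forall>y\<in>V. x - y \<in> U"
    and V6: "U \<in> N \<Longrightarrow> \<exists>V\<in>N. \<forall>x y. x * y \<in> V \<longrightarrow> x \<in> U \<or> y \<in> U"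
begin

definition bounded_set :: "'a set \<Rightarrow> bool" where
  "bounded_set X \<longleftrightarrow> (\<forall>U\<in>N. \<exists>V\<in>N. \<forall>v\<in>V. \<forall>x\<in>X. v * x \<in> U)"

lemma bounded_setE:
  assumes "bounded_set X" "U \<in> N"
  obtains V where "V \<in> N" "\<And>v x. \<lbrakk>v \<in> V; x \<in> X\<rbrakk> \<Longrightarrow> v * x \<in> U"
proof -
  have "\<exists>V\<in>N. \<forall>v\<in>V. \<forall>x\<in>X. v * x \<in> U"
    using assms unfolding bounded_set_def by (rule bspec)
  then show ?thesis
    using that by (elim bexE) simp
qed

lemma nbhd_avoiding_1:
  obtains U where "U \<in> N" "1 \<notin> U"
  using V1(1) by (metis InterI one_neq_zero singletonD)

lemma bounded_set_not_UNIV: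
  assumes "bounded_set X"
  shows "X \<noteq> UNIV"
proof
  assume X: "X = UNIV"
  obtain U where U: "U \<in> N" "1 \<notin> U"
    by (rule nbhd_avoiding_1)
  obtain V where V: "V \<in> N" "\<And>v x. \<lbrakk>v \<in> V; x \<in> X\<rbrakk> \<Longrightarrow> v * x \<in> U"
    by (rule bounded_setE[OF assms U(1)]) (rule that)
  have "V \<noteq> {0}"
    using V(1) V1(2) by blast
  then obtain v where "v \<in> V" "v \<noteq> 0"
    using zero_nbhd[OF V(1)] by blast
  then have "v * inverse v \<in> U"
    by (intro V(2)) (simp_all add: X)
  then show False
    using U(2) \<open>v \<noteq> 0\<close> by simp
qed

lemma bounded_set_Un:
  assumes "bounded_set X" "bounded_set Y"
  shows "bounded_set (X \<union> Y)"
  unfolding bounded_set_def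
proof
  fix U
  assume U: "U \<in> N"
  obtain V where V: "V \<in> N" "\<And>v x. \<lbrakk>v \<in> V; x \<in> X\<rbrakk> \<Longrightarrow> v * x \<in> U"
    by (rule bounded_setE[OF assms(1) U]) (rule that)
  obtain V' where V': "V' \<in> N" "\<And>v x. \<lbrakk>v \<in> V'; x \<in> Y\<rbrakk> \<Longrightarrow> v * x \<in> U"
    by (rule bounded_setE[OF assms(2) U]) (rule that)
  obtain W where "W \<in> N" "W \<subseteq> V \<inter> V'"
    using V2[OF V(1) V'(1)] by blast
  then show "\<exists>W\<in>N. \<forall>w\<in>W. \<forall>x\<in>X \<union> Y. w * x \<in> U"
    using V(2) V'(2) by (intro bexI[of _ W]) auto
qed

lemma bounded_set_01: "bounded_set {0, 1, - 1}"
  unfolding bounded_set_def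
proof
  fix U
  assume U: "U \<in> N"
  obtain V where V: "V \<in> N" "\<forall>x\<in>V. \<forall>y\<in>V. x - y \<in> U"
    using V3[OF U] by blast
  have "v - 0 \<in> U" "0 - v \<in> U" if "v \<in> V" for v
    using V(2) that zero_nbhd[OF V(1)] by blast+
  then show "\<exists>V\<in>N. \<forall>v\<in>V. \<forall>x\<in>{0, 1, - 1}. v * x \<in> U"
    using V(1) zero_nbhd[OF U] by (intro bexI[of _ V]) auto
qed

lemma bounded_set_mult_add:
  assumes "bounded_set X"
  shows "bounded_set {x * y + z | x y z. x \<in> X \<and> y \<in> X \<and> z \<in> X}"
  unfolding bounded_set_def
proof
  fix U
  assume "U \<in> N"
  then obtain U1 where U1: "U1 \<in> N" "\<forall>x\<in>U1. \<forall>y\<in>U1. x - y \<in> U"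
    using V3 by blast
  obtain U2 where U2: "U2 \<in> N" "\<forall>x\<in>U2. \<forall>y\<in>U2. x - y \<in> U1"
    using V3[OF U1(1)] by blast
  have add: "x + y \<in> U" if "x \<in> U2" "y \<in> U2" for x y
  proof -
    have "x - 0 \<in> U1" "0 - y \<in> U1"
      using U2(2) that zero_nbhd[OF U2(1)] by blast+
    then have "x - 0 - (0 - y) \<in> U"
      using U1(2) by blast
    then show ?thesis
      by simp
  qed
  obtain V where V: "V \<in> N" "\<And>v x. \<lbrakk>v \<in> V; x \<in> X\<rbrakk> \<Longrightarrow> v * x \<in> U2"
    by (rule bounded_setE[OF assms U2(1)]) (rule that)
  obtain V' where V': "V' \<in> N" "\<And>v x. \<lbrakk>v \<in> V'; x \<in> X\<rbrakk> \<Longrightarrow> v * x \<in> V"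
    by (rule bounded_setE[OF assms V(1)]) (rule that)
  obtain W where W: "W \<in> N" "W \<subseteq> V \<inter> V'"
    using V2[OF V(1) V'(1)] by blast
  have "w * (x * y + z) \<in> U" if "w \<in> W" "x \<in> X" "y \<in> X" "z \<in> X" for w x y z
  proof -
    have "w * x * y \<in> U2" "w * z \<in> U2"
      using that W(2) V(2) V'(2) by blast+
    then show ?thesis
      using add by (simp add: distrib_left mult.assoc)
  qed
  then show "\<exists>W\<in>N. \<forall>w\<in>W. \<forall>x\<in>{x * y + z | x y z. x \<in> X \<and> y \<in> X \<and> z \<in> X}. w * x \<in> U"
    using W(1) by (intro bexI[of _ W]) auto
qed

text \<open>If \<open>v = (v t) (1 / t)\<close> is in \<open>V\<close>, one of the two factors is in
  \<open>W\<close>, and \<open>1 / t\<close> is not.\<close>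

lemma bounded_set_away_from_0:
  assumes "U0 \<in> N" "\<And>t. t \<in> X \<Longrightarrow> t \<noteq> 0 \<and> inverse t \<notin> U0"
  shows "bounded_set X"
  unfolding bounded_set_def
proof
  fix U
  assume "U \<in> N"
  then obtain W where W: "W \<in> N" "W \<subseteq> U \<inter> U0"
    using V2 assms(1) by blast
  obtain V where V: "V \<in> N" "\<forall>x y. x * y \<in> V \<longrightarrow> x \<in> W \<or> y \<in> W"
    using V6[OF W(1)] by blast
  have "v * t \<in> U" if "v \<in> V" "t \<in> X" for v t
  proof -
    have "v * t * inverse t = v"
      using assms(2)[OF that(2)] by simp
    then have "v * t * inverse t \<in> V"
      using that(1) by (simp only:)
    then show ?thesis
      using V(2) W(2) assms(2)[OF that(2)] by blast
  qed
  then show "\<exists>V\<in>N. \<forall>v\<in>V. \<forall>x\<in>X. v * x \<in> U"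
    using V(1) by blast
qed

text \<open>This rules out that \<open>G\<close> contains all nonzero elements, for then the whole
  subbase is cofinite. In an infinite field a cofinite \<open>V\<close> meets its translate by
  \<open>1\<close>, so \<open>1\<close> is a difference of elements of \<open>V\<close>; in a finite
  field the intersection \<open>{0}\<close> of all neighbourhoods would be a neighbourhood.\<close>

lemma not_all_cofinite:
  assumes "\<And>U. U \<in> N \<Longrightarrow> finite (- U)" and Inter: "\<And>F. \<lbrakk>F \<subseteq> N; F \<noteq> {}; finite F\<rbrakk> \<Longrightarrow> \<Inter>F \<in> N"
  shows False
proof (cases "finite (UNIV :: 'a set)")
  case True
  then have "finite (Pow (UNIV :: 'a set))"
    by (simp only: finite_Pow_iff)
  then have "finite N"
    by (rule rev_finite_subset) auto
  moreover have "N \<noteq> {}"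
    using nbhd_avoiding_1 by blast
  ultimately show False
    using Inter[of N] V1 by simp
next
  case False
  obtain U where U: "U \<in> N" "1 \<notin> U"
    by (rule nbhd_avoiding_1)
  obtain V where V: "V \<in> N" "\<forall>x\<in>V. \<forall>y\<in>V. x - y \<in> U"
    using V3[OF U(1)] by blast
  have "finite (- V \<union> (\<lambda>x. x + 1) ` (- V))"
    using assms(1)[OF V(1)] by simp
  then obtain x where x: "x \<notin> - V" "x \<notin> (\<lambda>x. x + 1) ` (- V)"
    using False ex_new_if_finite by blast
  have "x - 1 \<in> V"
  proof (rule ccontr)
    assume "x - 1 \<notin> V"
    then have "x - 1 + 1 \<in> (\<lambda>x. x + 1) ` (- V)"
      by blast
    then show False
      using x(2) by simp
  qed
  then have "x - (x - 1) \<in> U"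
    using V(2) x(1) by blast
  then show False
    using U(2) by simp
qed

end

lemma (in power_group) B_not_UNIV:
  assumes "field_neighbourhoods N" "U \<in> N" "\<And>t. t \<in> T \<Longrightarrow> t \<noteq> 0 \<and> inverse t \<notin> U"
  shows "B n \<noteq> UNIV"
proof -
  interpret field_neighbourhoods N
    by (rule assms(1))
  have "bounded_set (B n)"
  proof (induction n)
    case 0
    then show ?case
      using bounded_set_Un[OF bounded_set_away_from_0[OF assms(2,3)] bounded_set_01] by simp
  next
    case (Suc n)
    then show ?case
      unfolding ring_stage.simps by (rule bounded_set_mult_add)
  qed
  then show ?thesis
    by (rule bounded_set_not_UNIV)
qed

lemma cofinite_topology_generated_by:
  assumes "openin (topology_generated_by S) U" and S: "\<And>X. X \<in> S \<Longrightarrow> finite (- X)"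
  shows "U = {} \<or> finite (- U)"
proof -
  have "generate_topology_on S U"
    using assms(1) by (simp add: openin_topology_generated_by_iff)
  then show ?thesis
  proof (induction rule: generate_topology_on.induct)
    case (UN K)
    show ?case
    proof (cases "\<Union>K = {}")
      case False
      then obtain X where "X \<in> K" "X \<noteq> {}"
        by blast
      then have "finite (- X)"
        using UN.IH by blast
      then show ?thesis
        using \<open>X \<in> K\<close> by (auto intro: rev_finite_subset)
    qed simp
  qed (use S in \<open>auto simp: Compl_Int\<close>)
qed

section \<open>The Artin--Schreier case\<close>

lemma power_poly_artin_schreier:
  assumes "prime q"
  shows "power_poly q 0 (- 1) x = x ^ q - x"
proof -
  obtain r where r: "q = Suc (Suc r)"
    using prime_ge_2_nat[OF assms] by (metis add_2_eq_Suc le_Suc_ex)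
  have "(\<Sum>k<q - 1. of_nat ((q choose Suc k) div q) * (0 * x) ^ k) = (1 :: 'a)"
    by (simp add: r sum.lessThan_Suc_shift del: sum.lessThan_Suc)
  then show ?thesis
    by (simp add: power_poly_def)
qed

lemma definable_artin_schreier_group: "definable_set (artin_schreier_group q)"
proof -
  have "definable_set {y. \<exists>x :: 'a. y = x ^ q - x}"
    by (intro definable_set_Ex definable_intros)
  then show ?thesis
    by (simp add: artin_schreier_group_def)
qed

lemma definable_set_inverses:
  fixes S :: "'a::field set"
  assumes "definable_set S" "0 \<in> S"
  shows "definable_set {inverse y | y. y \<notin> S}"
proof -
  have "definable_set {t. \<exists>y. t * y = 1 \<and> y \<notin> S}"
    by (intro definable_set_Ex definable_intros assms(1))
  also have "{t. \<exists>y. t * y = 1 \<and> y \<notin> S} = {inverse y | y. y \<notin> S}"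
  proof (intro Set.set_eqI iffI)
    fix t
    assume "t \<in> {t. \<exists>y. t * y = 1 \<and> y \<notin> S}"
    then obtain y where "t * y = 1" "y \<notin> S"
      by blast
    moreover from this have "t = inverse y"
      using inverse_unique[of y t] by (simp add: mult.commute)
    ultimately show "t \<in> {inverse y | y. y \<notin> S}"
      by blast
  next
    fix t
    assume "t \<in> {inverse y | y. y \<notin> S}"
    then obtain y where "t = inverse y" "y \<notin> S"
      by blast
    moreover from this have "y \<noteq> 0"
      using assms(2) by auto
    ultimately show "t \<in> {t. \<exists>y. t * y = 1 \<and> y \<notin> S}"
      by (intro CollectI exI[of _ y]) simp
  qed
  finally show ?thesis .
qed

theorem artin_schreier_case:
  fixes q :: nat and N :: "'a::field set set"
  assumes q: "prime q" and char: "CHAR('a) = q"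
    and N: "field_neighbourhoods N" and G: "artin_schreier_group q \<in> N" "artin_schreier_group q \<noteq> (UNIV :: 'a set)"
  shows "admits_nontrivial_empty_definable_valuation TYPE('a)"
proof -
  let ?G = "artin_schreier_group q :: 'a set" and ?T = "{inverse y | y. y \<notin> (artin_schreier_group q :: 'a set)}"
  have add: "(x + y) ^ q = x ^ q + y ^ q" for x y :: 'a
    by (rule freshmans_dream) (use q char in simp_all)
  have q0: "(of_nat q :: 'a) = 0"
    using of_nat_CHAR[where 'a = 'a] by (simp add: char)
  interpret power_map q 0 "- 1 :: 'a"
    using q prime_ge_2_nat[OF q] q0
    by unfold_locales (auto intro: valring.neg_unit valring.one_unit)
  have c: "c = 0"
    using prime_gt_0_nat[OF q] by (simp add: c_def)
  have H: "H = ?G"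
    by (auto simp: H_def c power_poly_artin_schreier[OF q] artin_schreier_group_def)
  interpret power_group q 0 "- 1 :: 'a" ?T
  proof
    show "y + z * (1 + c * y) \<in> H" if yz: "y \<in> H" "z \<in> H" for y z
    proof -
      obtain a b where "y = a ^ q - a" "z = b ^ q - b"
        using yz by (auto simp: H artin_schreier_group_def)
      then have "y + z * (1 + c * y) = (a + b) ^ q - (a + b)"
        by (simp add: c add)
      then show ?thesis
        by (auto simp: H artin_schreier_group_def)
    qed
    show "- (y / (1 + c * y)) \<in> H" if y: "y \<in> H" for y
    proof -
      obtain a where a: "y = a ^ q - a"
        using y by (auto simp: H artin_schreier_group_def)
      have "a ^ q + (- a) ^ q = 0"
        using add[of a "- a"] zero_power[OF prime_gt_0_nat[OF q], where 'a = 'a] by simp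
      then have "(- a) ^ q = - (a ^ q)"
        by (rule minus_unique[symmetric])
      then have "- (y / (1 + c * y)) = (- a) ^ q - (- a)"
        by (simp only: a c) simp
      then show ?thesis
        unfolding H artin_schreier_group_def by blast
    qed
    show "\<exists>y. y \<notin> H \<and> 1 + c * y \<noteq> 0"
      using G(2) by (auto simp: H c)
    show "inverse y \<in> ?T" if "y \<notin> H" for y
      using that by (auto simp: H)
    show "\<exists>e y. y \<notin> H \<and> t = e * inverse y \<and> (\<forall>V. valring V \<longrightarrow> e \<in> V)" if t: "t \<in> ?T" for t
    proof -
      obtain y where "t = inverse y" "y \<notin> ?G"
        using t by blast
      then show ?thesis
        using valring.one_mem unfolding H by (intro exI[of _ 1] exI[of _ y]) auto
    qed
  qed
  have T: "definable_set ?T"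
    using definable_set_inverses[OF definable_artin_schreier_group] H_0 H by blast
  have away: "t \<noteq> 0 \<and> inverse t \<notin> ?G" if "t \<in> ?T" for t
    using that H_0 H by auto
  show ?thesis
  proof (rule definable_or_exceptional[OF T B_not_UNIV[OF N G(1) away]])
    show "?thesis" if "c \<noteq> 0"
      using that c by simp
    \<comment> \<open>By Ostrowski's theorem an absolute value exceeding \<open>1\<close> on an
      integer is nonzero at \<open>q\<close>, which is \<open>0\<close> in this field.\<close>
    fix V N C and n :: nat
    assume quasi: "quasi_absolute_value V N C" and "N (of_nat n :: 'a) > 1"
    interpret quasi_absolute_value V N C by (rule quasi)
    obtain s where s: "s > 0" "\<And>m::nat. m > 0 \<Longrightarrow> N (of_nat m) = real m powr s"
      by (rule ostrowski[OF \<open>N (of_nat n) > 1\<close>]) (rule that)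
    from s(2)[of q] show ?thesis
      using prime_gt_0_nat[OF q] by (simp add: q0 N_0)
  qed
qed

section \<open>The Kummer case\<close>

lemma definable_unit_powers: "definable_set (unit_powers q)"
proof -
  have "definable_set {y. \<exists>x :: 'a. y = x ^ q \<and> x \<noteq> 0}"
    by (intro definable_set_Ex definable_intros)
  then show ?thesis
    by (simp add: unit_powers_def)
qed

interpretation unit_powers: unit_subgroup "unit_powers q :: 'a::field set"
  for q
proof
  show "1 \<in> unit_powers q"
    unfolding unit_powers_def by (intro CollectI exI[of _ 1]) simp
  show "x * y \<in> unit_powers q" if xy: "x \<in> unit_powers q" "y \<in> unit_powers q" for x y :: 'a
  proof -
    obtain a b where "x = a ^ q" "a \<noteq> 0" "y = b ^ q" "b \<noteq> 0"
      using xy by (auto simp: unit_powers_def)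
    then show ?thesis
      unfolding unit_powers_def by (intro CollectI exI[of _ "a * b"]) (simp add: power_mult_distrib)
  qed
  show "inverse x \<in> unit_powers q" if x: "x \<in> unit_powers q" for x :: 'a
  proof -
    obtain a where "x = a ^ q" "a \<noteq> 0"
      using x by (auto simp: unit_powers_def)
    then show ?thesis
      unfolding unit_powers_def by (intro CollectI exI[of _ "inverse a"]) (simp add: power_inverse)
  qed
  show "0 \<notin> (unit_powers q :: 'a set)"
    by (auto simp: unit_powers_def)
qed

text \<open>Expand \<open>(1 + \<pi>) ^ q = 1\<close> and divide by \<open>\<pi>\<close>: all remaining terms but \<open>q\<close> and \<open>\<pi> ^ (q - 1)\<close> are
  divisible by \<open>q \<pi>\<close>.\<close>

lemma root_of_unity_ramification:
  fixes \<zeta> :: "'a::field"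
  assumes q: "prime q" and \<zeta>: "\<zeta> ^ q = 1" "\<zeta> \<noteq> 1" and V: "valring V" and q0: "(of_nat q :: 'a) \<noteq> 0"
  shows "of_nat q / (\<zeta> - 1) ^ (q - 1) \<in> val_units V"
proof -
  interpret valring V by (rule V)
  define \<pi> where "\<pi> = \<zeta> - 1"
  have \<pi>0: "\<pi> \<noteq> 0"
    using \<zeta>(2) by (simp add: \<pi>_def)
  have \<pi>V: "\<pi> \<in> V"
    unfolding \<pi>_def using \<zeta>(1) prime_gt_0_nat[OF q] by (intro diff_mem root_of_unity_mem one_mem)
  obtain r where r: "q = Suc (Suc r)"
    using prime_ge_2_nat[OF q] by (metis add_2_eq_Suc le_Suc_ex)
  define s :: 'a where "s = (\<Sum>k<r. of_nat ((q choose Suc (Suc k)) div q) * \<pi> ^ k)"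
  have sV: "s \<in> V"
    unfolding s_def by (intro sum_mem mult_mem of_nat_mem power_mem \<pi>V)
  have "(1 + \<pi> * 1) ^ q = 1 + \<pi> ^ q * power_poly q \<pi> (of_nat q / \<pi> ^ (q - 1)) 1"
    using \<pi>0 by (intro power_poly_eq[OF q, symmetric]) simp
  then have "power_poly q \<pi> (of_nat q / \<pi> ^ (q - 1)) 1 = 0"
    using \<pi>0 \<zeta>(1) by (simp add: \<pi>_def)
  moreover have "(\<Sum>k<q - 1. of_nat ((q choose Suc k) div q) * \<pi> ^ k) = 1 + \<pi> * s"
    by (simp add: r s_def sum.lessThan_Suc_shift sum_distrib_left mult_ac del: sum.lessThan_Suc)
  ultimately have "1 + of_nat q / \<pi> ^ (q - 1) * (1 + \<pi> * s) = 0"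
    by (simp add: power_poly_def)
  then have eq: "\<pi> ^ (q - 1) = - (of_nat q * (1 + \<pi> * s))"
    using \<pi>0 by (simp add: add_eq_0_iff field_simps)
  have q1: "q - 1 > 0"
    by (simp add: r)
  have unit: "1 + \<pi> * s \<in> val_units V"
  proof (cases "\<pi> \<in> nonunits V")
    case True
    then show ?thesis
      by (intro one_plus_unit nonunit_mult sV)
  next
    case False
    then have "\<pi> ^ (q - 1) \<in> val_units V"
      using \<pi>V by (intro power_unit) (simp add: unit_iff)
    then have "- (\<pi> ^ (q - 1)) \<in> val_units V"
      by (rule neg_unit)
    also have "- (\<pi> ^ (q - 1)) = (1 + \<pi> * s) * of_nat q"
      unfolding eq by simp
    finally show ?thesis
      by (rule unit_of_mult) (intro add_mem mult_mem one_mem of_nat_mem \<pi>V sV)+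
  qed
  have "of_nat q / \<pi> ^ (q - 1) = - inverse (1 + \<pi> * s)"
    unfolding eq using q0 by (simp add: divide_inverse mult.assoc[symmetric])
  then show ?thesis
    using neg_unit[OF inverse_unit[OF unit]] by (simp add: \<pi>_def)
qed

definition kummer_set :: "nat \<Rightarrow> 'a::field \<Rightarrow> 'a set" where
  "kummer_set q \<zeta> = {y. 1 + (\<zeta> - 1) ^ q * y \<in> unit_powers q}"

text \<open>Taking all roots of unity together avoids naming one of them by a parameter.\<close>

definition kummer_inverses :: "nat \<Rightarrow> 'a::field set" where
  "kummer_inverses q = {inverse y | y \<zeta>. \<zeta> ^ q = 1 \<and> \<zeta> \<noteq> 1 \<and> y \<notin> kummer_set q \<zeta>}"

lemma zero_in_kummer_set: "0 \<in> kummer_set q \<zeta>"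
  by (simp add: kummer_set_def unit_powers.G_1)

lemma definable_kummer_inverses: "definable_set (kummer_inverses q :: 'a::field set)"
proof -
  have "definable_set {t :: 'a. \<exists>y z. t * y = 1 \<and> z ^ q = 1 \<and> z \<noteq> 1 \<and> 1 + (z - 1) ^ q * y \<notin> unit_powers q}"
    by (intro definable_set_Ex2 definable_intros definable_unit_powers)
  also have "{t :: 'a. \<exists>y z. t * y = 1 \<and> z ^ q = 1 \<and> z \<noteq> 1 \<and> 1 + (z - 1) ^ q * y \<notin> unit_powers q} =
      kummer_inverses q"
  proof (intro Set.set_eqI iffI)
    fix t :: 'a
    assume "t \<in> kummer_inverses q"
    then obtain y z where "t = inverse y" "z ^ q = 1" "z \<noteq> 1" "y \<notin> kummer_set q z"
      by (auto simp: kummer_inverses_def)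
    moreover from this have "y \<noteq> 0"
      using zero_in_kummer_set by blast
    ultimately show "t \<in> {t. \<exists>y z. t * y = 1 \<and> z ^ q = 1 \<and> z \<noteq> 1 \<and> 1 + (z - 1) ^ q * y \<notin> unit_powers q}"
      by (intro CollectI exI[of _ y] exI[of _ z]) (simp add: kummer_set_def)
  next
    fix t :: 'a
    assume "t \<in> {t. \<exists>y z. t * y = 1 \<and> z ^ q = 1 \<and> z \<noteq> 1 \<and> 1 + (z - 1) ^ q * y \<notin> unit_powers q}"
    then obtain y z where *: "t * y = 1" "z ^ q = 1" "z \<noteq> 1" "1 + (z - 1) ^ q * y \<notin> unit_powers q"
      by blast
    then have "t = inverse y"
      using inverse_unique[of y t] by (simp add: mult.commute)
    then show "t \<in> kummer_inverses q"
      using * unfolding kummer_inverses_def kummer_set_def by blast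
  qed
  finally show ?thesis .
qed

lemma finite_roots_of_unity:
  assumes "q > 0"
  shows "finite {\<zeta> :: 'a::field. \<zeta> ^ q = 1}"
proof -
  have "monom 1 q - 1 \<noteq> (0 :: 'a poly)"
  proof
    assume "monom 1 q - 1 = (0 :: 'a poly)"
    then have "coeff (monom 1 q - 1 :: 'a poly) q = 0"
      by simp
    then show False
      using assms by simp
  qed
  then have "finite {\<zeta>. poly (monom 1 q - 1 :: 'a poly) \<zeta> = 0}"
    by (rule poly_roots_finite)
  then show ?thesis
    by (simp add: poly_monom)
qed

lemma square_powers_closed_imp_euclidean:
  fixes G :: "'a::field set"
  defines "G \<equiv> unit_powers 2"
  assumes all: "\<And>x. x \<noteq> 0 \<Longrightarrow> x \<in> G \<or> - x \<in> G" and neg: "- 1 \<notin> G"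
    and add: "\<And>x y. \<lbrakk>x \<in> G; y \<in> G\<rbrakk> \<Longrightarrow> x + y \<in> G"
  shows "euclidean_field TYPE('a)"
proof -
  define r :: "'a rel" where "r = {(x, y). x = y \<or> y - x \<in> G}"
  have not_both: "\<not> (x \<in> G \<and> - x \<in> G)" for x
    using unit_powers.G_divide[of "- x" 2 x] unit_powers.G_nonzero[of x 2] neg by (auto simp: G_def)
  have "field_ordering r"
    unfolding field_ordering_def linear_order_on_def partial_order_on_def preorder_on_def
  proof (intro conjI allI impI)
    show "refl_on UNIV r"
      by (auto simp: r_def refl_on_def)
    show "trans r"
    proof (rule transI)
      fix x y z
      assume "(x, y) \<in> r" "(y, z) \<in> r"
      then show "(x, z) \<in> r"
        using add[of "y - x" "z - y"] by (auto simp: r_def)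
    qed
    show "antisym r"
    proof (rule antisymI)
      fix x y
      assume "(x, y) \<in> r" "(y, x) \<in> r"
      then show "x = y"
        using not_both[of "y - x"] by (auto simp: r_def)
    qed
    show "total_on UNIV r"
      unfolding total_on_def
    proof (intro ballI impI)
      fix x y :: 'a
      assume "x \<noteq> y"
      then show "(x, y) \<in> r \<or> (y, x) \<in> r"
        using all[of "y - x"] by (auto simp: r_def)
    qed
    show "(x + z, y + z) \<in> r" if "(x, y) \<in> r" for x y z
      using that by (auto simp: r_def)
    show "(0, x * y) \<in> r" if "(0, x) \<in> r \<and> (0, y) \<in> r" for x y
      using that unit_powers.G_mult[of x 2 y] by (auto simp: r_def G_def)
  qed auto
  moreover have "positive_cone r = {x ^ 2 | x. True}"
    by (auto simp: positive_cone_def r_def G_def unit_powers_def)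
  ultimately show ?thesis
    unfolding euclidean_field_def by blast
qed

theorem kummer_case:
  fixes q :: nat and N :: "'a::field set set"
  assumes q: "prime q" and char: "CHAR('a) \<noteq> q" and \<zeta>: "\<zeta> ^ q = 1" "\<zeta> \<noteq> (1 :: 'a)"
    and N: "field_neighbourhoods N" and nbhd: "\<And>\<zeta>. \<lbrakk>\<zeta> ^ q = 1; \<zeta> \<noteq> 1\<rbrakk> \<Longrightarrow> kummer_set q \<zeta> \<in> N"
    and Inter: "\<And>F. \<lbrakk>F \<subseteq> N; F \<noteq> {}; finite F\<rbrakk> \<Longrightarrow> \<Inter>F \<in> N"
    and proper: "(x0 :: 'a) \<noteq> 0" "x0 \<notin> unit_powers q"
    and not_euclidean: "q = 2 \<Longrightarrow> \<not> euclidean_field TYPE('a)"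
  shows "admits_nontrivial_empty_definable_valuation TYPE('a)"
proof -
  let ?G = "unit_powers q :: 'a set" and ?T = "kummer_inverses q :: 'a set"
  define \<pi> u where "\<pi> = \<zeta> - 1" and "u = of_nat q / \<pi> ^ (q - 1)"
  have q_pos: "q > 0"
    by (rule prime_gt_0_nat[OF q])
  have \<pi>0: "\<pi> \<noteq> 0"
    using \<zeta>(2) by (simp add: \<pi>_def)
  have q0: "(of_nat q :: 'a) \<noteq> 0"
    using q char CHAR_not_1' prime_nat_iff by (auto simp: of_nat_eq_0_iff_char_dvd)
  interpret power_map q \<pi> u
    using q \<pi>0 root_of_unity_ramification[OF q \<zeta> _ q0] by unfold_locales (auto simp: u_def \<pi>_def)
  have P_eq: "1 + c * P x = (1 + \<pi> * x) ^ q" for x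
    unfolding c_def by (rule power_poly_eq[OF q u_\<pi>])
  have c0: "c \<noteq> 0"
    using \<pi>0 by (simp add: c_def)
  have kummer_iff: "y \<in> kummer_set q \<zeta> \<longleftrightarrow> 1 + c * y \<in> ?G" for y
    by (simp add: kummer_set_def c_def flip: \<pi>_def)
  have H: "H = kummer_set q \<zeta>"
  proof (intro Set.set_eqI iffI)
    fix y
    assume "y \<in> H"
    then obtain x where x: "y = P x" "1 + c * P x \<noteq> 0"
      by (auto simp: H_def)
    then have "1 + c * y = (1 + \<pi> * x) ^ q" "1 + \<pi> * x \<noteq> 0"
      using q_pos by (auto simp: P_eq)
    then show "y \<in> kummer_set q \<zeta>"
      unfolding kummer_iff unit_powers_def by blast
  next
    fix y
    assume "y \<in> kummer_set q \<zeta>"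
    then obtain g where g: "1 + c * y = g ^ q" "g \<noteq> 0"
      by (auto simp: kummer_iff unit_powers_def)
    then have "1 + c * P ((g - 1) / \<pi>) = 1 + c * y"
      using \<pi>0 by (simp add: P_eq)
    then have "P ((g - 1) / \<pi>) = y"
      using c0 by simp
    then show "y \<in> H"
      using g unfolding H_def by (intro CollectI exI[of _ "(g - 1) / \<pi>"]) simp
  qed
  have H_iff: "y \<in> H \<longleftrightarrow> 1 + c * y \<in> ?G" for y
    by (simp add: H kummer_iff)
  interpret power_group q \<pi> u ?T
  proof
    show "y + z * (1 + c * y) \<in> H" if "y \<in> H" "z \<in> H" for y z
    proof -
      have "1 + c * (y + z * (1 + c * y)) = (1 + c * y) * (1 + c * z)"
        by (simp add: algebra_simps)
      then show ?thesis
        using that unit_powers.G_mult by (simp add: H_iff)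
    qed
    show "- (y / (1 + c * y)) \<in> H" if "y \<in> H" for y
    proof -
      have "1 + c * y \<noteq> 0"
        using that unit_powers.G_nonzero[of "1 + c * y" q] by (simp add: H_iff)
      then have "1 + c * (- (y / (1 + c * y))) = inverse (1 + c * y)"
        by (simp add: field_simps)
      then show ?thesis
        using that unit_powers.G_inverse by (simp only: H_iff)
    qed
    show "\<exists>y. y \<notin> H \<and> 1 + c * y \<noteq> 0"
      using proper c0 by (intro exI[of _ "(x0 - 1) / c"]) (simp add: H_iff)
    show "inverse y \<in> ?T" if "y \<notin> H" for y
      using that \<zeta> unfolding H kummer_inverses_def by blast
    show "\<exists>e y. y \<notin> H \<and> t = e * inverse y \<and> (\<forall>V. valring V \<longrightarrow> e \<in> V)" if t: "t \<in> ?T" for t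
    proof -
      obtain y z where y: "t = inverse y" "z ^ q = 1" "z \<noteq> 1" "y \<notin> kummer_set q z"
        using t by (auto simp: kummer_inverses_def)
      let ?c' = "(z - 1) ^ q"
      have z0: "z - 1 \<noteq> 0"
        using y(3) by simp
      have "y * (?c' / c) \<notin> H"
        using y(4) c0 by (simp add: H_iff kummer_set_def mult.commute)
      moreover have "t = ?c' / c * inverse (y * (?c' / c))"
        using y(1) z0 c0 by (simp add: field_simps)
      \<comment> \<open>For both roots of unity the ratio of \<open>q\<close> to the power
        \<open>q - 1\<close> is a unit, so \<open>(z - 1) / \<pi>\<close> has a unit as a
        power.\<close>
      moreover have "?c' / c \<in> V" if V: "valring V" for V
      proof -
        interpret V: valring V by (rule V)
        have "of_nat q / \<pi> ^ (q - 1) / (of_nat q / (z - 1) ^ (q - 1)) \<in> val_units V"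
          unfolding \<pi>_def by (intro V.divide_unit root_of_unity_ramification q \<zeta> y V q0)
        also have "of_nat q / \<pi> ^ (q - 1) / (of_nat q / (z - 1) ^ (q - 1)) = ((z - 1) / \<pi>) ^ (q - 1)"
          using q0 by (simp add: power_divide)
        finally have "((z - 1) / \<pi>) ^ (q - 1) \<in> V"
          by (rule V.unit_mem)
        then have "(z - 1) / \<pi> \<in> V"
          using prime_ge_2_nat[OF q] by (subst (asm) V.power_mem_iff) auto
        then show ?thesis
          unfolding c_def power_divide[symmetric] by (rule V.power_mem)
      qed
      ultimately show ?thesis
        by blast
    qed
  qed
  let ?Z = "{z :: 'a. z ^ q = 1 \<and> z \<noteq> 1}"
  have "\<Inter>(kummer_set q ` ?Z) \<in> N"
    using nbhd \<zeta> finite_subset[OF _ finite_roots_of_unity[OF q_pos], of ?Z] by (intro Inter) auto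
  moreover have "t \<noteq> 0 \<and> inverse t \<notin> \<Inter>(kummer_set q ` ?Z)" if t: "t \<in> ?T" for t
  proof -
    obtain y z where "t = inverse y" "z ^ q = 1" "z \<noteq> 1" "y \<notin> kummer_set q z"
      using t by (auto simp: kummer_inverses_def)
    then show ?thesis
      using zero_in_kummer_set by auto
  qed
  ultimately have B: "B n \<noteq> UNIV" for n
    by (rule B_not_UNIV[OF N])
  \<comment> \<open>The archimedean argument controls units only up to sign, so the sign is built
    into the subgroup.\<close>
  define G' where "G' = {x. x \<in> ?G \<or> - x \<in> ?G}"
  have def_G': "definable_set G'"
    unfolding G'_def by (intro definable_set_unary definable_intros definable_unit_powers)
  interpret G': unit_subgroup G'
  proof
    show "1 \<in> G'" "0 \<notin> G'"
      using unit_powers.G_1 unit_powers.G_0 by (auto simp: G'_def)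
    show "x * y \<in> G'" if "x \<in> G'" "y \<in> G'" for x y
      using that unit_powers.G_mult[of x q y] unit_powers.G_mult[of "- x" q y]
        unit_powers.G_mult[of x q "- y"] unit_powers.G_mult[of "- x" q "- y"] by (auto simp: G'_def)
    show "inverse x \<in> G'" if "x \<in> G'" for x
      using that unit_powers.G_inverse[of x q] unit_powers.G_inverse[of "- x" q] by (auto simp: G'_def)
  qed
  have done_if_proper: ?thesis if "valring V" "val_units V \<subseteq> G'" "x \<noteq> 0" "x \<notin> G'" for V x
  proof -
    interpret units_in_subgroup V G'
      using that(1,2) by (simp add: units_in_subgroup_def units_in_subgroup_axioms_def G'.unit_subgroup_axioms)
    show ?thesis
      by (rule definable_if_units_in_subgroup[OF def_G' that(3,4)])
  qed
  have not_both: "\<not> ((\<forall>x. x \<noteq> 0 \<longrightarrow> x \<in> G') \<and> - 1 \<in> ?G)"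
  proof
    assume *: "(\<forall>x. x \<noteq> 0 \<longrightarrow> x \<in> G') \<and> - 1 \<in> ?G"
    then have "x0 \<in> ?G \<or> - 1 * - x0 \<in> ?G"
      using proper(1) unit_powers.G_mult[of "- 1" q "- x0"] by (auto simp: G'_def)
    then show False
      using proper(2) by simp
  qed
  show ?thesis
  proof (rule definable_or_exceptional[OF definable_kummer_inverses B])
    fix V
    assume V: "valring V" and VH: "\<And>w. w \<in> val_units V \<Longrightarrow> (w - 1) / c \<in> H"
    have sub: "val_units V \<subseteq> ?G"
      using VH c0 by (auto simp: H_iff)
    \<comment> \<open>As \<open>- 1\<close> is a unit of \<open>V\<close>, it is a
      \<open>q\<close>-th power, and then \<open>G'\<close> cannot contain every nonzero
      element.\<close>
    then have "- 1 \<in> ?G"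
      using valring.neg_unit[OF V valring.one_unit[OF V]] by blast
    then obtain x where "x \<noteq> 0" "x \<notin> G'"
      using not_both by blast
    then show ?thesis
      using done_if_proper[OF V] sub by (auto simp: G'_def)
  next
    fix V N C and \<epsilon> :: real and n :: nat
    assume quasi: "quasi_absolute_value V N C" and \<epsilon>: "\<epsilon> > 0"
      and near: "\<And>y. \<lbrakk>y \<in> V; N y < \<epsilon>\<rbrakk> \<Longrightarrow> y \<in> H" and n: "N (of_nat n :: 'a) > 1"
    interpret quasi_absolute_value V N C by (rule quasi)
    obtain s where s: "s > 0" "\<And>m::nat. m > 0 \<Longrightarrow> N (of_nat m) = real m powr s"
      by (rule ostrowski[OF n]) (rule that)
    have V: "valring V" ..
    \<comment> \<open>Archimedean absolute values do not vanish at \<open>q\<close>, so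
      \<open>q\<close> and with it \<open>c\<close> are units of \<open>V\<close>. A neighbourhood
      of \<open>0\<close> inside \<open>H\<close> thus becomes one of \<open>1\<close> inside the
      group of powers.\<close>
    have "of_nat q \<in> val_units V"
      using s(2)[OF q_pos] N_zero_iff[OF of_nat_mem, of q] q_pos by (simp add: unit_iff of_nat_mem)
    then have "c \<notin> nonunits V"
      using q_nonunit[OF V] by (auto simp: unit_iff)
    then have c: "c \<in> val_units V"
      using c_mem[OF V] by (simp add: unit_iff)
    interpret archimedean V N C ?G s "\<epsilon> * N c"
    proof
      show "0 < \<epsilon> * N c"
        using \<epsilon> N_pos[OF c] by simp
      show "w \<in> ?G" if "w \<in> V" "N (w - 1) < \<epsilon> * N c" for w
      proof -
        have "N ((w - 1) / c) < \<epsilon>"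
          using that N_pos[OF c] by (simp add: N_divide[OF diff_mem[OF _ one_mem] c] divide_less_eq)
        then have "(w - 1) / c \<in> H"
          using that(1) by (intro near divide_mem diff_mem one_mem c)
        then show ?thesis
          using c0 by (simp add: H_iff)
      qed
    qed (use s in auto)
    have units: "val_units V \<subseteq> G'"
      using neg_in_G by (auto simp: G'_def)
    show ?thesis
    proof (cases "\<exists>x. x \<noteq> 0 \<and> x \<notin> G'")
      case True
      then show ?thesis
        using done_if_proper[OF V units] by blast
    next
      case False
      then have neg: "- 1 \<notin> ?G"
        using not_both by blast
      have "q = 2"
      proof (rule ccontr)
        assume "q \<noteq> 2"
        then have "odd q"
          using q by (simp add: primes_dvd_imp_eq prime_odd_nat prime_gt_1_nat le_neq_implies_less prime_ge_2_nat)
        then have "- 1 = (- 1 :: 'a) ^ q"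
          by simp
        then show False
          using neg unfolding unit_powers_def by (metis (mono_tags, lifting) mem_Collect_eq neg_equal_0_iff_equal one_neq_zero)
      qed
      \<comment> \<open>\<open>one_plus_in_G\<close> treats \<open>1 + g\<close> only for
        \<open>g\<close> in \<open>V\<close>; otherwise \<open>1 / g\<close> is in \<open>V\<close>,
        and \<open>1 + g = g (1 + 1 / g)\<close>.\<close>
      have "x + y \<in> ?G" if xy: "x \<in> ?G" "y \<in> ?G" for x y
      proof -
        define g where "g = y / x"
        have g: "g \<in> ?G" "x \<noteq> 0" "g \<noteq> 0"
          using unit_powers.G_divide[OF xy(2,1)] unit_powers.G_nonzero[OF xy(1)]
            unit_powers.G_nonzero[OF xy(2)] by (simp_all add: g_def)
        have "1 + g \<in> ?G"
        proof (cases "g \<in> V")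
          case True
          then show ?thesis
            using one_plus_in_G[OF neg] g(1) by blast
        next
          case False
          then have "inverse g \<in> V"
            using mem_or_inverse by blast
          then have "1 + inverse g \<in> ?G"
            by (rule one_plus_in_G[OF neg _ unit_powers.G_inverse[OF g(1)]])
          then have "g * (1 + inverse g) \<in> ?G"
            by (rule unit_powers.G_mult[OF g(1)])
          then show ?thesis
            using g(3) by (simp add: distrib_left add.commute)
        qed
        then have "x * (1 + g) \<in> ?G"
          by (intro unit_powers.G_mult xy)
        then show ?thesis
          using g(2) by (simp add: g_def distrib_left)
      qed
      then have "euclidean_field TYPE('a)"
        using False neg \<open>q = 2\<close> by (intro square_powers_closed_imp_euclidean) (auto simp: G'_def)
      then show ?thesis
        using not_euclidean \<open>q = 2\<close> by blast
    qed
  qed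
qed

theorem corollary5p16:
  fixes q :: nat
    and G :: "'a::field set"
    and T :: "'a topology"
    and N :: "'a set set"
  assumes "prime q"
    and "(CHAR('a) = q \<and> G = artin_schreier_group q \<and> T = additive_group_topology G) \<or>
         (CHAR('a) \<noteq> q \<and> (\<exists>\<zeta>::'a. primitive_root_of_unity q \<zeta>) \<and> G = unit_powers q \<and>
          (q = 2 \<longrightarrow> \<not> euclidean_field TYPE('a)) \<and> T = multiplicative_group_topology G)"
    and "N = {U. openin T U \<and> 0 \<in> U}"
    and V1: "\<Inter>N = {0} \<and> {0} \<notin> N"
    and V2: "\<forall>U\<in>N. \<forall>V\<in>N. \<exists>W\<in>N. W \<subseteq> U \<inter> V"
    and V3: "\<forall>U\<in>N. \<exists>V\<in>N. {x - y | x y. x \<in> V \<and> y \<in> V} \<subseteq> U"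
    and V4: "\<forall>U\<in>N. \<forall>x y. \<exists>V\<in>N. {(x + a) * (y + b) | a b. a \<in> V \<and> b \<in> V} \<subseteq> {x * y + u | u. u \<in> U}"
    and V5: "\<forall>U\<in>N. \<forall>x. x \<noteq> 0 \<longrightarrow>
               (\<exists>V\<in>N. {inverse (x + a) | a. a \<in> V \<and> x + a \<noteq> 0} \<subseteq> {inverse x + u | u. u \<in> U})"
    and V6: "\<forall>U\<in>N. \<exists>V\<in>N. \<forall>x y. x * y \<in> V \<longrightarrow> x \<in> U \<or> y \<in> U"
  shows "admits_nontrivial_empty_definable_valuation TYPE('a)"
proof -
  note q = assms(1) and N_def = assms(3)
  have N: "field_neighbourhoods N"
  proof
    fix U
    assume U: "U \<in> N"
    then obtain V where "V \<in> N" "{x - y | x y. x \<in> V \<and> y \<in> V} \<subseteq> U"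
      using V3 by blast
    then show "\<exists>V\<in>N. \<forall>x\<in>V. \<forall>y\<in>V. x - y \<in> U"
      by (intro bexI[of _ V]) auto
    show "\<exists>V\<in>N. \<forall>x y. x * y \<in> V \<longrightarrow> x \<in> U \<or> y \<in> U"
      using V6 U by (rule bspec)
    show "\<exists>W\<in>N. W \<subseteq> U \<inter> V" if "V \<in> N" for V
      using V2 U that by (elim ballE) auto
    show "0 \<in> U"
      using U by (simp add: N_def)
  qed (use V1 in auto)
  have Inter: "\<Inter>F \<in> N" if "F \<subseteq> N" "F \<noteq> {}" "finite F" for F
    using that openin_Inter[of F T] by (auto simp: N_def)
  have not_cofinite: False if "T = topology_generated_by S" "\<And>X. X \<in> S \<Longrightarrow> finite (- X)" for S
  proof (rule field_neighbourhoods.not_all_cofinite[OF N _ Inter])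
    fix U
    assume "U \<in> N"
    then show "finite (- U)"
      using cofinite_topology_generated_by[of S U] that by (auto simp: N_def)
  qed
  from assms(2) show ?thesis
  proof (elim disjE conjE exE)
    assume char: "CHAR('a) = q" and G: "G = artin_schreier_group q" and T: "T = additive_group_topology G"
    have "openin T {(1 * x + 0) / (0 * x + 1) | x. x \<in> G \<and> 0 * x \<noteq> - 1}"
      unfolding T additive_group_topology_def
      by (intro topology_generated_by_Basis CollectI exI[of _ 1] exI[of _ 0] conjI refl) simp
    then have "openin T G"
      by simp
    moreover have "0 ^ q - 0 \<in> G"
      unfolding G artin_schreier_group_def by blast
    ultimately have "G \<in> N"
      using zero_power[OF prime_gt_0_nat[OF q], where 'a = 'a] by (simp add: N_def)
    moreover have "G \<noteq> UNIV"
    proof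
      assume UNIV: "G = UNIV"
      have "finite (- {(a * x + b) / (c * x + d) | x. x \<in> G \<and> c * x \<noteq> - d})"
        if det: "a * d - b * c \<noteq> 0" for a b c d
      proof -
        \<comment> \<open>The inverse fractional linear map gives the preimage of \<open>y\<close>.
          For \<open>c = 0\<close> the excluded value \<open>a / c\<close> is \<open>0\<close> by
          the convention on division, and omitting one point still leaves a cofinite set.\<close>
        have "y \<in> {(a * x + b) / (c * x + d) | x. x \<in> G \<and> c * x \<noteq> - d}" if y: "y \<noteq> a / c" for y
        proof -
          have nz: "c * y - a \<noteq> 0"
            using det y by (cases "c = 0") (auto simp: field_simps)
          define x where "x = (b - d * y) / (c * y - a)"
          have cx: "c * x + d = - (a * d - b * c) / (c * y - a)"
            using nz by (simp add: x_def field_simps)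
          have ax: "a * x + b = y * (- (a * d - b * c) / (c * y - a))"
            using nz by (simp add: x_def field_simps)
          have "c * x + d \<noteq> 0"
            using nz det by (simp add: cx)
          then have "c * x \<noteq> - d" "y = (a * x + b) / (c * x + d)"
            by (auto simp: eq_neg_iff_add_eq_0 ax cx)
          then show ?thesis
            using UNIV by blast
        qed
        then have "- {(a * x + b) / (c * x + d) | x. x \<in> G \<and> c * x \<noteq> - d} \<subseteq> {a / c}"
          by blast
        then show ?thesis
          by (rule finite_subset) simp
      qed
      then show False
        using not_cofinite[OF T[unfolded additive_group_topology_def]] by auto
    qed
    ultimately show ?thesis
      using artin_schreier_case[OF q char N] G by simp
  next
    fix \<zeta> :: 'a
    assume char: "CHAR('a) \<noteq> q" and \<zeta>: "primitive_root_of_unity q \<zeta>" and G: "G = unit_powers q"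
      and euclidean: "q = 2 \<longrightarrow> \<not> euclidean_field TYPE('a)" and T: "T = multiplicative_group_topology G"
    have \<zeta>': "\<zeta> ^ q = 1" "\<zeta> \<noteq> 1"
      using \<zeta> prime_gt_1_nat[OF q] by (auto simp: primitive_root_of_unity_def dest: spec[of _ 1])
    have nbhd: "kummer_set q z \<in> N" if z: "z ^ q = 1" "z \<noteq> 1" for z
    proof -
      let ?c = "(z - 1) ^ q"
      have c0: "?c \<noteq> 0"
        using z(2) by simp
      \<comment> \<open>The Kummer set is the image of \<open>G\<close> under the inverse of
        \<open>y \<mapsto> 1 + ?c * y\<close>, hence a member of the subbase.\<close>
      have "openin T {inverse ?c * x + - inverse ?c | x. x \<in> G}"
        unfolding T multiplicative_group_topology_def using c0
        by (intro topology_generated_by_Basis CollectI exI[of _ "inverse ?c"] exI[of _ "- inverse ?c"] conjI refl) simp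
      also have "{inverse ?c * x + - inverse ?c | x. x \<in> G} = kummer_set q z"
      proof (intro Set.set_eqI iffI)
        fix y
        assume "y \<in> kummer_set q z"
        then have "1 + ?c * y \<in> G" "y = inverse ?c * (1 + ?c * y) + - inverse ?c"
          using c0 by (simp_all add: kummer_set_def G distrib_left)
        then show "y \<in> {inverse ?c * x + - inverse ?c | x. x \<in> G}"
          by blast
      next
        fix y
        assume "y \<in> {inverse ?c * x + - inverse ?c | x. x \<in> G}"
        then obtain x where x: "y = inverse ?c * x + - inverse ?c" "x \<in> G"
          by blast
        then have "1 + ?c * y = x"
          using c0 by (simp add: distrib_left right_diff_distrib)
        then show "y \<in> kummer_set q z"
          using x(2) by (simp add: kummer_set_def G)
      qed
      finally show ?thesis
        by (simp add: N_def zero_in_kummer_set)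
    qed
    have "\<exists>x. x \<noteq> 0 \<and> x \<notin> G"
    proof (rule ccontr)
      assume "\<not> ?thesis"
      have "finite (- {a * x + b | x. x \<in> G})" if "a \<noteq> 0" for a b
      proof -
        have "y \<in> {a * x + b | x. x \<in> G}" if "y \<noteq> b" for y
        proof -
          have "(y - b) / a \<noteq> 0"
            using \<open>a \<noteq> 0\<close> \<open>y \<noteq> b\<close> by simp
          then have "(y - b) / a \<in> G"
            using \<open>\<not> (\<exists>x. x \<noteq> 0 \<and> x \<notin> G)\<close> by blast
          moreover have "y = a * ((y - b) / a) + b"
            using \<open>a \<noteq> 0\<close> by simp
          ultimately show ?thesis
            by blast
        qed
        then have "- {a * x + b | x. x \<in> G} \<subseteq> {b}"
          by blast
        then show ?thesis
          by (rule finite_subset) simp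
      qed
      then show False
        using not_cofinite[OF T[unfolded multiplicative_group_topology_def]] by auto
    qed
    then obtain x0 where "x0 \<noteq> 0" "x0 \<notin> G"
      by blast
    then show ?thesis
      using euclidean by (intro kummer_case[OF q char \<zeta>' N nbhd Inter]) (simp_all add: G)
  qed
qed

end
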